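(* For a countable commutative ring $R$ with unity, the following are equivalent over $\mathsf{RCA}_0$: (1) every pair $a,b\in R$ has a gcd $d$, and there are $x,y\in R$ with $ax+by=d$; (2) every finite set $A\subseteq R$ has a gcd $d$, and $d\in(A)$; (3) for all $a,b\in R$ there exists $d$ such that $(a)+(b)=(d)$; (4) every finitely generated $\Sigma^0_1$-ideal is principal.
   Context: $\mathsf{RCA}_0$: basic arithmetic, $\Sigma^0_1$-induction, $\Delta^0_1$-comprehension. For a finite $A\subseteq R$, $b=\gcd(A)$ means $b$ divides every $a\in A$ and every such common divisor divides $b$. $(A)=\{a_1r_1+\cdots+a_nr_n:a_i\in A,r_i\in R\}$; $(a)=\{ar:r\in R\}$; $(a)+(b)=\{ar+bs:r,s\in R\}$. A $\Sigma^0_1$-ideal is a sequence $\langle a_0,a_1,\ldots\rangle$ in $R$ such that for all $i,j,r,s$ some $a_k=a_ir+a_js$; it is finitely generated if it equals $(c_0,\ldots,c_{n-1})$ for some finite list, and principal if it equals $(c)$ for some $c$, equality meaning mutual inclusion of memberships. *)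

theory Defs
  imports Main
begin

section \<open>The language of second-order arithmetic\<close>

text \<open>
  Two-sorted syntax with de Bruijn indices. Number variables and set variables are indexed
  independently: a number quantifier does not shift set indices, nor conversely.
  Equality of sets is not primitive.
\<close>

datatype tm = Var nat | Zero | One | Plus tm tm | Times tm tm

datatype fm =
    Eq tm tm
  | Less tm tm
  | Mem tm nat
  | Fls
  | Imp fm fm
  | AllN fm
  | AllS fm

abbreviation Neg :: "fm \<Rightarrow> fm" where "Neg \<phi> \<equiv> Imp \<phi> Fls"
abbreviation And :: "fm \<Rightarrow> fm \<Rightarrow> fm" where "And \<phi> \<psi> \<equiv> Neg (Imp \<phi> (Neg \<psi>))"
abbreviation Or :: "fm \<Rightarrow> fm \<Rightarrow> fm" where "Or \<phi> \<psi> \<equiv> Imp (Neg \<phi>) \<psi>"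
abbreviation Iff :: "fm \<Rightarrow> fm \<Rightarrow> fm" where "Iff \<phi> \<psi> \<equiv> And (Imp \<phi> \<psi>) (Imp \<psi> \<phi>)"
abbreviation ExN :: "fm \<Rightarrow> fm" where "ExN \<phi> \<equiv> Neg (AllN (Neg \<phi>))"
abbreviation ExS :: "fm \<Rightarrow> fm" where "ExS \<phi> \<equiv> Neg (AllS (Neg \<phi>))"

primrec sub_tm :: "(nat \<Rightarrow> tm) \<Rightarrow> tm \<Rightarrow> tm" where
  "sub_tm \<sigma> (Var i) = \<sigma> i"
| "sub_tm \<sigma> Zero = Zero"
| "sub_tm \<sigma> One = One"
| "sub_tm \<sigma> (Plus s t) = Plus (sub_tm \<sigma> s) (sub_tm \<sigma> t)"
| "sub_tm \<sigma> (Times s t) = Times (sub_tm \<sigma> s) (sub_tm \<sigma> t)"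

abbreviation lift_tm :: "tm \<Rightarrow> tm" where "lift_tm \<equiv> sub_tm (\<lambda>i. Var (Suc i))"

text \<open>Simultaneous capture-avoiding substitution of terms for number variables and of
  set variables for set variables.\<close>

primrec sub :: "(nat \<Rightarrow> tm) \<Rightarrow> (nat \<Rightarrow> nat) \<Rightarrow> fm \<Rightarrow> fm" where
  "sub \<sigma> \<rho> (Eq s t) = Eq (sub_tm \<sigma> s) (sub_tm \<sigma> t)"
| "sub \<sigma> \<rho> (Less s t) = Less (sub_tm \<sigma> s) (sub_tm \<sigma> t)"
| "sub \<sigma> \<rho> (Mem t X) = Mem (sub_tm \<sigma> t) (\<rho> X)"
| "sub \<sigma> \<rho> Fls = Fls"
| "sub \<sigma> \<rho> (Imp \<phi> \<psi>) = Imp (sub \<sigma> \<rho> \<phi>) (sub \<sigma> \<rho> \<psi>)"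
| "sub \<sigma> \<rho> (AllN \<phi>) = AllN (sub (case_nat (Var 0) (\<lambda>i. lift_tm (\<sigma> i))) \<rho> \<phi>)"
| "sub \<sigma> \<rho> (AllS \<phi>) = AllS (sub \<sigma> (case_nat 0 (\<lambda>i. Suc (\<rho> i))) \<phi>)"

abbreviation instN :: "tm \<Rightarrow> fm \<Rightarrow> fm" where "instN t \<equiv> sub (case_nat t Var) (\<lambda>i. i)"
abbreviation instS :: "nat \<Rightarrow> fm \<Rightarrow> fm" where "instS Y \<equiv> sub Var (case_nat Y (\<lambda>i. i))"
abbreviation liftN :: "fm \<Rightarrow> fm" where "liftN \<equiv> sub (\<lambda>i. Var (Suc i)) (\<lambda>i. i)"
abbreviation liftS :: "fm \<Rightarrow> fm" where "liftS \<equiv> sub Var Suc"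


section \<open>Provability\<close>

text \<open>
  Hilbert calculus for classical two-sorted first-order logic with equality on numbers.
  Generalization is unrestricted, so a non-logical axiom with free variables is used as its
  universal closure.
\<close>

inductive proves :: "fm set \<Rightarrow> fm \<Rightarrow> bool" (infix "\<turnstile>" 40) for T where
  Ax: "\<phi> \<in> T \<Longrightarrow> T \<turnstile> \<phi>"
| MP: "T \<turnstile> Imp \<phi> \<psi> \<Longrightarrow> T \<turnstile> \<phi> \<Longrightarrow> T \<turnstile> \<psi>"
| GenN: "T \<turnstile> \<phi> \<Longrightarrow> T \<turnstile> AllN \<phi>"
| GenS: "T \<turnstile> \<phi> \<Longrightarrow> T \<turnstile> AllS \<phi>"
| K: "T \<turnstile> Imp \<phi> (Imp \<psi> \<phi>)"
| S: "T \<turnstile> Imp (Imp \<phi> (Imp \<psi> \<chi>)) (Imp (Imp \<phi> \<psi>) (Imp \<phi> \<chi>))"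
| DN: "T \<turnstile> Imp (Neg (Neg \<phi>)) \<phi>"
| AllN_inst: "T \<turnstile> Imp (AllN \<phi>) (instN t \<phi>)"
| AllN_dist: "T \<turnstile> Imp (AllN (Imp \<phi> \<psi>)) (Imp (AllN \<phi>) (AllN \<psi>))"
| AllN_vac: "T \<turnstile> Imp \<phi> (AllN (liftN \<phi>))"
| AllS_inst: "T \<turnstile> Imp (AllS \<phi>) (instS Y \<phi>)"
| AllS_dist: "T \<turnstile> Imp (AllS (Imp \<phi> \<psi>)) (Imp (AllS \<phi>) (AllS \<psi>))"
| AllS_vac: "T \<turnstile> Imp \<phi> (AllS (liftS \<phi>))"
| Eq_refl: "T \<turnstile> Eq t t"
| Eq_subst: "T \<turnstile> Imp (Eq s t) (Imp (instN s \<phi>) (instN t \<phi>))"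


section \<open>Formulas written with bound variables\<close>

text \<open>
  A formula is written as a function of the numbers \<open>k\<close>, \<open>l\<close> of enclosing number and set
  quantifiers. The variable bound at level \<open>k\<close> has de Bruijn index \<open>k' - Suc k\<close> when it occurs
  below \<open>k'\<close> quantifiers, so Isabelle binders can be used for object-level quantification.
\<close>

type_synonym ntm = "nat \<Rightarrow> tm"
type_synonym svar = "nat \<Rightarrow> nat"
type_synonym form = "nat \<Rightarrow> nat \<Rightarrow> fm"

definition all_n :: "(ntm \<Rightarrow> form) \<Rightarrow> form" (binder "\<^bold>\<forall>" 10) where
  "all_n F = (\<lambda>k l. AllN (F (\<lambda>k'. Var (k' - Suc k)) (Suc k) l))"

definition all_s :: "(svar \<Rightarrow> form) \<Rightarrow> form" (binder "\<^bold>\<forall>\<^sub>S" 10) where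
  "all_s F = (\<lambda>k l. AllS (F (\<lambda>l'. l' - Suc l) k (Suc l)))"

definition ex_n :: "(ntm \<Rightarrow> form) \<Rightarrow> form" (binder "\<^bold>\<exists>" 10) where
  "ex_n F = (\<lambda>k l. ExN (F (\<lambda>k'. Var (k' - Suc k)) (Suc k) l))"

definition ex_s :: "(svar \<Rightarrow> form) \<Rightarrow> form" (binder "\<^bold>\<exists>\<^sub>S" 10) where
  "ex_s F = (\<lambda>k l. ExS (F (\<lambda>l'. l' - Suc l) k (Suc l)))"

definition not_f :: "form \<Rightarrow> form" ("\<^bold>\<not> _" [40] 40) where
  "(\<^bold>\<not> \<phi>) = (\<lambda>k l. Neg (\<phi> k l))"

definition and_f :: "form \<Rightarrow> form \<Rightarrow> form" (infixr "\<^bold>\<and>" 35) where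
  "(\<phi> \<^bold>\<and> \<psi>) = (\<lambda>k l. And (\<phi> k l) (\<psi> k l))"

definition or_f :: "form \<Rightarrow> form \<Rightarrow> form" (infixr "\<^bold>\<or>" 30) where
  "(\<phi> \<^bold>\<or> \<psi>) = (\<lambda>k l. Or (\<phi> k l) (\<psi> k l))"

definition imp_f :: "form \<Rightarrow> form \<Rightarrow> form" (infixr "\<^bold>\<longrightarrow>" 25) where
  "(\<phi> \<^bold>\<longrightarrow> \<psi>) = (\<lambda>k l. Imp (\<phi> k l) (\<psi> k l))"

definition iff_f :: "form \<Rightarrow> form \<Rightarrow> form" (infixr "\<^bold>\<longleftrightarrow>" 25) where
  "(\<phi> \<^bold>\<longleftrightarrow> \<psi>) = (\<lambda>k l. Iff (\<phi> k l) (\<psi> k l))"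

definition eq_f :: "ntm \<Rightarrow> ntm \<Rightarrow> form" (infix "\<^bold>=" 50) where
  "(s \<^bold>= t) = (\<lambda>k l. Eq (s k) (t k))"

definition less_f :: "ntm \<Rightarrow> ntm \<Rightarrow> form" (infix "\<^bold><" 50) where
  "(s \<^bold>< t) = (\<lambda>k l. Less (s k) (t k))"

definition mem_f :: "ntm \<Rightarrow> svar \<Rightarrow> form" (infix "\<^bold>\<in>" 50) where
  "(t \<^bold>\<in> X) = (\<lambda>k l. Mem (t k) (X l))"

definition zero_t :: ntm ("\<^bold>0") where "\<^bold>0 = (\<lambda>k. Zero)"
definition one_t :: ntm ("\<^bold>1") where "\<^bold>1 = (\<lambda>k. One)"

definition plus_t :: "ntm \<Rightarrow> ntm \<Rightarrow> ntm" (infixl "\<^bold>+" 65) where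
  "s \<^bold>+ t = (\<lambda>k. Plus (s k) (t k))"

definition times_t :: "ntm \<Rightarrow> ntm \<Rightarrow> ntm" (infixl "\<^bold>\<cdot>" 70) where
  "s \<^bold>\<cdot> t = (\<lambda>k. Times (s k) (t k))"

definition sentence :: "form \<Rightarrow> fm" where
  "sentence \<phi> = \<phi> 0 0"


section \<open>The theory \<open>RCA\<^sub>0\<close>\<close>

definition basic_axioms :: "fm set" where
  "basic_axioms = sentence ` {
     (\<^bold>\<forall>n. \<^bold>\<not> n \<^bold>+ \<^bold>1 \<^bold>= \<^bold>0),
     (\<^bold>\<forall>m n. m \<^bold>+ \<^bold>1 \<^bold>= n \<^bold>+ \<^bold>1 \<^bold>\<longrightarrow> m \<^bold>= n),
     (\<^bold>\<forall>m. m \<^bold>+ \<^bold>0 \<^bold>= m),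
     (\<^bold>\<forall>m n. m \<^bold>+ (n \<^bold>+ \<^bold>1) \<^bold>= (m \<^bold>+ n) \<^bold>+ \<^bold>1),
     (\<^bold>\<forall>m. m \<^bold>\<cdot> \<^bold>0 \<^bold>= \<^bold>0),
     (\<^bold>\<forall>m n. m \<^bold>\<cdot> (n \<^bold>+ \<^bold>1) \<^bold>= m \<^bold>\<cdot> n \<^bold>+ m),
     (\<^bold>\<forall>m. \<^bold>\<not> m \<^bold>< \<^bold>0),
     (\<^bold>\<forall>m n. m \<^bold>< n \<^bold>+ \<^bold>1 \<^bold>\<longleftrightarrow> m \<^bold>< n \<^bold>\<or> m \<^bold>= n)}"

inductive delta00 :: "fm \<Rightarrow> bool" where
  "delta00 (Eq s t)"
| "delta00 (Less s t)"
| "delta00 (Mem t X)"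
| "delta00 Fls"
| "delta00 \<phi> \<Longrightarrow> delta00 \<psi> \<Longrightarrow> delta00 (Imp \<phi> \<psi>)"
| "delta00 \<phi> \<Longrightarrow> delta00 (AllN (Imp (Less (Var 0) (lift_tm t)) \<phi>))"
| "delta00 \<phi> \<Longrightarrow> delta00 (ExN (And (Less (Var 0) (lift_tm t)) \<phi>))"

definition sigma01 :: "fm \<Rightarrow> bool" where
  "sigma01 \<phi> \<longleftrightarrow> (\<exists>\<theta>. delta00 \<theta> \<and> \<phi> = ExN \<theta>)"

definition pi01 :: "fm \<Rightarrow> bool" where
  "pi01 \<phi> \<longleftrightarrow> (\<exists>\<theta>. delta00 \<theta> \<and> \<phi> = AllN \<theta>)"

text \<open>In both schemes the distinguished number variable of \<open>\<phi>\<close> is \<open>Var 0\<close>; all other free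
  variables, of either sort, are parameters.\<close>

definition induction_axiom :: "fm \<Rightarrow> fm" where
  "induction_axiom \<phi> =
     Imp (And (instN Zero \<phi>)
              (AllN (Imp \<phi> (sub (case_nat (Plus (Var 0) One) (\<lambda>i. Var (Suc i))) (\<lambda>i. i) \<phi>))))
         (AllN \<phi>)"

definition comprehension_axiom :: "fm \<Rightarrow> fm \<Rightarrow> fm" where
  "comprehension_axiom \<phi> \<psi> =
     Imp (AllN (Iff \<phi> \<psi>)) (ExS (AllN (Iff (Mem (Var 0) 0) (liftS \<phi>))))"

definition RCA0 :: "fm set" where
  "RCA0 = basic_axioms
     \<union> {induction_axiom \<phi> |\<phi>. sigma01 \<phi>}
     \<union> {comprehension_axiom \<phi> \<psi> |\<phi> \<psi>. sigma01 \<phi> \<and> pi01 \<psi>}"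


section \<open>Sets, functions and finite sequences inside second-order arithmetic\<close>

type_synonym pred = "ntm \<Rightarrow> form"

definition in_set :: "svar \<Rightarrow> pred" where
  "in_set X = (\<lambda>x. x \<^bold>\<in> X)"

definition all_in :: "pred \<Rightarrow> (ntm \<Rightarrow> form) \<Rightarrow> form" where
  "all_in D F = (\<^bold>\<forall>x. D x \<^bold>\<longrightarrow> F x)"

definition ex_in :: "pred \<Rightarrow> (ntm \<Rightarrow> form) \<Rightarrow> form" where
  "ex_in D F = (\<^bold>\<exists>x. D x \<^bold>\<and> F x)"

syntax
  "_all_in" :: "pttrn \<Rightarrow> pred \<Rightarrow> form \<Rightarrow> form"  ("(3\<^bold>\<forall>_\<^bold>:_./ _)" [0, 51, 10] 10)
  "_ex_in" :: "pttrn \<Rightarrow> pred \<Rightarrow> form \<Rightarrow> form"  ("(3\<^bold>\<exists>_\<^bold>:_./ _)" [0, 51, 10] 10)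
translations
  "\<^bold>\<forall>x\<^bold>:D. F" \<rightleftharpoons> "CONST all_in D (\<lambda>x. F)"
  "\<^bold>\<exists>x\<^bold>:D. F" \<rightleftharpoons> "CONST ex_in D (\<lambda>x. F)"

text \<open>The usual injective pairing \<open>(i, j) = (i + j)\<^sup>2 + i\<close> of reverse mathematics.\<close>

definition pair :: "ntm \<Rightarrow> ntm \<Rightarrow> ntm" where
  "pair i j = (i \<^bold>+ j) \<^bold>\<cdot> (i \<^bold>+ j) \<^bold>+ i"

definition maps :: "svar \<Rightarrow> ntm \<Rightarrow> ntm \<Rightarrow> form" where
  "maps f x y = (pair x y \<^bold>\<in> f)"

text \<open>\<open>f \<subseteq> D \<times> C\<close> and every \<open>x \<in> D\<close> has exactly one image.\<close>

definition is_fun :: "svar \<Rightarrow> pred \<Rightarrow> pred \<Rightarrow> form" where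
  "is_fun f D C =
     ((\<^bold>\<forall>p\<^bold>:in_set f. \<^bold>\<exists>x\<^bold>:D. \<^bold>\<exists>y\<^bold>:C. p \<^bold>= pair x y) \<^bold>\<and>
      (\<^bold>\<forall>x\<^bold>:D. \<^bold>\<exists>y. maps f x y \<^bold>\<and> (\<^bold>\<forall>z. maps f x z \<^bold>\<longrightarrow> z \<^bold>= y)))"

definition numbers :: pred where
  "numbers = (\<lambda>i. i \<^bold>= i)"

definition is_seq :: "svar \<Rightarrow> ntm \<Rightarrow> pred \<Rightarrow> form" where
  "is_seq f n C = is_fun f (\<lambda>i. i \<^bold>< n) C"

definition is_finite :: "svar \<Rightarrow> form" where
  "is_finite X = (\<^bold>\<exists>k. \<^bold>\<forall>i\<^bold>:in_set X. i \<^bold>< k)"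

definition entry_of :: "svar \<Rightarrow> pred" where
  "entry_of f = (\<lambda>y. \<^bold>\<exists>i. maps f i y)"

definition times_p :: "pred \<Rightarrow> pred \<Rightarrow> pred" where
  "times_p D C = (\<lambda>p. \<^bold>\<exists>x\<^bold>:D. \<^bold>\<exists>y\<^bold>:C. p \<^bold>= pair x y)"

definition same :: "pred \<Rightarrow> pred \<Rightarrow> form" where
  "same A B = (\<^bold>\<forall>x. A x \<^bold>\<longleftrightarrow> B x)"


section \<open>Countable commutative rings\<close>

text \<open>A countable ring is given by a set of numbers, the graphs of its two operations, and two
  distinguished elements.\<close>

record ring_code =
  carrier :: svar
  add_graph :: svar
  mult_graph :: svar
  zero_elt :: ntm
  one_elt :: ntm

definition el :: "ring_code \<Rightarrow> pred" where
  "el R = in_set (carrier R)"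

definition add :: "ring_code \<Rightarrow> ntm \<Rightarrow> ntm \<Rightarrow> ntm \<Rightarrow> form" where
  "add R x y z = maps (add_graph R) (pair x y) z"

definition mult :: "ring_code \<Rightarrow> ntm \<Rightarrow> ntm \<Rightarrow> ntm \<Rightarrow> form" where
  "mult R x y z = maps (mult_graph R) (pair x y) z"

definition comm_ring_with_unity :: "ring_code \<Rightarrow> form" where
  "comm_ring_with_unity R =
     (is_fun (add_graph R) (times_p (el R) (el R)) (el R) \<^bold>\<and>
      is_fun (mult_graph R) (times_p (el R) (el R)) (el R) \<^bold>\<and>
      el R (zero_elt R) \<^bold>\<and> el R (one_elt R) \<^bold>\<and>
      (\<^bold>\<forall>x\<^bold>:el R. \<^bold>\<forall>y\<^bold>:el R. \<^bold>\<forall>z\<^bold>:el R.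
         \<^bold>\<exists>u v w. add R x y u \<^bold>\<and> add R u z w \<^bold>\<and> add R y z v \<^bold>\<and> add R x v w) \<^bold>\<and>
      (\<^bold>\<forall>x\<^bold>:el R. \<^bold>\<forall>y\<^bold>:el R. \<^bold>\<exists>u. add R x y u \<^bold>\<and> add R y x u) \<^bold>\<and>
      (\<^bold>\<forall>x\<^bold>:el R. add R x (zero_elt R) x) \<^bold>\<and>
      (\<^bold>\<forall>x\<^bold>:el R. \<^bold>\<exists>y\<^bold>:el R. add R x y (zero_elt R)) \<^bold>\<and>
      (\<^bold>\<forall>x\<^bold>:el R. \<^bold>\<forall>y\<^bold>:el R. \<^bold>\<forall>z\<^bold>:el R.
         \<^bold>\<exists>u v w. mult R x y u \<^bold>\<and> mult R u z w \<^bold>\<and> mult R y z v \<^bold>\<and> mult R x v w) \<^bold>\<and>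
      (\<^bold>\<forall>x\<^bold>:el R. \<^bold>\<forall>y\<^bold>:el R. \<^bold>\<exists>u. mult R x y u \<^bold>\<and> mult R y x u) \<^bold>\<and>
      (\<^bold>\<forall>x\<^bold>:el R. mult R x (one_elt R) x) \<^bold>\<and>
      (\<^bold>\<forall>x\<^bold>:el R. \<^bold>\<forall>y\<^bold>:el R. \<^bold>\<forall>z\<^bold>:el R.
         \<^bold>\<exists>s u v w. add R y z s \<^bold>\<and> mult R x s w \<^bold>\<and> mult R x y u \<^bold>\<and> mult R x z v \<^bold>\<and> add R u v w))"

definition all_rings :: "(ring_code \<Rightarrow> form) \<Rightarrow> form" (binder "\<^bold>\<forall>\<^sub>R" 10) where
  "all_rings F =
     (\<^bold>\<forall>\<^sub>S C A M. \<^bold>\<forall>z e.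
        let R = \<lparr>carrier = C, add_graph = A, mult_graph = M, zero_elt = z, one_elt = e\<rparr>
        in comm_ring_with_unity R \<^bold>\<longrightarrow> F R)"

text \<open>\<open>lin_comb R a x b y d\<close> expresses \<open>a x + b y = d\<close>.\<close>

definition lin_comb :: "ring_code \<Rightarrow> ntm \<Rightarrow> ntm \<Rightarrow> ntm \<Rightarrow> ntm \<Rightarrow> ntm \<Rightarrow> form" where
  "lin_comb R a x b y d = (\<^bold>\<exists>u v. mult R a x u \<^bold>\<and> mult R b y v \<^bold>\<and> add R u v d)"

definition divides :: "ring_code \<Rightarrow> ntm \<Rightarrow> ntm \<Rightarrow> form" where
  "divides R a b = (\<^bold>\<exists>r\<^bold>:el R. mult R a r b)"

definition is_gcd :: "ring_code \<Rightarrow> pred \<Rightarrow> ntm \<Rightarrow> form" where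
  "is_gcd R A b =
     (el R b \<^bold>\<and> (\<^bold>\<forall>a\<^bold>:A. divides R b a) \<^bold>\<and>
      (\<^bold>\<forall>c\<^bold>:el R. (\<^bold>\<forall>a\<^bold>:A. divides R c a) \<^bold>\<longrightarrow> divides R c b))"

definition doubleton :: "ntm \<Rightarrow> ntm \<Rightarrow> pred" where
  "doubleton a b = (\<lambda>x. x \<^bold>= a \<^bold>\<or> x \<^bold>= b)"

text \<open>
  The ideal \<open>(A)\<close>: \<open>b = a 0 r 0 + \<dots> + a (n - 1) r (n - 1)\<close> for finite sequences \<open>a\<close> in \<open>A\<close> and
  \<open>r\<close> in the ring; \<open>s\<close> is the sequence of partial sums. The length \<open>n\<close> is a number of the
  theory, and the empty sum is \<open>0\<close>.
\<close>

definition ideal_gen :: "ring_code \<Rightarrow> pred \<Rightarrow> pred" where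
  "ideal_gen R A = (\<lambda>b.
     \<^bold>\<exists>n. \<^bold>\<exists>\<^sub>S a r s.
       is_seq a n A \<^bold>\<and> is_seq r n (el R) \<^bold>\<and> is_seq s (n \<^bold>+ \<^bold>1) (el R) \<^bold>\<and>
       maps s \<^bold>0 (zero_elt R) \<^bold>\<and>
       (\<^bold>\<forall>i. i \<^bold>< n \<^bold>\<longrightarrow>
          (\<^bold>\<exists>x y p u v. maps a i x \<^bold>\<and> maps r i y \<^bold>\<and> mult R x y p \<^bold>\<and>
             maps s i u \<^bold>\<and> add R u p v \<^bold>\<and> maps s (i \<^bold>+ \<^bold>1) v)) \<^bold>\<and>
       maps s n b)"

definition principal_ideal :: "ring_code \<Rightarrow> ntm \<Rightarrow> pred" where
  "principal_ideal R a = (\<lambda>b. \<^bold>\<exists>r\<^bold>:el R. mult R a r b)"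

definition principal_sum :: "ring_code \<Rightarrow> ntm \<Rightarrow> ntm \<Rightarrow> pred" where
  "principal_sum R a b = (\<lambda>c. \<^bold>\<exists>r\<^bold>:el R. \<^bold>\<exists>s\<^bold>:el R. lin_comb R a r b s c)"

definition is_sigma01_ideal :: "ring_code \<Rightarrow> svar \<Rightarrow> form" where
  "is_sigma01_ideal R f =
     (is_fun f numbers (el R) \<^bold>\<and>
      (\<^bold>\<forall>i j. \<^bold>\<forall>r\<^bold>:el R. \<^bold>\<forall>s\<^bold>:el R.
         \<^bold>\<exists>k x y z. maps f i x \<^bold>\<and> maps f j y \<^bold>\<and> maps f k z \<^bold>\<and> lin_comb R x r y s z))"

definition is_finitely_generated :: "ring_code \<Rightarrow> svar \<Rightarrow> form" where
  "is_finitely_generated R f =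
     (\<^bold>\<exists>n. \<^bold>\<exists>\<^sub>S c. is_seq c n (el R) \<^bold>\<and> same (entry_of f) (ideal_gen R (entry_of c)))"

definition is_principal :: "ring_code \<Rightarrow> svar \<Rightarrow> form" where
  "is_principal R f = (\<^bold>\<exists>c\<^bold>:el R. same (entry_of f) (principal_ideal R c))"


section \<open>The four properties\<close>

definition pairs_have_bezout_gcd :: "ring_code \<Rightarrow> form" where
  "pairs_have_bezout_gcd R =
     (\<^bold>\<forall>a\<^bold>:el R. \<^bold>\<forall>b\<^bold>:el R. \<^bold>\<exists>d.
        is_gcd R (doubleton a b) d \<^bold>\<and> (\<^bold>\<exists>x\<^bold>:el R. \<^bold>\<exists>y\<^bold>:el R. lin_comb R a x b y d))"

definition finite_sets_have_bezout_gcd :: "ring_code \<Rightarrow> form" where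
  "finite_sets_have_bezout_gcd R =
     (\<^bold>\<forall>\<^sub>S A. is_finite A \<^bold>\<and> (\<^bold>\<forall>a\<^bold>:in_set A. el R a) \<^bold>\<longrightarrow>
        (\<^bold>\<exists>d. is_gcd R (in_set A) d \<^bold>\<and> ideal_gen R (in_set A) d))"

definition sums_of_principal_are_principal :: "ring_code \<Rightarrow> form" where
  "sums_of_principal_are_principal R =
     (\<^bold>\<forall>a\<^bold>:el R. \<^bold>\<forall>b\<^bold>:el R. \<^bold>\<exists>d\<^bold>:el R. same (principal_sum R a b) (principal_ideal R d))"

definition fg_sigma01_ideals_are_principal :: "ring_code \<Rightarrow> form" where
  "fg_sigma01_ideals_are_principal R =
     (\<^bold>\<forall>\<^sub>S f. is_sigma01_ideal R f \<^bold>\<and> is_finitely_generated R f \<^bold>\<longrightarrow> is_principal R f)"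

end

theory Submission
  imports Defs "HOL-Library.Countable_Set"
begin

text \<open>
  By completeness of the calculus it suffices to verify the sentence in every countable model of
  \<open>RCA\<^sub>0\<close>. In such a model bounded sets are coded by numbers, in the style of
  Goedel's beta function, so that membership in the ideal generated by a finite set \<open>X\<close> is a
  \<open>\<Sigma>\<^sup>0\<^sub>1\<close> property. Hence \<open>\<Sigma>\<^sup>0\<^sub>1\<close> induction on \<open>j\<close> shows that Bezout gcds of
  pairs yield some \<open>d \<in> (X)\<close> dividing all elements of \<open>X\<close> below \<open>j\<close>. In the other
  directions, \<open>\<Sigma>\<^sup>0\<^sub>1\<close> induction along the partial sums of a linear combination shows that
  common divisors of the generators divide every element of the ideal, and
  \<open>\<Delta>\<^sup>0\<^sub>1\<close> comprehension enumerates \<open>(a) + (b)\<close> as a \<open>\<Sigma>\<^sup>0\<^sub>1\<close> ideal.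
\<close>

section \<open>Substitution\<close>

text \<open>The model may be nonstandard, and this shapes everything after completeness. The length
  of a finite sum and the bound of a finite set are elements of the model, so no Isabelle induction
  reaches them; only the induction scheme does, and each use needs a certificate that its predicate
  is \<open>\<Sigma>\<^sup>0\<^sub>1\<close> with parameters. Membership in \<open>(X)\<close> is
  stated with set quantifiers over sequences of generators, coefficients and partial sums, hence has
  no such certificate as it stands. Coding each sequence by three numbers gives it one, and
  comprehension leads back from the numbers to the sets. The coding rests on a common multiple of
  the numbers up to \<open>b\<close>, which replaces the factorial, and on collection; both follow
  from \<open>\<Sigma>\<^sup>0\<^sub>1\<close> induction. Being a gcd is not stated in
  \<open>\<Sigma>\<^sup>0\<^sub>1\<close> form either, so the induction for finite sets tracks
  membership in the ideal and divisibility instead, and maximality is read off from the ideal.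
  Logically, (1) is equivalent to (2) and to (3), and (4) is tied in by (2) \<longrightarrow> (4)
  \<longrightarrow> (3).\<close>

lemma sub_tm_sub_tm: "sub_tm \<sigma> (sub_tm \<tau> t) = sub_tm (\<lambda>i. sub_tm \<sigma> (\<tau> i)) t"
  by (induction t) auto

lemma sub_tm_Var [simp]: "sub_tm Var t = t"
  by (induction t) auto

lemma case_nat_Var_Suc [simp]: "case_nat (Var 0) (\<lambda>i. Var (Suc i)) = Var"
  by (auto split: nat.split)

lemma case_nat_0_Suc [simp]: "case_nat 0 (\<lambda>i. Suc i) = (\<lambda>i. i)"
  by (auto split: nat.split)

lemma sub_Var [simp]: "sub Var (\<lambda>i. i) \<phi> = \<phi>"
  by (induction \<phi>) auto

lemma sub_sub:
  "sub \<sigma> \<rho> (sub \<sigma>' \<rho>' \<phi>) = sub (\<lambda>i. sub_tm \<sigma> (\<sigma>' i)) (\<lambda>i. \<rho> (\<rho>' i)) \<phi>"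
proof (induction \<phi> arbitrary: \<sigma> \<rho> \<sigma>' \<rho>')
  case (AllN \<phi>)
  have "(\<lambda>i. sub_tm (case_nat (Var 0) (\<lambda>i. lift_tm (\<sigma> i))) (case_nat (Var 0) (\<lambda>i. lift_tm (\<sigma>' i)) i))
      = case_nat (Var 0) (\<lambda>i. lift_tm (sub_tm \<sigma> (\<sigma>' i)))"
    by (auto simp: fun_eq_iff sub_tm_sub_tm split: nat.split)
  then show ?case by (simp add: AllN)
next
  case (AllS \<phi>)
  have "(\<lambda>i. case_nat 0 (\<lambda>i. Suc (\<rho> i)) (case_nat 0 (\<lambda>i. Suc (\<rho>' i)) i))
      = case_nat 0 (\<lambda>i. Suc (\<rho> (\<rho>' i)))"
    by (auto simp: fun_eq_iff split: nat.split)
  then show ?case by (simp add: AllS)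
qed (auto simp: sub_tm_sub_tm)

text \<open>A stand-in for free variables that serves both sorts at once: every index from
  \<open>N\<close> on is fresh for the formula, which is all that the choice of eigenvariables asks
  for.\<close>

definition supp :: "nat \<Rightarrow> fm \<Rightarrow> bool" where
  "supp N \<phi> \<longleftrightarrow> (\<forall>\<sigma> \<sigma>' \<rho> \<rho>'. (\<forall>i<N. \<sigma> i = \<sigma>' i \<and> \<rho> i = \<rho>' i) \<longrightarrow> sub \<sigma> \<rho> \<phi> = sub \<sigma>' \<rho>' \<phi>)"

lemma suppD: "supp N \<phi> \<Longrightarrow> (\<And>i. i < N \<Longrightarrow> \<sigma> i = \<sigma>' i \<and> \<rho> i = \<rho>' i) \<Longrightarrow> sub \<sigma> \<rho> \<phi> = sub \<sigma>' \<rho>' \<phi>"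
  unfolding supp_def by blast

lemma supp_mono: "supp N \<phi> \<Longrightarrow> N \<le> N' \<Longrightarrow> supp N' \<phi>"
  unfolding supp_def by (meson less_le_trans)

lemma sub_tm_finite_support: "\<exists>N. \<forall>\<sigma> \<sigma>'. (\<forall>i<N. \<sigma> i = \<sigma>' i) \<longrightarrow> sub_tm \<sigma> t = sub_tm \<sigma>' t"
proof (induction t)
  case (Plus s t)
  then obtain M N where "\<forall>\<sigma> \<sigma>'. (\<forall>i<M. \<sigma> i = \<sigma>' i) \<longrightarrow> sub_tm \<sigma> s = sub_tm \<sigma>' s"
    "\<forall>\<sigma> \<sigma>'. (\<forall>i<N. \<sigma> i = \<sigma>' i) \<longrightarrow> sub_tm \<sigma> t = sub_tm \<sigma>' t" by blast
  then show ?case by (intro exI[of _ "max M N"]) (simp add: less_max_iff_disj)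
next
  case (Times s t)
  then obtain M N where "\<forall>\<sigma> \<sigma>'. (\<forall>i<M. \<sigma> i = \<sigma>' i) \<longrightarrow> sub_tm \<sigma> s = sub_tm \<sigma>' s"
    "\<forall>\<sigma> \<sigma>'. (\<forall>i<N. \<sigma> i = \<sigma>' i) \<longrightarrow> sub_tm \<sigma> t = sub_tm \<sigma>' t" by blast
  then show ?case by (intro exI[of _ "max M N"]) (simp add: less_max_iff_disj)
qed auto

lemma sub_tm_finite_support2:
  "\<exists>N. \<forall>\<sigma> \<sigma>'. (\<forall>i<N. \<sigma> i = \<sigma>' i) \<longrightarrow> sub_tm \<sigma> s = sub_tm \<sigma>' s \<and> sub_tm \<sigma> t = sub_tm \<sigma>' t"
  using sub_tm_finite_support[of "Plus s t"] by simp

lemma supp_ex: "\<exists>N. supp N \<phi>"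
proof (induction \<phi>)
  case (Eq s t)
  then show ?case using sub_tm_finite_support2[of s t] unfolding supp_def by (simp, meson)
next
  case (Less s t)
  then show ?case using sub_tm_finite_support2[of s t] unfolding supp_def by (simp, meson)
next
  case (Mem t X)
  obtain N where "\<forall>\<sigma> \<sigma>'. (\<forall>i<N. \<sigma> i = \<sigma>' i) \<longrightarrow> sub_tm \<sigma> t = sub_tm \<sigma>' t"
    using sub_tm_finite_support by blast
  then have "supp (max N (Suc X)) (Mem t X)"
    unfolding supp_def by (simp add: less_max_iff_disj)
  then show ?case by blast
next
  case Fls
  then show ?case by (simp add: supp_def)
next
  case (Imp \<phi> \<psi>)
  then obtain M N where "supp M \<phi>" "supp N \<psi>" by blast
  then have "supp (max M N) \<phi>" "supp (max M N) \<psi>" by (auto elim: supp_mono)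
  then have "supp (max M N) (Imp \<phi> \<psi>)" by (simp add: supp_def)
  then show ?case by blast
next
  case (AllN \<phi>)
  then obtain N where N: "supp N \<phi>" by blast
  have "supp N (AllN \<phi>)"
    unfolding supp_def by (auto intro!: suppD[OF N] split: nat.split)
  then show ?case by blast
next
  case (AllS \<phi>)
  then obtain N where N: "supp N \<phi>" by blast
  have "supp N (AllS \<phi>)"
    unfolding supp_def by (auto intro!: suppD[OF N] split: nat.split)
  then show ?case by blast
qed


section \<open>Derived rules of the calculus\<close>

text \<open>Hypotheses are kept as an iterated implication and not added to \<open>T\<close>: with
  unrestricted generalization the deduction theorem fails for added open axioms, whereas here
  \<open>ded_Imp\<close> holds by computation.\<close>

definition ded :: "fm set \<Rightarrow> fm list \<Rightarrow> fm \<Rightarrow> bool" where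
  "ded T G \<phi> \<longleftrightarrow> T \<turnstile> foldr Imp G \<phi>"

lemma ded_single: "ded T [\<gamma>] \<phi> \<longleftrightarrow> T \<turnstile> Imp \<gamma> \<phi>"
  by (simp add: ded_def)

lemma ded_Imp: "ded T G (Imp \<phi> \<psi>) \<longleftrightarrow> ded T (G @ [\<phi>]) \<psi>"
  by (simp add: ded_def)

lemma ded_thm: "T \<turnstile> \<phi> \<Longrightarrow> ded T G \<phi>"
  by (induction G) (auto simp: ded_def intro: MP K)

lemma proves_ImpS: "T \<turnstile> Imp \<chi> (Imp \<phi> \<psi>) \<Longrightarrow> T \<turnstile> Imp \<chi> \<phi> \<Longrightarrow> T \<turnstile> Imp \<chi> \<psi>"
  by (meson MP S)

lemma proves_Imp_trans: "T \<turnstile> Imp \<phi> \<psi> \<Longrightarrow> T \<turnstile> Imp \<psi> \<chi> \<Longrightarrow> T \<turnstile> Imp \<phi> \<chi>"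
  by (meson MP S K)

lemma proves_Imp_refl: "T \<turnstile> Imp \<phi> \<phi>"
  by (rule MP[OF MP[OF S K] K])

lemma ded_S: "T \<turnstile> Imp (foldr Imp G (Imp \<phi> \<psi>)) (Imp (foldr Imp G \<phi>) (foldr Imp G \<psi>))"
proof (induction G)
  case Nil
  have "T \<turnstile> Imp (Imp \<phi> \<psi>) (Imp \<phi> \<psi>)" by (meson MP S K)
  then show ?case by simp
next
  case (Cons a G)
  then have "T \<turnstile> Imp a (Imp (foldr Imp G (Imp \<phi> \<psi>)) (Imp (foldr Imp G \<phi>) (foldr Imp G \<psi>)))"
    by (meson MP K)
  then have "T \<turnstile> Imp (Imp a (foldr Imp G (Imp \<phi> \<psi>))) (Imp a (Imp (foldr Imp G \<phi>) (foldr Imp G \<psi>)))"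
    by (meson MP S)
  then show ?case by (auto intro: proves_Imp_trans S)
qed

lemma ded_MP: "ded T G (Imp \<phi> \<psi>) \<Longrightarrow> ded T G \<phi> \<Longrightarrow> ded T G \<psi>"
  unfolding ded_def by (meson MP ded_S)

lemma ded_hyp: "\<phi> \<in> set G \<Longrightarrow> ded T G \<phi>"
proof (induction G)
  case (Cons a G)
  show ?case
  proof (cases "\<phi> \<in> set G")
    case True
    then have "ded T G \<phi>" using Cons by simp
    then show ?thesis by (simp add: ded_def) (meson MP K)
  next
    case False
    then have "\<phi> = a" using Cons by simp
    moreover have "T \<turnstile> Imp a (foldr Imp G a)"
    proof (induction G)
      case Nil
      show ?case by simp (meson MP S K)
    next
      case (Cons b G)
      then show ?case by simp (meson proves_Imp_trans K)
    qed
    ultimately show ?thesis by (simp add: ded_def)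
  qed
qed simp

lemma ded_classical: "ded T (G @ [Neg \<phi>]) Fls \<Longrightarrow> ded T G \<phi>"
  unfolding ded_Imp[symmetric] by (rule ded_MP[OF ded_thm[OF DN]])

lemma ded_FlsE: "ded T G Fls \<Longrightarrow> ded T G \<phi>"
  by (rule ded_MP[OF ded_thm[OF DN]], rule ded_MP[OF ded_thm[OF K]])

lemma proves_Imp_Neg_Neg: "T \<turnstile> Imp \<gamma> (Neg (Neg \<phi>)) \<Longrightarrow> T \<turnstile> Imp \<gamma> \<phi>"
  by (rule proves_Imp_trans[OF _ DN])

lemma proves_And1: "T \<turnstile> Imp (And \<phi> \<psi>) \<phi>"
proof -
  let ?G = "[And \<phi> \<psi>, Neg \<phi>]"
  have "ded T (?G @ [\<phi>]) (Neg \<psi>)"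
    by (rule ded_FlsE, rule ded_MP[of _ _ \<phi>]; rule ded_hyp; simp)
  then have "ded T ?G (Imp \<phi> (Neg \<psi>))"
    by (simp only: ded_Imp)
  moreover have "ded T ?G (And \<phi> \<psi>)"
    by (rule ded_hyp) simp
  ultimately have "ded T ?G Fls"
    by (rule ded_MP[rotated])
  then show ?thesis
    using ded_classical[of T "[And \<phi> \<psi>]"] by (simp add: ded_single)
qed

lemma proves_And2: "T \<turnstile> Imp (And \<phi> \<psi>) \<psi>"
proof -
  let ?G = "[And \<phi> \<psi>, Neg \<psi>]"
  have "ded T (?G @ [\<phi>]) (Neg \<psi>)"
    by (intro ded_hyp) simp
  then have "ded T ?G (Imp \<phi> (Neg \<psi>))"
    by (simp only: ded_Imp)
  moreover have "ded T ?G (And \<phi> \<psi>)"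
    by (rule ded_hyp) simp
  ultimately have "ded T ?G Fls"
    by (rule ded_MP[rotated])
  then show ?thesis
    using ded_classical[of T "[And \<phi> \<psi>]"] by (simp add: ded_single)
qed

lemma proves_And_Fls: "T \<turnstile> Imp (And \<gamma> \<phi>) Fls \<Longrightarrow> T \<turnstile> Imp \<gamma> (Neg \<phi>)"
  by (rule MP[OF DN])

section \<open>Renaming of variables and the eigenvariable rules\<close>

text \<open>Generalization binds index 0 only, so variables are renamed one at a time by binding and
  instantiating. The induction hypothesis is used with raised targets: they stay clear of index 0,
  where the original variable \<open>N\<close> has arrived, and fall back when \<open>f N\<close> is
  put for it. The indices from \<open>N\<close> on drop by \<open>N\<close>, one for each
  instantiation.\<close>

lemma proves_generalizeN:
  assumes "T \<turnstile> \<phi>"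
  shows "T \<turnstile> sub (\<lambda>i. if i < N then Var (f i) else Var (i - N)) (\<lambda>i. i) \<phi>"
proof (induction N arbitrary: f)
  case 0
  then show ?case using assms by simp
next
  case (Suc N)
  let ?\<sigma> = "\<lambda>i. if i < N then Var (Suc (f i)) else Var (i - N)"
  have "T \<turnstile> instN (Var (f N)) (sub ?\<sigma> (\<lambda>i. i) \<phi>)"
    by (rule MP[OF AllN_inst GenN[OF Suc]])
  moreover have "(\<lambda>i. sub_tm (case_nat (Var (f N)) Var) (?\<sigma> i))
      = (\<lambda>i. if i < Suc N then Var (f i) else Var (i - Suc N))"
  proof
    fix i
    show "sub_tm (case_nat (Var (f N)) Var) (?\<sigma> i) = (if i < Suc N then Var (f i) else Var (i - Suc N))"
    proof (cases "i < Suc N")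
      case False
      then obtain j where "i - N = Suc j" "i - Suc N = j" by (metis Suc_diff_Suc not_less_eq)
      then show ?thesis using False by simp
    qed (auto simp: less_Suc_eq)
  qed
  ultimately show ?case by (simp add: sub_sub)
qed

lemma proves_generalizeS:
  assumes "T \<turnstile> \<phi>"
  shows "T \<turnstile> sub Var (\<lambda>i. if i < N then f i else i - N) \<phi>"
proof (induction N arbitrary: f)
  case 0
  then show ?case using assms by simp
next
  case (Suc N)
  let ?\<sigma> = "\<lambda>i. if i < N then Suc (f i) else i - N"
  have "T \<turnstile> instS (f N) (sub Var ?\<sigma> \<phi>)"
    by (rule MP[OF AllS_inst GenS[OF Suc]])
  moreover have "(\<lambda>i. case_nat (f N) (\<lambda>i. i) (?\<sigma> i))
      = (\<lambda>i. if i < Suc N then f i else i - Suc N)"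
  proof
    fix i
    show "case_nat (f N) (\<lambda>i. i) (?\<sigma> i) = (if i < Suc N then f i else i - Suc N)"
    proof (cases "i < Suc N")
      case False
      then obtain j where "i - N = Suc j" "i - Suc N = j" by (metis Suc_diff_Suc not_less_eq)
      then show ?thesis using False by simp
    qed (auto simp: less_Suc_eq)
  qed
  ultimately show ?case by (simp add: sub_sub)
qed

text \<open>With \<open>N\<close> a support of the formula, the shift of the indices from
  \<open>N\<close> on cannot be seen, and an arbitrary renaming remains.\<close>

lemma proves_renameN: "T \<turnstile> \<phi> \<Longrightarrow> T \<turnstile> sub (\<lambda>i. Var (f i)) (\<lambda>i. i) \<phi>"
proof -
  assume a: "T \<turnstile> \<phi>"
  obtain N where "supp N \<phi>" using supp_ex by blast
  then have "sub (\<lambda>i. if i < N then Var (f i) else Var (i - N)) (\<lambda>i. i) \<phi> = sub (\<lambda>i. Var (f i)) (\<lambda>i. i) \<phi>"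
    by (rule suppD) auto
  then show ?thesis using proves_generalizeN[OF a, of N f] by simp
qed

lemma proves_renameS: "T \<turnstile> \<phi> \<Longrightarrow> T \<turnstile> sub Var f \<phi>"
proof -
  assume a: "T \<turnstile> \<phi>"
  obtain N where "supp N \<phi>" using supp_ex by blast
  then have "sub Var (\<lambda>i. if i < N then f i else i - N) \<phi> = sub Var f \<phi>"
    by (rule suppD) auto
  then show ?thesis using proves_generalizeS[OF a, of N f] by simp
qed

text \<open>The renaming moves the fresh index \<open>N\<close> to 0 and raises all others by one.
  On \<open>\<gamma>\<close> this is \<open>liftN\<close>, and on the instance of
  \<open>\<psi>\<close> it undoes the instantiation, so that generalization and
  \<open>AllN_vac\<close> finish.\<close>

lemma proves_AllN_fresh:
  assumes "supp N \<gamma>" "supp N \<psi>" "T \<turnstile> Imp \<gamma> (instN (Var N) \<psi>)"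
  shows "T \<turnstile> Imp \<gamma> (AllN \<psi>)"
proof -
  let ?f = "\<lambda>i. if i = N then 0 else Suc i"
  let ?\<sigma> = "\<lambda>i. Var (?f i)"
  have "sub ?\<sigma> (\<lambda>i. i) \<gamma> = liftN \<gamma>"
    by (rule suppD[OF assms(1)]) auto
  moreover have "sub (\<lambda>i. sub_tm ?\<sigma> (case_nat (Var N) Var i)) (\<lambda>i. i) \<psi> = sub Var (\<lambda>i. i) \<psi>"
    by (rule suppD[OF assms(2)]) (auto split: nat.split)
  then have "sub ?\<sigma> (\<lambda>i. i) (instN (Var N) \<psi>) = \<psi>"
    by (simp add: sub_sub)
  ultimately have "T \<turnstile> Imp (liftN \<gamma>) \<psi>"
    using proves_renameN[OF assms(3), of ?f] by simp
  then show ?thesis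
    by (rule proves_Imp_trans[OF AllN_vac MP[OF AllN_dist GenN]])
qed

lemma proves_AllS_fresh:
  assumes "supp N \<gamma>" "supp N \<psi>" "T \<turnstile> Imp \<gamma> (instS N \<psi>)"
  shows "T \<turnstile> Imp \<gamma> (AllS \<psi>)"
proof -
  let ?f = "\<lambda>i. if i = N then 0 else Suc i"
  have "sub Var ?f \<gamma> = liftS \<gamma>"
    by (rule suppD[OF assms(1)]) auto
  moreover have "sub Var (\<lambda>i. ?f (case_nat N (\<lambda>i. i) i)) \<psi> = sub Var (\<lambda>i. i) \<psi>"
    by (rule suppD[OF assms(2)]) (auto split: nat.split)
  then have "sub Var ?f (instS N \<psi>) = \<psi>"
    by (simp add: sub_sub)
  ultimately have "T \<turnstile> Imp (liftS \<gamma>) \<psi>"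
    using proves_renameS[OF assms(3), of ?f] by simp
  then show ?thesis
    by (rule proves_Imp_trans[OF AllS_vac MP[OF AllS_dist GenS]])
qed

section \<open>Completeness\<close>

instance tm :: countable by countable_datatype
instance fm :: countable by countable_datatype

definition consistent :: "fm set \<Rightarrow> fm \<Rightarrow> bool" where
  "consistent T \<gamma> \<longleftrightarrow> \<not> T \<turnstile> Imp \<gamma> Fls"

text \<open>The commitments made so far are the single formula \<open>\<gamma>\<close>, so an index
  that is fresh for it always exists. If \<open>\<gamma>\<close> refutes a universal
  \<open>\<phi>\<close>, the negated instance at a fresh variable is added as a counterexample; were
  this inconsistent, \<open>\<gamma>\<close> would prove the instance and, by the eigenvariable
  rule, \<open>\<phi>\<close> itself.\<close>

lemma henkin_step:
  assumes "consistent T \<gamma>"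
  shows "\<exists>\<gamma>'. consistent T \<gamma>' \<and> T \<turnstile> Imp \<gamma>' \<gamma> \<and>
    (T \<turnstile> Imp \<gamma>' \<phi> \<or>
     T \<turnstile> Imp \<gamma>' (Neg \<phi>) \<and>
     (\<forall>\<psi>. \<phi> = AllN \<psi> \<longrightarrow> (\<exists>t. T \<turnstile> Imp \<gamma>' (Neg (instN t \<psi>)))) \<and>
     (\<forall>\<psi>. \<phi> = AllS \<psi> \<longrightarrow> (\<exists>Y. T \<turnstile> Imp \<gamma>' (Neg (instS Y \<psi>)))))"
proof (cases "consistent T (And \<gamma> \<phi>)")
  case True
  then show ?thesis by (intro exI[of _ "And \<gamma> \<phi>"] conjI disjI1 proves_And1 proves_And2)
next
  case False
  then have neg: "T \<turnstile> Imp \<gamma> (Neg \<phi>)"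
    unfolding consistent_def by (blast intro: proves_And_Fls)
  have witness: "consistent T (And \<gamma> (Neg \<chi>))" if "T \<turnstile> Imp \<gamma> \<chi> \<Longrightarrow> T \<turnstile> Imp \<gamma> \<phi>" for \<chi>
  proof (rule ccontr)
    assume "\<not> consistent T (And \<gamma> (Neg \<chi>))"
    then have "T \<turnstile> Imp \<gamma> (Neg (Neg \<chi>))"
      unfolding consistent_def by (blast intro: proves_And_Fls)
    then have "T \<turnstile> Imp \<gamma> \<phi>" using that proves_Imp_Neg_Neg by blast
    then show False using assms neg proves_ImpS unfolding consistent_def by blast
  qed
  have new: "T \<turnstile> Imp (And \<gamma> \<chi>) (Neg \<phi>)" for \<chi>
    by (rule proves_Imp_trans[OF proves_And1 neg])
  obtain M where M: "supp M \<gamma>" using supp_ex by blast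
  show ?thesis
  proof (cases \<phi>)
    case (AllN \<psi>)
    obtain N where N: "supp N \<psi>" using supp_ex by blast
    have "consistent T (And \<gamma> (Neg (instN (Var (max M N)) \<psi>)))"
      unfolding AllN
      by (rule witness) (auto simp: AllN intro!: proves_AllN_fresh[of "max M N"] supp_mono[OF M] supp_mono[OF N])
    then show ?thesis
      using AllN new proves_And2
      by (intro exI[of _ "And \<gamma> (Neg (instN (Var (max M N)) \<psi>))"] conjI disjI2 proves_And1) (simp_all, blast)
  next
    case (AllS \<psi>)
    obtain N where N: "supp N \<psi>" using supp_ex by blast
    have "consistent T (And \<gamma> (Neg (instS (max M N) \<psi>)))"
      unfolding AllS
      by (rule witness) (auto simp: AllS intro!: proves_AllS_fresh[of "max M N"] supp_mono[OF M] supp_mono[OF N])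
    then show ?thesis
      using AllS new proves_And2
      by (intro exI[of _ "And \<gamma> (Neg (instS (max M N) \<psi>))"] conjI disjI2 proves_And1) (simp_all, blast)
  qed (use assms neg in \<open>auto intro!: exI[of _ \<gamma>] proves_Imp_refl\<close>)
qed

text \<open>Membership is made to obey the clauses of a truth definition over terms and set
  variables. The quantifier clauses are where the witnesses of the construction end up: a universal
  formula outside \<open>\<Gamma>\<close> has an instance outside \<open>\<Gamma>\<close>.\<close>

definition henkin_set :: "fm set \<Rightarrow> fm set \<Rightarrow> bool" where
  "henkin_set T \<Gamma> \<longleftrightarrow>
    (\<forall>\<phi>. T \<turnstile> \<phi> \<longrightarrow> \<phi> \<in> \<Gamma>) \<and> Fls \<notin> \<Gamma> \<and>
    (\<forall>\<phi> \<psi>. Imp \<phi> \<psi> \<in> \<Gamma> \<longleftrightarrow> (\<phi> \<in> \<Gamma> \<longrightarrow> \<psi> \<in> \<Gamma>)) \<and>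
    (\<forall>\<phi>. AllN \<phi> \<in> \<Gamma> \<longleftrightarrow> (\<forall>t. instN t \<phi> \<in> \<Gamma>)) \<and>
    (\<forall>\<phi>. AllS \<phi> \<in> \<Gamma> \<longleftrightarrow> (\<forall>Y. instS Y \<phi> \<in> \<Gamma>))"

text \<open>Stage \<open>n\<close> decides the formula with number \<open>n\<close>, starting from
  the negation of \<open>\<phi>\<^sub>0\<close>. Each stage implies its predecessors, so two
  consequences of stages follow from a common stage; this closes \<open>\<Gamma>\<close> under modus
  ponens, while the consistency of every stage keeps \<open>Fls\<close> out.\<close>

lemma henkin_set_exists:
  assumes "\<not> T \<turnstile> \<phi>\<^sub>0"
  obtains \<Gamma> where "henkin_set T \<Gamma>" "\<phi>\<^sub>0 \<notin> \<Gamma>"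
proof -
  have con0: "consistent T (Neg \<phi>\<^sub>0)"
    unfolding consistent_def using assms MP[OF DN] by blast
  define Q where "Q n \<gamma> \<gamma>' \<longleftrightarrow> T \<turnstile> Imp \<gamma>' \<gamma> \<and>
    (T \<turnstile> Imp \<gamma>' (from_nat n) \<or>
     T \<turnstile> Imp \<gamma>' (Neg (from_nat n)) \<and>
     (\<forall>\<psi>. from_nat n = AllN \<psi> \<longrightarrow> (\<exists>t. T \<turnstile> Imp \<gamma>' (Neg (instN t \<psi>)))) \<and>
     (\<forall>\<psi>. from_nat n = AllS \<psi> \<longrightarrow> (\<exists>Y. T \<turnstile> Imp \<gamma>' (Neg (instS Y \<psi>)))))" for n :: nat and \<gamma> \<gamma>'
  have "\<exists>g. \<forall>n. (consistent T (g n) \<and> (n = 0 \<longrightarrow> g n = Neg \<phi>\<^sub>0)) \<and> Q n (g n) (g (Suc n))"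
  proof (rule dependent_nat_choice)
    fix \<gamma> and n :: nat assume "consistent T \<gamma> \<and> (n = 0 \<longrightarrow> \<gamma> = Neg \<phi>\<^sub>0)"
    then show "\<exists>\<gamma>'. (consistent T \<gamma>' \<and> (Suc n = 0 \<longrightarrow> \<gamma>' = Neg \<phi>\<^sub>0)) \<and> Q n \<gamma> \<gamma>'"
      using henkin_step[of T \<gamma> "from_nat n"] unfolding Q_def by simp
  qed (simp add: con0)
  then obtain g where con: "\<And>n. consistent T (g n)" and g0: "g 0 = Neg \<phi>\<^sub>0"
    and g: "\<And>n. Q n (g n) (g (Suc n))"
    by blast
  have dec: "T \<turnstile> Imp (g (Suc n)) (g n)" for n
    using g[of n] unfolding Q_def by blast
  define \<Gamma> where "\<Gamma> = {\<phi>. \<exists>n. T \<turnstile> Imp (g n) \<phi>}"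
  have mono: "T \<turnstile> Imp (g (k + n)) (g n)" for k n
    by (induction k) (auto intro: proves_Imp_trans dec proves_Imp_refl)
  have step': "\<phi> \<in> \<Gamma> \<or> Neg \<phi> \<in> \<Gamma> \<and>
     (\<forall>\<psi>. \<phi> = AllN \<psi> \<longrightarrow> (\<exists>t. Neg (instN t \<psi>) \<in> \<Gamma>)) \<and>
     (\<forall>\<psi>. \<phi> = AllS \<psi> \<longrightarrow> (\<exists>Y. Neg (instS Y \<psi>) \<in> \<Gamma>))" for \<phi>
    using g[of "to_nat \<phi>"] unfolding Q_def \<Gamma>_def from_nat_to_nat by blast
  have thms: "\<phi> \<in> \<Gamma>" if "T \<turnstile> \<phi>" for \<phi>
    unfolding \<Gamma>_def using MP[OF K that] by blast
  have fls: "Fls \<notin> \<Gamma>"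
    unfolding \<Gamma>_def using con consistent_def by blast
  have mp: "\<psi> \<in> \<Gamma>" if prems: "Imp \<phi> \<psi> \<in> \<Gamma>" "\<phi> \<in> \<Gamma>" for \<phi> \<psi>
  proof -
    obtain m n where "T \<turnstile> Imp (g m) (Imp \<phi> \<psi>)" "T \<turnstile> Imp (g n) \<phi>"
      using prems unfolding \<Gamma>_def by blast
    then have "T \<turnstile> Imp (g (n + m)) (Imp \<phi> \<psi>)" "T \<turnstile> Imp (g (n + m)) \<phi>"
      using mono[of n m] mono[of m n] by (auto intro: proves_Imp_trans simp: add.commute)
    then show ?thesis unfolding \<Gamma>_def using proves_ImpS by blast
  qed
  have neg: "Neg \<phi> \<in> \<Gamma> \<longleftrightarrow> \<phi> \<notin> \<Gamma>" for \<phi>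
    using mp fls step' by blast
  have "Imp \<phi> \<psi> \<in> \<Gamma>" if "\<phi> \<in> \<Gamma> \<longrightarrow> \<psi> \<in> \<Gamma>" for \<phi> \<psi>
  proof (cases "\<psi> \<in> \<Gamma>")
    case True
    then show ?thesis using thms[OF K] mp by blast
  next
    case False
    then have "Neg \<phi> \<in> \<Gamma>" using that neg by blast
    moreover have "T \<turnstile> Imp (Neg \<phi>) (Imp \<phi> \<psi>)"
    proof -
      have "ded T [Neg \<phi>, \<phi>] \<psi>"
        by (rule ded_FlsE, rule ded_MP[of _ _ \<phi>]; rule ded_hyp; simp)
      then show ?thesis by (simp add: ded_def)
    qed
    ultimately show ?thesis using thms mp by blast
  qed
  moreover have "AllN \<phi> \<in> \<Gamma> \<longleftrightarrow> (\<forall>t. instN t \<phi> \<in> \<Gamma>)" for \<phi>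
    using step'[of "AllN \<phi>"] neg mp thms[OF AllN_inst] by blast
  moreover have "AllS \<phi> \<in> \<Gamma> \<longleftrightarrow> (\<forall>Y. instS Y \<phi> \<in> \<Gamma>)" for \<phi>
    using step'[of "AllS \<phi>"] neg mp thms[OF AllS_inst] by blast
  ultimately have "henkin_set T \<Gamma>"
    unfolding henkin_set_def using thms fls mp by blast
  moreover have "\<phi>\<^sub>0 \<notin> \<Gamma>"
  proof -
    have "T \<turnstile> Imp (g 0) (Neg \<phi>\<^sub>0)" unfolding g0 by (rule proves_Imp_refl)
    then show ?thesis using neg unfolding \<Gamma>_def by blast
  qed
  ultimately show thesis by (rule that)
qed

section \<open>Structures, satisfaction and the term model\<close>

locale arith_structure =
  fixes ze on :: 'm and pl ti :: "'m \<Rightarrow> 'm \<Rightarrow> 'm" and ls :: "'m \<Rightarrow> 'm \<Rightarrow> bool"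
    and mem :: "'m \<Rightarrow> 's \<Rightarrow> bool"
begin

primrec val :: "(nat \<Rightarrow> 'm) \<Rightarrow> tm \<Rightarrow> 'm" where
  "val e (Var i) = e i"
| "val e Zero = ze"
| "val e One = on"
| "val e (Plus s t) = pl (val e s) (val e t)"
| "val e (Times s t) = ti (val e s) (val e t)"

primrec sat :: "(nat \<Rightarrow> 'm) \<Rightarrow> (nat \<Rightarrow> 's) \<Rightarrow> fm \<Rightarrow> bool" where
  "sat e E (Eq s t) \<longleftrightarrow> val e s = val e t"
| "sat e E (Less s t) \<longleftrightarrow> ls (val e s) (val e t)"
| "sat e E (Mem t X) \<longleftrightarrow> mem (val e t) (E X)"
| "sat e E Fls \<longleftrightarrow> False"
| "sat e E (Imp \<phi> \<psi>) \<longleftrightarrow> (sat e E \<phi> \<longrightarrow> sat e E \<psi>)"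
| "sat e E (AllN \<phi>) \<longleftrightarrow> (\<forall>x. sat (case_nat x e) E \<phi>)"
| "sat e E (AllS \<phi>) \<longleftrightarrow> (\<forall>X. sat e (case_nat X E) \<phi>)"

lemma val_sub_tm: "val e (sub_tm \<sigma> t) = val (\<lambda>i. val e (\<sigma> i)) t"
  by (induction t) auto

lemma sat_sub: "sat e E (sub \<sigma> \<rho> \<phi>) \<longleftrightarrow> sat (\<lambda>i. val e (\<sigma> i)) (\<lambda>i. E (\<rho> i)) \<phi>"
proof (induction \<phi> arbitrary: e E \<sigma> \<rho>)
  case (AllN \<phi>)
  have "(\<lambda>i. val (case_nat x e) (case_nat (Var 0) (\<lambda>i. lift_tm (\<sigma> i)) i)) = case_nat x (\<lambda>i. val e (\<sigma> i))" for x
    by (auto simp: fun_eq_iff val_sub_tm split: nat.split)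
  then show ?case by (simp add: AllN)
next
  case (AllS \<phi>)
  have "(\<lambda>i. (case case i of 0 \<Rightarrow> 0 | Suc i \<Rightarrow> Suc (\<rho> i) of 0 \<Rightarrow> X | Suc x \<Rightarrow> E x)) = case_nat X (\<lambda>i. E (\<rho> i))" for X
    by (auto simp: fun_eq_iff split: nat.split)
  then show ?case by (simp add: AllS)
qed (auto simp: val_sub_tm)

end

text \<open>The successor axioms make the term model infinite, so its number sort can be taken to be
  all of \<open>nat\<close>; this avoids relativizing number quantifiers to a domain.\<close>

theorem countable_model_exists:
  fixes T :: "fm set"
  assumes succ0: "sentence (\<^bold>\<forall>n. \<^bold>\<not> n \<^bold>+ \<^bold>1 \<^bold>= \<^bold>0) \<in> T"
    and succ_inj: "sentence (\<^bold>\<forall>m n. m \<^bold>+ \<^bold>1 \<^bold>= n \<^bold>+ \<^bold>1 \<^bold>\<longrightarrow> m \<^bold>= n) \<in> T"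
    and "\<not> T \<turnstile> \<phi>\<^sub>0"
  obtains ze on :: nat and pl ti ls and mem :: "nat \<Rightarrow> nat \<Rightarrow> bool" and e E where
    "\<And>\<phi> e E. \<phi> \<in> T \<Longrightarrow> arith_structure.sat ze on pl ti ls mem e E \<phi>"
    "\<not> arith_structure.sat ze on pl ti ls mem e E \<phi>\<^sub>0"
proof -
  obtain \<Gamma> where "henkin_set T \<Gamma>" and \<phi>\<^sub>0: "\<phi>\<^sub>0 \<notin> \<Gamma>"
    using henkin_set_exists[OF assms(3)] by blast
  then have thms: "\<And>\<phi>. T \<turnstile> \<phi> \<Longrightarrow> \<phi> \<in> \<Gamma>" and fls: "Fls \<notin> \<Gamma>"
    and imp: "\<And>\<phi> \<psi>. Imp \<phi> \<psi> \<in> \<Gamma> \<longleftrightarrow> (\<phi> \<in> \<Gamma> \<longrightarrow> \<psi> \<in> \<Gamma>)"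
    and alln: "\<And>\<phi>. AllN \<phi> \<in> \<Gamma> \<longleftrightarrow> (\<forall>t. instN t \<phi> \<in> \<Gamma>)"
    and alls: "\<And>\<phi>. AllS \<phi> \<in> \<Gamma> \<longleftrightarrow> (\<forall>Y. instS Y \<phi> \<in> \<Gamma>)"
    unfolding henkin_set_def by auto
  define eqv where "eqv s t \<longleftrightarrow> Eq s t \<in> \<Gamma>" for s t
  have refl: "eqv t t" for t unfolding eqv_def by (rule thms[OF Eq_refl])
  have subst: "instN t \<phi> \<in> \<Gamma>" if "eqv s t" "instN s \<phi> \<in> \<Gamma>" for s t \<phi>
    using thms[OF Eq_subst, of s t \<phi>] that imp unfolding eqv_def by blast
  have lift: "sub_tm (case_nat s Var) (lift_tm t) = t" for s t
    by (simp add: sub_tm_sub_tm)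
  \<comment> \<open>Symmetry, transitivity and the congruences all come from \<open>Eq_subst\<close>
    applied to a formula with its hole at \<open>Var 0\<close>. The other terms are lifted, so that
    by \<open>lift\<close> the instantiation leaves them alone.\<close>
  have sym: "eqv t s" if "eqv s t" for s t
    using subst[OF that, of "Eq (Var 0) (lift_tm s)"] refl by (simp add: lift eqv_def)
  have trans: "eqv s u" if "eqv s t" "eqv t u" for s t u
    using subst[OF that(2), of "Eq (lift_tm s) (Var 0)"] that(1) by (simp add: lift eqv_def)
  have less_cong: "Less s' t' \<in> \<Gamma>" if "eqv s s'" "eqv t t'" "Less s t \<in> \<Gamma>" for s s' t t'
    using subst[OF that(2), of "Less (lift_tm s') (Var 0)"] subst[OF that(1), of "Less (Var 0) (lift_tm t)"] that(3)
    by (simp add: lift)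
  have mem_cong: "Mem s' X \<in> \<Gamma>" if "eqv s s'" "Mem s X \<in> \<Gamma>" for s s' X
    using subst[OF that(1), of "Mem (Var 0) X"] that(2) by simp
  have plus_cong: "eqv (Plus s t) (Plus s' t')" if "eqv s s'" "eqv t t'" for s s' t t'
    using subst[OF that(2), of "Eq (lift_tm (Plus s t)) (Plus (lift_tm s') (Var 0))"]
      subst[OF that(1), of "Eq (lift_tm (Plus s t)) (Plus (Var 0) (lift_tm t))"] refl[of "Plus s t"]
    by (simp add: lift eqv_def)
  have times_cong: "eqv (Times s t) (Times s' t')" if "eqv s s'" "eqv t t'" for s s' t t'
    using subst[OF that(2), of "Eq (lift_tm (Times s t)) (Times (lift_tm s') (Var 0))"]
      subst[OF that(1), of "Eq (lift_tm (Times s t)) (Times (Var 0) (lift_tm t))"] refl[of "Times s t"]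
    by (simp add: lift eqv_def)
  define cls where "cls t = {s. eqv t s}" for t
  have cls_eq: "cls s = cls t \<longleftrightarrow> eqv s t" for s t
    unfolding cls_def using refl sym trans by blast
  have s0: "\<not> eqv (Plus t One) Zero" for t
    using thms[OF Ax[OF succ0]]
    by (auto simp: eqv_def sentence_def all_n_def not_f_def eq_f_def plus_t_def one_t_def zero_t_def alln imp fls)
  have si: "eqv s t" if "eqv (Plus s One) (Plus t One)" for s t
  proof -
    have "Imp (Eq (Plus s One) (Plus t One)) (Eq s t) \<in> \<Gamma>"
      using thms[OF Ax[OF succ_inj]]
      by (auto simp: sentence_def all_n_def imp_f_def eq_f_def plus_t_def one_t_def alln imp lift)
    then show ?thesis using that by (auto simp: imp eqv_def)
  qed
  define num where "num n = ((\<lambda>t. Plus t One) ^^ n) Zero" for n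
  have "\<not> eqv (num m) (num n)" if "m < n" for m n
    using that
  proof (induction m arbitrary: n)
    case 0
    then show ?case using s0 sym by (cases n) (auto simp: num_def)
  next
    case (Suc m)
    then show ?case using si by (cases n) (auto simp: num_def)
  qed
  then have "inj (\<lambda>n. cls (num n))"
    by (auto simp: inj_def cls_eq) (metis linorder_neqE_nat sym)
  then have "infinite (range cls)"
    by (metis (no_types, lifting) finite_subset image_subsetI infinite_UNIV_nat finite_imageD rangeI)
  then have bij: "bij_betw (to_nat_on (range cls)) (range cls) UNIV"
    by (intro to_nat_on_infinite) auto
  define h where "h t = to_nat_on (range cls) (cls t)" for t
  have h_eq: "h s = h t \<longleftrightarrow> eqv s t" for s t
    using bij_betw_imp_inj_on[OF bij] by (auto simp: h_def cls_eq[symmetric] inj_on_def)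
  have "\<exists>t. h t = n" for n
    using bij_betw_imp_surj_on[OF bij] unfolding h_def by (metis (no_types, lifting) UNIV_I imageE rangeE)
  then obtain g where hg: "\<And>n. h (g n) = n" by metis
  have gh: "eqv (g (h t)) t" for t
    using hg h_eq by blast
  define pl where "pl m n = h (Plus (g m) (g n))" for m n
  define ti where "ti m n = h (Times (g m) (g n))" for m n
  define ls where "ls m n \<longleftrightarrow> Less (g m) (g n) \<in> \<Gamma>" for m n
  define mem where "mem m X \<longleftrightarrow> Mem (g m) X \<in> \<Gamma>" for m and X :: nat
  have h_pl: "pl (h s) (h t) = h (Plus s t)" and h_ti: "ti (h s) (h t) = h (Times s t)" for s t
    unfolding pl_def ti_def h_eq by (simp_all add: plus_cong times_cong gh)
  have h_ls: "ls (h s) (h t) \<longleftrightarrow> Less s t \<in> \<Gamma>" for s t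
    unfolding ls_def by (auto intro: less_cong[OF gh gh] less_cong[OF sym[OF gh] sym[OF gh]])
  have h_mem: "mem (h t) X \<longleftrightarrow> Mem t X \<in> \<Gamma>" for t X
    unfolding mem_def by (auto intro: mem_cong[OF gh] mem_cong[OF sym[OF gh]])
  interpret arith_structure "h Zero" "h One" pl ti ls mem .
  have val: "val (\<lambda>i. h (e i)) t = h (sub_tm e t)" for e t
  proof (induction t)
    case (Plus s t)
    then show ?case by (simp add: h_pl)
  next
    case (Times s t)
    then show ?case by (simp add: h_ti)
  qed auto
  \<comment> \<open>The truth lemma is proved for all environments of terms at once, because the
    quantifier cases change the environment. The set sort is not factored: its elements are the
    indices of the set variables themselves.\<close>
  have truth: "sat (\<lambda>i. h (e i)) E \<phi> \<longleftrightarrow> sub e E \<phi> \<in> \<Gamma>" for e E \<phi>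
  proof (induction \<phi> arbitrary: e E)
    case (Eq s t)
    show ?case by (simp add: val h_eq eqv_def)
  next
    case (Less s t)
    show ?case by (simp add: val h_ls)
  next
    case (Mem t X)
    show ?case by (simp add: val h_mem)
  next
    case Fls
    show ?case by (simp add: fls)
  next
    case (Imp \<phi> \<psi>)
    then show ?case by (simp add: imp)
  next
    case (AllN \<phi>)
    have 1: "case_nat (h t) (\<lambda>i. h (e i)) = (\<lambda>i. h (case_nat t e i))" for t
      by (auto simp: fun_eq_iff split: nat.split)
    have 2: "instN t (sub (case_nat (Var 0) (\<lambda>i. lift_tm (e i))) E \<phi>) = sub (case_nat t e) E \<phi>" for t
    proof -
      have "(\<lambda>i. sub_tm (case_nat t Var) (case_nat (Var 0) (\<lambda>i. lift_tm (e i)) i)) = case_nat t e"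
        by (auto simp: fun_eq_iff lift split: nat.split)
      then show ?thesis by (simp add: sub_sub)
    qed
    have "(\<forall>x. sat (case_nat x (\<lambda>i. h (e i))) E \<phi>) \<longleftrightarrow> (\<forall>t. sat (case_nat (h t) (\<lambda>i. h (e i))) E \<phi>)"
      using hg by metis
    then show ?case by (simp add: alln 1 2 AllN)
  next
    case (AllS \<phi>)
    have "instS Y (sub e (case_nat 0 (\<lambda>i. Suc (E i))) \<phi>) = sub e (case_nat Y E) \<phi>" for Y
    proof -
      have "(\<lambda>i. case_nat Y (\<lambda>i. i) (case_nat 0 (\<lambda>i. Suc (E i)) i)) = case_nat Y E"
        by (auto simp: fun_eq_iff split: nat.split)
      then show ?thesis by (simp add: sub_sub)
    qed
    then show ?case by (simp add: alls AllS)
  qed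
  have model: "sat e E \<phi>" if "\<phi> \<in> T" for \<phi> e E
  proof -
    \<comment> \<open>An axiom may have free variables and must hold in every environment, while
      \<open>truth\<close> gives theorems in the identity environment only. Applying
      \<open>GenN\<close> and reading the quantifier semantically frees the first \<open>k\<close>
      values, and a support of the formula shows that finitely many suffice. The fact
      \<open>S\<close> does the same for sets.\<close>
    have N: "sat (\<lambda>i. if i < k then e i else h (Var (i - k))) (\<lambda>i. i) \<chi>" if "T \<turnstile> \<chi>" for k \<chi> e
      using that
    proof (induction k arbitrary: e \<chi>)
      case 0
      then show ?case using truth[of Var "\<lambda>i. i" \<chi>] thms by simp
    next
      case (Suc k)
      have "case_nat (e 0) (\<lambda>i. if i < k then e (Suc i) else h (Var (i - k)))
          = (\<lambda>i. if i < Suc k then e i else h (Var (i - Suc k)))"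
        by (auto simp: fun_eq_iff split: nat.split)
      moreover have "sat (case_nat (e 0) (\<lambda>i. if i < k then e (Suc i) else h (Var (i - k)))) (\<lambda>i. i) \<chi>"
        using Suc.IH[OF GenN[OF Suc.prems], of "\<lambda>i. e (Suc i)"] unfolding sat.simps by blast
      ultimately show ?case by (simp only:)
    qed
    have S: "sat (\<lambda>i. if i < k then e i else h (Var (i - k))) (\<lambda>i. if i < l then E i else i - l) \<chi>"
      if "T \<turnstile> \<chi>" for k l \<chi> e E
      using that
    proof (induction l arbitrary: E \<chi>)
      case 0
      then show ?case using N by simp
    next
      case (Suc l)
      have "case_nat (E 0) (\<lambda>i. if i < l then E (Suc i) else i - l)
          = (\<lambda>i. if i < Suc l then E i else i - Suc l)"
        by (auto simp: fun_eq_iff split: nat.split)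
      moreover have "sat (\<lambda>i. if i < k then e i else h (Var (i - k)))
          (case_nat (E 0) (\<lambda>i. if i < l then E (Suc i) else i - l)) \<chi>"
        using Suc.IH[OF GenS[OF Suc.prems], of "\<lambda>i. E (Suc i)"] unfolding sat.simps by blast
      ultimately show ?case by (simp only:)
    qed
    obtain k where k: "supp k \<phi>" using supp_ex by blast
    let ?e = "\<lambda>i. if i < k then e i else h (Var (i - k))"
    have "sub (\<lambda>i. g (e i)) E \<phi> = sub (\<lambda>i. g (?e i)) (\<lambda>i. if i < k then E i else i - k) \<phi>"
      by (rule suppD[OF k]) auto
    then show ?thesis
      using truth[of "\<lambda>i. g (e i)" E \<phi>] truth[of "\<lambda>i. g (?e i)" _ \<phi>] S[OF Ax[OF that], of k e k E]
      by (simp only: hg)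
  qed
  have "\<not> sat (\<lambda>i. h (Var i)) (\<lambda>i. i) \<phi>\<^sub>0"
    using truth[of Var "\<lambda>i. i" \<phi>\<^sub>0] \<phi>\<^sub>0 by simp
  with model show thesis by (rule that)
qed


section \<open>Definable predicates in countable models\<close>

lemma lift_tm_sub_tm: "sub_tm (case_nat (Var 0) (\<lambda>i. lift_tm (\<sigma> i))) (lift_tm t) = lift_tm (sub_tm \<sigma> t)"
  by (simp add: sub_tm_sub_tm)

lemma delta00_sub: "delta00 \<phi> \<Longrightarrow> delta00 (sub \<sigma> \<rho> \<phi>)"
  by (induction arbitrary: \<sigma> \<rho> rule: delta00.induct)
    (simp_all add: delta00.intros lift_tm_sub_tm)

locale rca_model = arith_structure ze on pl ti ls mem
  for ze on :: "'m :: countable" and pl (infixl "\<oplus>" 65) and ti (infixl "\<otimes>" 70)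
    and ls (infix "\<prec>" 50) and mem :: "'m \<Rightarrow> 's :: countable \<Rightarrow> bool" (infix "\<epsilon>" 50) +
  assumes RCA0: "\<phi> \<in> RCA0 \<Longrightarrow> sat e E \<phi>"
begin

text \<open>A predicate on environments is \<open>delta0 n\<close> or \<open>sigma1 n\<close> if it is given by a bounded, respectively
  \<open>\<Sigma>\<^sup>0\<^sub>1\<close>, formula in the variables below \<open>n\<close>. As the model is countable, the
  remaining variables can be assigned all elements and all sets of the model at once, so
  arbitrary parameters are available.\<close>

definition env :: "nat \<Rightarrow> (nat \<Rightarrow> 'm) \<Rightarrow> nat \<Rightarrow> 'm" where
  "env n e = (\<lambda>i. if i < n then e i else from_nat (i - n))"

definition term_fun :: "nat \<Rightarrow> ((nat \<Rightarrow> 'm) \<Rightarrow> 'm) \<Rightarrow> bool" where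
  "term_fun n T \<longleftrightarrow> (\<exists>t. \<forall>e. T e = val (env n e) t)"

definition delta0 :: "nat \<Rightarrow> ((nat \<Rightarrow> 'm) \<Rightarrow> bool) \<Rightarrow> bool" where
  "delta0 n P \<longleftrightarrow> (\<exists>\<phi>. delta00 \<phi> \<and> (\<forall>e. P e \<longleftrightarrow> sat (env n e) from_nat \<phi>))"

definition sigma1 :: "nat \<Rightarrow> ((nat \<Rightarrow> 'm) \<Rightarrow> bool) \<Rightarrow> bool" where
  "sigma1 n P \<longleftrightarrow> (\<exists>Q. delta0 (Suc n) Q \<and> (\<forall>e. P e \<longleftrightarrow> (\<exists>x. Q (case_nat x e))))"

lemma case_nat_env: "case_nat x (env n e) = env (Suc n) (case_nat x e)"
  by (auto simp: env_def fun_eq_iff split: nat.split)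

section \<open>Closure properties of bounded predicates\<close>

lemma term_fun_const: "term_fun n (\<lambda>e. c)"
  unfolding term_fun_def by (rule exI[of _ "Var (n + to_nat c)"]) (simp add: env_def)

lemma term_fun_var: "j < n \<Longrightarrow> term_fun n (\<lambda>e. e j)"
  unfolding term_fun_def by (rule exI[of _ "Var j"]) (simp add: env_def)

lemma term_fun_pl: "term_fun n S \<Longrightarrow> term_fun n T \<Longrightarrow> term_fun n (\<lambda>e. S e \<oplus> T e)"
  unfolding term_fun_def by (metis val.simps(4))

lemma term_fun_ti: "term_fun n S \<Longrightarrow> term_fun n T \<Longrightarrow> term_fun n (\<lambda>e. S e \<otimes> T e)"
  unfolding term_fun_def by (metis val.simps(5))

lemma delta0_eq: "term_fun n S \<Longrightarrow> term_fun n T \<Longrightarrow> delta0 n (\<lambda>e. S e = T e)"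
  unfolding term_fun_def delta0_def by (metis sat.simps(1) delta00.intros(1))

lemma delta0_ls: "term_fun n S \<Longrightarrow> term_fun n T \<Longrightarrow> delta0 n (\<lambda>e. S e \<prec> T e)"
  unfolding term_fun_def delta0_def by (metis sat.simps(2) delta00.intros(2))

lemma delta0_mem: assumes "term_fun n T" shows "delta0 n (\<lambda>e. T e \<epsilon> X)"
proof -
  obtain t where "\<And>e. T e = val (env n e) t" using assms unfolding term_fun_def by blast
  then show ?thesis
    unfolding delta0_def by (intro exI[of _ "Mem t (to_nat X)"]) (simp add: delta00.intros)
qed

lemma delta0_False: "delta0 n (\<lambda>e. False)"
  unfolding delta0_def by (intro exI[of _ Fls]) (simp add: delta00.intros)

lemma delta0_imp: assumes "delta0 n P" "delta0 n Q" shows "delta0 n (\<lambda>e. P e \<longrightarrow> Q e)"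
proof -
  obtain \<phi> \<psi> where "delta00 \<phi>" "\<And>e. P e \<longleftrightarrow> sat (env n e) from_nat \<phi>"
    "delta00 \<psi>" "\<And>e. Q e \<longleftrightarrow> sat (env n e) from_nat \<psi>"
    using assms unfolding delta0_def by blast
  then show ?thesis
    unfolding delta0_def by (intro exI[of _ "Imp \<phi> \<psi>"]) (simp add: delta00.intros)
qed

lemma delta0_not: "delta0 n P \<Longrightarrow> delta0 n (\<lambda>e. \<not> P e)"
  using delta0_imp[OF _ delta0_False, of n P] by simp

lemma delta0_const: "delta0 n (\<lambda>e. c)"
  using delta0_False delta0_not[OF delta0_False] by (cases c) auto

lemma delta0_conj: "delta0 n P \<Longrightarrow> delta0 n Q \<Longrightarrow> delta0 n (\<lambda>e. P e \<and> Q e)"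
  using delta0_not[OF delta0_imp[OF _ delta0_not], of n P Q] by simp

lemma delta0_disj: "delta0 n P \<Longrightarrow> delta0 n Q \<Longrightarrow> delta0 n (\<lambda>e. P e \<or> Q e)"
  using delta0_imp[OF delta0_not, of n P Q] by (simp add: disj_imp)

lemma delta0_iff: "delta0 n P \<Longrightarrow> delta0 n Q \<Longrightarrow> delta0 n (\<lambda>e. P e \<longleftrightarrow> Q e)"
  using delta0_conj[OF delta0_imp[of n P Q] delta0_imp[of n Q P]] by (simp add: iff_conv_conj_imp)

text \<open>Stated for a predicate of the bound value and the outer environment, so that repeated
  resolution follows the quantifiers of a goal: in the premise the bound variable sits at index 0
  and the others have moved up by one.\<close>

lemma delta0_ball:
  assumes "term_fun n T" "delta0 (Suc n) (\<lambda>e. P (e 0) (\<lambda>i. e (Suc i)))"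
  shows "delta0 n (\<lambda>e. \<forall>x. x \<prec> T e \<longrightarrow> P x e)"
proof -
  obtain t \<phi> where t: "\<And>e. T e = val (env n e) t" and \<phi>: "delta00 \<phi>"
    "\<And>e. P (e 0) (\<lambda>i. e (Suc i)) \<longleftrightarrow> sat (env (Suc n) e) from_nat \<phi>"
    using assms unfolding term_fun_def delta0_def by blast
  have "P x e \<longleftrightarrow> sat (env (Suc n) (case_nat x e)) from_nat \<phi>" for x e
    using \<phi>(2)[of "case_nat x e"] by simp
  then show ?thesis
    unfolding delta0_def
    by (intro exI[of _ "AllN (Imp (Less (Var 0) (lift_tm t)) \<phi>)"])
      (simp add: delta00.intros \<phi>(1) t val_sub_tm case_nat_env[symmetric])
qed

lemma delta0_bex:
  assumes "term_fun n T" "delta0 (Suc n) (\<lambda>e. P (e 0) (\<lambda>i. e (Suc i)))"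
  shows "delta0 n (\<lambda>e. \<exists>x. x \<prec> T e \<and> P x e)"
  using delta0_not[OF delta0_ball[OF assms(1) delta0_not[OF assms(2)]]] by simp

text \<open>The indices from \<open>n\<close> on name parameters, so the substitution moves them to
  start at \<open>m\<close>, where \<open>env m\<close> gives them the same elements.\<close>

lemma delta0_subst:
  assumes "delta0 n P" "\<And>i. i < n \<Longrightarrow> term_fun m (T i)"
  shows "delta0 m (\<lambda>e. P (\<lambda>i. T i e))"
proof -
  obtain \<phi> where \<phi>: "delta00 \<phi>" "\<And>e. P e \<longleftrightarrow> sat (env n e) from_nat \<phi>"
    using assms unfolding delta0_def by blast
  obtain t where t: "\<And>i e. i < n \<Longrightarrow> T i e = val (env m e) (t i)"
    using assms(2) unfolding term_fun_def by metis
  let ?\<sigma> = "\<lambda>i. if i < n then t i else Var (m + (i - n))"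
  have "(\<lambda>i. val (env m e) (?\<sigma> i)) = env n (\<lambda>i. T i e)" for e
    using t by (auto simp: env_def fun_eq_iff)
  then show ?thesis
    unfolding delta0_def
    by (intro exI[of _ "sub ?\<sigma> (\<lambda>i. i) \<phi>"]) (simp add: delta00_sub \<phi> sat_sub)
qed

lemma delta0_rename:
  "delta0 n P \<Longrightarrow> (\<And>i. i < n \<Longrightarrow> f i < m) \<Longrightarrow> delta0 m (\<lambda>e. P (\<lambda>i. e (f i)))"
  using delta0_subst[of n P m "\<lambda>i e. e (f i)"] by (simp add: term_fun_var)

lemma term_fun_lift: assumes "term_fun n T" shows "term_fun (Suc n) (\<lambda>e. T (\<lambda>i. e (Suc i)))"
proof -
  obtain t where t: "\<And>e. T e = val (env n e) t" using assms unfolding term_fun_def by blast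
  have "(\<lambda>i. env (Suc n) e (Suc i)) = env n (\<lambda>i. e (Suc i))" for e
    by (auto simp: env_def)
  then show ?thesis
    unfolding term_fun_def by (intro exI[of _ "lift_tm t"]) (simp add: t val_sub_tm)
qed

lemma delta0_cong: "delta0 n P \<Longrightarrow> (\<And>e. P e \<longleftrightarrow> Q e) \<Longrightarrow> delta0 n Q"
  unfolding delta0_def by simp

lemma sigma1_cong: "sigma1 n P \<Longrightarrow> (\<And>e. P e \<longleftrightarrow> Q e) \<Longrightarrow> sigma1 n Q"
  unfolding sigma1_def by simp

lemma sigma1_D0: assumes "delta0 n P" shows "sigma1 n P"
proof -
  have "delta0 (Suc n) (\<lambda>e. P (\<lambda>i. e (Suc i)))"
    using assms by (rule delta0_rename) simp
  then show ?thesis unfolding sigma1_def by (intro exI[of _ "\<lambda>e. P (\<lambda>i. e (Suc i))"]) simp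
qed

lemma env_0: "env 0 e = from_nat"
  by (simp add: env_def)

section \<open>Induction and comprehension for definable predicates\<close>

lemma sigma1_sigma01:
  assumes "sigma1 (Suc 0) (\<lambda>e. P (e 0))"
  obtains \<theta> where "delta00 \<theta>" "\<And>x. P x \<longleftrightarrow> (\<exists>y. sat (case_nat y (case_nat x from_nat)) from_nat \<theta>)"
proof -
  obtain Q \<theta> where Q: "\<And>e. P (e 0) \<longleftrightarrow> (\<exists>x. Q (case_nat x e))" and \<theta>: "delta00 \<theta>"
    "\<And>e. Q e \<longleftrightarrow> sat (env (Suc (Suc 0)) e) from_nat \<theta>"
    using assms unfolding sigma1_def delta0_def by blast
  show thesis
  proof (rule that[OF \<theta>(1)])
    fix x
    show "P x \<longleftrightarrow> (\<exists>y. sat (case_nat y (case_nat x from_nat)) from_nat \<theta>)"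
      using Q[of "case_nat x from_nat"] by (simp add: \<theta>(2) case_nat_env[symmetric] env_0)
  qed
qed

lemma sigma1_induct:
  assumes "sigma1 (Suc 0) (\<lambda>e. P (e 0))" and zero: "P ze" and step: "\<And>x. P x \<Longrightarrow> P (x \<oplus> on)"
  shows "P x"
proof -
  obtain \<theta> where \<theta>: "delta00 \<theta>" "\<And>x. P x \<longleftrightarrow> (\<exists>y. sat (case_nat y (case_nat x from_nat)) from_nat \<theta>)"
    using sigma1_sigma01[OF assms(1)] by blast
  then have P: "P x \<longleftrightarrow> sat (case_nat x from_nat) from_nat (ExN \<theta>)" for x
    by simp
  have "sigma01 (ExN \<theta>)" using \<theta>(1) unfolding sigma01_def by blast
  then have ax: "sat from_nat from_nat (induction_axiom (ExN \<theta>))"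
    by (intro RCA0) (auto simp: RCA0_def)
  have 0: "(\<lambda>i. val from_nat (case_nat Zero Var i)) = case_nat ze from_nat"
    by (auto simp: fun_eq_iff split: nat.split)
  have 1: "(\<lambda>i. val (case_nat x from_nat) (case_nat (Plus (Var 0) One) (\<lambda>i. Var (Suc i)) i))
      = case_nat (x \<oplus> on) from_nat" for x
    by (auto simp: fun_eq_iff split: nat.split)
  have "sat from_nat from_nat (instN Zero (ExN \<theta>))"
    unfolding sat_sub 0 using zero P by blast
  moreover have "sat (case_nat x from_nat) from_nat
      (sub (case_nat (Plus (Var 0) One) (\<lambda>i. Var (Suc i))) (\<lambda>i. i) (ExN \<theta>))"
    if "sat (case_nat x from_nat) from_nat (ExN \<theta>)" for x
    unfolding sat_sub 1 using that P step by blast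
  ultimately have "sat from_nat from_nat (AllN (ExN \<theta>))"
    using ax unfolding induction_axiom_def sat.simps(4,5,6) by blast
  then show ?thesis unfolding sat.simps(6) using P by blast
qed

text \<open>A \<open>\<Delta>\<^sup>0\<^sub>1\<close> predicate is given by certificates for itself
  and for its complement; negating the matrix of the second one yields the \<open>pi01\<close>
  formula that the axiom asks for.\<close>

lemma delta1_comprehension:
  assumes "sigma1 (Suc 0) (\<lambda>e. P (e 0))" "sigma1 (Suc 0) (\<lambda>e. \<not> P (e 0))"
  obtains X where "\<And>x. x \<epsilon> X \<longleftrightarrow> P x"
proof -
  obtain \<theta> where \<theta>: "delta00 \<theta>" "\<And>x. P x \<longleftrightarrow> (\<exists>y. sat (case_nat y (case_nat x from_nat)) from_nat \<theta>)"
    using sigma1_sigma01[OF assms(1)] by blast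
  obtain \<eta> where \<eta>: "delta00 \<eta>" "\<And>x. \<not> P x \<longleftrightarrow> (\<exists>y. sat (case_nat y (case_nat x from_nat)) from_nat \<eta>)"
    using sigma1_sigma01[OF assms(2)] by blast
  have "sigma01 (ExN \<theta>)" "pi01 (AllN (Neg \<eta>))"
    using \<theta>(1) \<eta>(1) unfolding sigma01_def pi01_def by (auto intro: delta00.intros)
  then have "sat from_nat from_nat (comprehension_axiom (ExN \<theta>) (AllN (Neg \<eta>)))"
    by (intro RCA0) (auto simp: RCA0_def)
  moreover have "sat (case_nat x from_nat) from_nat (ExN \<theta>) \<longleftrightarrow> P x" for x
    using \<theta>(2) by simp
  moreover have "sat (case_nat x from_nat) from_nat (AllN (Neg \<eta>)) \<longleftrightarrow> P x" for x
    using \<eta>(2)[of x] by auto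
  moreover have "sat (case_nat x from_nat) (case_nat X from_nat) (liftS (ExN \<theta>)) \<longleftrightarrow> P x" for x X
    unfolding sat_sub using \<theta>(2) by simp
  ultimately have "\<exists>X. \<forall>x. x \<epsilon> X \<longleftrightarrow> P x"
    unfolding comprehension_axiom_def by (simp del: sub.simps) blast
  then show thesis using that by blast
qed

lemmas delta0_intros = delta0_const term_fun_const term_fun_var term_fun_pl term_fun_ti delta0_eq delta0_ls delta0_mem delta0_imp delta0_not delta0_conj delta0_disj delta0_iff
  delta0_ball delta0_bex

lemma delta0_induct:
  assumes "delta0 (Suc 0) (\<lambda>e. P (e 0))" "P ze" "\<And>x. P x \<Longrightarrow> P (x \<oplus> on)"
  shows "P x"
  by (rule sigma1_induct[OF sigma1_D0[OF assms(1)] assms(2,3)])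


section \<open>Arithmetic\<close>

lemma basic_axioms_sat: "\<phi> \<in> basic_axioms \<Longrightarrow> sat e E \<phi>"
  by (rule RCA0) (simp add: RCA0_def)

lemmas sat_defs = sentence_def all_n_def all_s_def ex_n_def ex_s_def not_f_def and_f_def or_f_def imp_f_def
  iff_f_def eq_f_def less_f_def mem_f_def zero_t_def one_t_def plus_t_def times_t_def

lemma
  succ_neq_ze [simp]: "n \<oplus> on \<noteq> ze" and
  succ_inj: "m \<oplus> on = n \<oplus> on \<Longrightarrow> m = n" and
  pl_ze [simp]: "m \<oplus> ze = m" and
  pl_succ: "m \<oplus> (n \<oplus> on) = (m \<oplus> n) \<oplus> on" and
  ti_ze [simp]: "m \<otimes> ze = ze" and
  ti_succ: "m \<otimes> (n \<oplus> on) = m \<otimes> n \<oplus> m" and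
  not_ls_ze [simp]: "\<not> m \<prec> ze" and
  ls_succ: "m \<prec> n \<oplus> on \<longleftrightarrow> m \<prec> n \<or> m = n"
proof -
  note ax = basic_axioms_sat[unfolded basic_axioms_def, simplified, of _ undefined undefined]
  have "\<forall>n. n \<oplus> on \<noteq> ze" using ax[of "sentence (\<^bold>\<forall>n. \<^bold>\<not> n \<^bold>+ \<^bold>1 \<^bold>= \<^bold>0)"] by (simp add: sat_defs)
  then show "n \<oplus> on \<noteq> ze" by blast
  have "\<forall>m n. m \<oplus> on = n \<oplus> on \<longrightarrow> m = n"
    using ax[of "sentence (\<^bold>\<forall>m n. m \<^bold>+ \<^bold>1 \<^bold>= n \<^bold>+ \<^bold>1 \<^bold>\<longrightarrow> m \<^bold>= n)"] by (simp add: sat_defs)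
  then show "m \<oplus> on = n \<oplus> on \<Longrightarrow> m = n" by blast
  have "\<forall>m. m \<oplus> ze = m" using ax[of "sentence (\<^bold>\<forall>m. m \<^bold>+ \<^bold>0 \<^bold>= m)"] by (simp add: sat_defs)
  then show "m \<oplus> ze = m" by blast
  have "\<forall>m n. m \<oplus> (n \<oplus> on) = (m \<oplus> n) \<oplus> on"
    using ax[of "sentence (\<^bold>\<forall>m n. m \<^bold>+ (n \<^bold>+ \<^bold>1) \<^bold>= (m \<^bold>+ n) \<^bold>+ \<^bold>1)"] by (simp add: sat_defs)
  then show "m \<oplus> (n \<oplus> on) = (m \<oplus> n) \<oplus> on" by blast
  have "\<forall>m. m \<otimes> ze = ze" using ax[of "sentence (\<^bold>\<forall>m. m \<^bold>\<cdot> \<^bold>0 \<^bold>= \<^bold>0)"] by (simp add: sat_defs)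
  then show "m \<otimes> ze = ze" by blast
  have "\<forall>m n. m \<otimes> (n \<oplus> on) = m \<otimes> n \<oplus> m"
    using ax[of "sentence (\<^bold>\<forall>m n. m \<^bold>\<cdot> (n \<^bold>+ \<^bold>1) \<^bold>= m \<^bold>\<cdot> n \<^bold>+ m)"] by (simp add: sat_defs)
  then show "m \<otimes> (n \<oplus> on) = m \<otimes> n \<oplus> m" by blast
  have "\<forall>m. \<not> m \<prec> ze" using ax[of "sentence (\<^bold>\<forall>m. \<^bold>\<not> m \<^bold>< \<^bold>0)"] by (simp add: sat_defs)
  then show "\<not> m \<prec> ze" by blast
  have "\<forall>m n. m \<prec> n \<oplus> on \<longleftrightarrow> m \<prec> n \<or> m = n"
    using ax[of "sentence (\<^bold>\<forall>m n. m \<^bold>< n \<^bold>+ \<^bold>1 \<^bold>\<longleftrightarrow> m \<^bold>< n \<^bold>\<or> m \<^bold>= n)"] by (simp add: sat_defs) blast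
  then show "m \<prec> n \<oplus> on \<longleftrightarrow> m \<prec> n \<or> m = n" by blast
qed

lemma pl_assoc: "(a \<oplus> b) \<oplus> c = a \<oplus> (b \<oplus> c)"
  by (rule delta0_induct[of "\<lambda>c. (a \<oplus> b) \<oplus> c = a \<oplus> (b \<oplus> c)"])
    ((intro delta0_intros; simp), simp, simp add: pl_succ)

lemma ze_pl [simp]: "ze \<oplus> a = a"
  by (rule delta0_induct[of "\<lambda>a. ze \<oplus> a = a"])
    ((intro delta0_intros; simp), simp, simp add: pl_succ)

lemma succ_pl: "(a \<oplus> on) \<oplus> b = (a \<oplus> b) \<oplus> on"
  by (rule delta0_induct[of "\<lambda>b. (a \<oplus> on) \<oplus> b = (a \<oplus> b) \<oplus> on"])
    ((intro delta0_intros; simp), simp, simp add: pl_succ)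

lemma pl_commute: "a \<oplus> b = b \<oplus> a"
  by (rule delta0_induct[of "\<lambda>b. a \<oplus> b = b \<oplus> a"])
    ((intro delta0_intros; simp), simp, simp add: pl_succ succ_pl)

lemma pl_left_commute: "a \<oplus> (b \<oplus> c) = b \<oplus> (a \<oplus> c)"
  by (metis pl_assoc pl_commute)

lemmas pl_ac = pl_assoc pl_commute pl_left_commute

lemma ze_ti [simp]: "ze \<otimes> a = ze"
  by (rule delta0_induct[of "\<lambda>a. ze \<otimes> a = ze"])
    ((intro delta0_intros; simp), simp, simp add: ti_succ)

lemma ti_on [simp]: "a \<otimes> on = a"
  using ti_succ[of a ze] by simp

lemma distrib_left: "a \<otimes> (b \<oplus> c) = a \<otimes> b \<oplus> a \<otimes> c"
  by (rule delta0_induct[of "\<lambda>c. a \<otimes> (b \<oplus> c) = a \<otimes> b \<oplus> a \<otimes> c"])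
    ((intro delta0_intros; simp), simp, simp add: pl_assoc[symmetric] ti_succ)

lemma distrib_right: "(a \<oplus> b) \<otimes> c = a \<otimes> c \<oplus> b \<otimes> c"
  by (rule delta0_induct[of "\<lambda>c. (a \<oplus> b) \<otimes> c = a \<otimes> c \<oplus> b \<otimes> c"])
    ((intro delta0_intros; simp), simp, simp add: ti_succ pl_ac)

lemma on_ti [simp]: "on \<otimes> a = a"
  by (rule delta0_induct[of "\<lambda>a. on \<otimes> a = a"])
    ((intro delta0_intros; simp), simp, simp add: ti_succ)

lemma ti_commute: "a \<otimes> b = b \<otimes> a"
  by (rule delta0_induct[of "\<lambda>b. a \<otimes> b = b \<otimes> a"])
    ((intro delta0_intros; simp), simp, simp add: distrib_left distrib_right)

lemma ti_assoc: "(a \<otimes> b) \<otimes> c = a \<otimes> (b \<otimes> c)"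
  by (rule delta0_induct[of "\<lambda>c. (a \<otimes> b) \<otimes> c = a \<otimes> (b \<otimes> c)"])
    ((intro delta0_intros; simp), simp, simp add: distrib_left)

lemma ti_left_commute: "a \<otimes> (b \<otimes> c) = b \<otimes> (a \<otimes> c)"
  by (metis ti_assoc ti_commute)

lemmas semiring = pl_ac ti_assoc ti_commute ti_left_commute distrib_left distrib_right

lemma pl_cancel: "a \<oplus> c = b \<oplus> c \<Longrightarrow> a = b"
proof -
  have "a \<oplus> c = b \<oplus> c \<longrightarrow> a = b"
    by (rule delta0_induct[of "\<lambda>c. a \<oplus> c = b \<oplus> c \<longrightarrow> a = b"])
      ((intro delta0_intros; simp), simp, auto simp: pl_succ dest: succ_inj)
  then show "a \<oplus> c = b \<oplus> c \<Longrightarrow> a = b" by blast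
qed

lemma pl_cancel_right [simp]: "a \<oplus> c = b \<oplus> c \<longleftrightarrow> a = b"
  using pl_cancel by blast

lemma pl_cancel_left [simp]: "c \<oplus> a = c \<oplus> b \<longleftrightarrow> a = b"
  using pl_cancel by (metis pl_commute)

lemma ls_pl_succ: "a \<prec> a \<oplus> (d \<oplus> on)"
  by (rule delta0_induct[of "\<lambda>d. a \<prec> a \<oplus> (d \<oplus> on)"])
    ((intro delta0_intros; simp), simp_all add: ls_succ pl_succ)

text \<open>Inside the induction the predecessor is bounded by the number itself, which keeps the
  induction formula bounded. The difference in \<open>ls_imp_pl\<close> is treated in the same
  way.\<close>

lemma ze_or_succ: "a = ze \<or> (\<exists>b. a = b \<oplus> on)"
proof -
  have "a = ze \<or> (\<exists>b. b \<prec> a \<and> a = b \<oplus> on)"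
    by (rule delta0_induct[of "\<lambda>a. a = ze \<or> (\<exists>b. b \<prec> a \<and> a = b \<oplus> on)"])
      ((intro delta0_intros; simp), simp_all add: ls_succ)
  then show ?thesis by blast
qed

lemma ls_imp_pl: "a \<prec> b \<Longrightarrow> \<exists>d. b = a \<oplus> (d \<oplus> on)"
proof -
  have "a \<prec> b \<longrightarrow> (\<exists>d. d \<prec> b \<and> b = a \<oplus> (d \<oplus> on))"
  proof (rule delta0_induct[of "\<lambda>b. a \<prec> b \<longrightarrow> (\<exists>d. d \<prec> b \<and> b = a \<oplus> (d \<oplus> on))"])
    fix x assume IH: "a \<prec> x \<longrightarrow> (\<exists>d. d \<prec> x \<and> x = a \<oplus> (d \<oplus> on))"
    show "a \<prec> x \<oplus> on \<longrightarrow> (\<exists>d. d \<prec> x \<oplus> on \<and> x \<oplus> on = a \<oplus> (d \<oplus> on))"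
    proof
      assume "a \<prec> x \<oplus> on"
      then consider "a \<prec> x" | "a = x" using ls_succ by blast
      then show "\<exists>d. d \<prec> x \<oplus> on \<and> x \<oplus> on = a \<oplus> (d \<oplus> on)"
      proof cases
        case 1
        then obtain d where d: "x = a \<oplus> (d \<oplus> on)" using IH by blast
        have "x \<oplus> on = (d \<oplus> on) \<oplus> (a \<oplus> on)" unfolding d by (simp add: pl_ac)
        then have "d \<oplus> on \<prec> x \<oplus> on" using ls_pl_succ by metis
        then show ?thesis using d by (intro exI[of _ "d \<oplus> on"]) (simp add: pl_ac)
      next
        case 2
        have "ze \<prec> ze \<oplus> (x \<oplus> on)" by (rule ls_pl_succ)
        then show ?thesis using 2 by (intro exI[of _ ze]) simp
      qed
    qed
  qed ((intro delta0_intros; simp), simp)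
  then show "a \<prec> b \<Longrightarrow> \<exists>d. b = a \<oplus> (d \<oplus> on)" by blast
qed

lemma ls_iff: "a \<prec> b \<longleftrightarrow> (\<exists>d. b = a \<oplus> (d \<oplus> on))"
  using ls_imp_pl ls_pl_succ by blast

lemma ls_irrefl [simp]: "\<not> a \<prec> a"
proof
  assume "a \<prec> a"
  then obtain d where "a \<oplus> ze = a \<oplus> (d \<oplus> on)" unfolding ls_iff by auto
  then show False by (metis pl_cancel_left succ_neq_ze)
qed

lemma ls_trans: "a \<prec> b \<Longrightarrow> b \<prec> c \<Longrightarrow> a \<prec> c"
  unfolding ls_iff by (metis pl_assoc)

lemma ls_linear: "a \<prec> b \<or> a = b \<or> b \<prec> a"
proof (rule delta0_induct[of "\<lambda>b. a \<prec> b \<or> a = b \<or> b \<prec> a"])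
  show "a \<prec> ze \<or> a = ze \<or> ze \<prec> a"
    using ze_or_succ[of a] ls_iff[of ze a] by auto
next
  fix x assume "a \<prec> x \<or> a = x \<or> x \<prec> a"
  then show "a \<prec> x \<oplus> on \<or> a = x \<oplus> on \<or> x \<oplus> on \<prec> a"
    using ze_or_succ ls_succ ls_iff by (metis pl_assoc pl_commute pl_ze)
qed (intro delta0_intros; simp)

lemma ls_pl1: "a \<prec> a \<oplus> b \<oplus> on" and ls_pl2: "b \<prec> a \<oplus> b \<oplus> on"
  unfolding ls_iff by (metis pl_assoc, metis pl_assoc pl_commute)

lemma ls_pl_mono: "a \<prec> b \<Longrightarrow> a \<oplus> c \<prec> b \<oplus> c"
  unfolding ls_iff by (metis pl_assoc pl_commute)


section \<open>Collection and closure properties of \<open>\<Sigma>\<^sup>0\<^sub>1\<close>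
  predicates\<close>

text \<open>A bound that works for all \<open>x\<close> below \<open>j\<close> is carried along by
  induction on \<open>j\<close>; adding the witness for \<open>j\<close> and one gives the next
  bound. Existence of such a bound is a \<open>\<Sigma>\<^sup>0\<^sub>1\<close> property of
  \<open>j\<close> because the matrix \<open>C\<close> is bounded.\<close>

lemma delta0_collection:
  assumes D: "delta0 (Suc (Suc 0)) (\<lambda>e. Q (e 0) (e (Suc 0)))" and ex: "\<And>x. x \<prec> n \<Longrightarrow> \<exists>y. Q x y"
  obtains b where "\<And>x. x \<prec> n \<Longrightarrow> \<exists>y. y \<prec> b \<and> Q x y"
proof -
  \<comment> \<open>In \<open>C\<close> the innermost variable \<open>y\<close> has index 0 and
    \<open>x\<close> has index 1, followed by \<open>b\<close> and \<open>j\<close>; the map sending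
    \<open>i\<close> to \<open>1 - i\<close> swaps the two arguments of \<open>Q\<close>
    accordingly.\<close>
  have D': "delta0 (Suc (Suc (Suc (Suc 0)))) (\<lambda>e. Q (e (Suc 0)) (e 0))"
    using delta0_rename[OF D, of "\<lambda>i. 1 - i" "Suc (Suc (Suc (Suc 0)))"] by simp
  define C where "C b j \<longleftrightarrow> (\<forall>x. x \<prec> j \<longrightarrow> x \<prec> n \<longrightarrow> (\<exists>y. y \<prec> b \<and> Q x y))" for b j
  have "delta0 (Suc (Suc 0)) (\<lambda>e. C (e 0) (e (Suc 0)))"
    unfolding C_def by (intro delta0_intros D'; simp)
  then have "sigma1 (Suc 0) (\<lambda>e. \<exists>b. C b (e 0))"
    unfolding sigma1_def by (intro exI[of _ "\<lambda>e. C (e 0) (e (Suc 0))"]) simp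
  then have "\<exists>b. C b n"
  proof (rule sigma1_induct)
    fix j assume "\<exists>b. C b j"
    then obtain b where b: "C b j" by blast
    show "\<exists>b. C b (j \<oplus> on)"
    proof (cases "j \<prec> n")
      case True
      then obtain y where y: "Q j y" using ex by blast
      have "C (b \<oplus> y \<oplus> on) (j \<oplus> on)"
        unfolding C_def
      proof (intro allI impI)
        fix x assume x: "x \<prec> j \<oplus> on" "x \<prec> n"
        show "\<exists>z. z \<prec> b \<oplus> y \<oplus> on \<and> Q x z"
        proof (cases "x = j")
          case True
          then show ?thesis using y ls_pl2 by blast
        next
          case False
          then obtain z where "z \<prec> b" "Q x z" using b x unfolding C_def ls_succ by blast
          then show ?thesis using ls_trans[OF _ ls_pl1] by blast
        qed
      qed
      then show ?thesis by blast
    next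
      case False
      then have "C b (j \<oplus> on)" using b unfolding C_def ls_succ by blast
      then show ?thesis by blast
    qed
  qed (simp add: C_def)
  then show thesis using that ls_trans unfolding C_def by blast
qed

lemma sigma1_subst:
  assumes "sigma1 n P" "\<And>i. i < n \<Longrightarrow> term_fun m (T i)"
  shows "sigma1 m (\<lambda>e. P (\<lambda>i. T i e))"
proof -
  obtain Q where Q: "delta0 (Suc n) Q" "\<And>e. P e \<longleftrightarrow> (\<exists>x. Q (case_nat x e))"
    using assms(1) unfolding sigma1_def by blast
  define U where "U i = (case i of 0 \<Rightarrow> (\<lambda>e. e 0) | Suc i \<Rightarrow> (\<lambda>e. T i (\<lambda>i. e (Suc i))))" for i
  have "delta0 (Suc m) (\<lambda>e. Q (\<lambda>i. U i e))"
    using Q(1) by (rule delta0_subst) (auto simp: U_def intro: term_fun_var term_fun_lift assms(2) split: nat.split)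
  moreover have "(\<lambda>i. U i (case_nat x e)) = case_nat x (\<lambda>i. T i e)" for x e
    by (auto simp: U_def fun_eq_iff split: nat.split)
  ultimately show ?thesis
    unfolding sigma1_def by (intro exI[of _ "\<lambda>e. Q (\<lambda>i. U i e)"]) (simp add: Q(2))
qed

text \<open>Makes room at index 2 for a bounding number that is quantified outside the two innermost
  variables.\<close>

lemma delta0_insert2:
  assumes "delta0 (Suc (Suc n)) Q"
  shows "delta0 (Suc (Suc (Suc n))) (\<lambda>e. Q (case_nat (e 0) (case_nat (e (Suc 0)) (\<lambda>i. e (Suc (Suc (Suc i)))))))"
proof -
  have *: "(\<lambda>i. e (if i < 2 then i else Suc i)) = case_nat (e 0) (case_nat (e (Suc 0)) (\<lambda>i. e (Suc (Suc (Suc i)))))"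
    for e :: "nat \<Rightarrow> 'm"
    by (auto simp: fun_eq_iff less_2_cases_iff split: nat.split)
  have "delta0 (Suc (Suc (Suc n))) (\<lambda>e. Q (\<lambda>i. e (if i < 2 then i else Suc i)))"
    using assms by (rule delta0_rename) auto
  then show ?thesis by (rule delta0_cong) (rule arg_cong[of _ _ Q, OF *])
qed

text \<open>Two unbounded quantifiers are merged into one over a common bound \<open>w\<close> of
  both witnesses. This needs no pairing and no projections.\<close>

lemma sigma1_ex:
  assumes "sigma1 (Suc n) (\<lambda>e. P (e 0) (\<lambda>i. e (Suc i)))"
  shows "sigma1 n (\<lambda>e. \<exists>x. P x e)"
proof -
  obtain Q where Q: "delta0 (Suc (Suc n)) Q" "\<And>e. P (e 0) (\<lambda>i. e (Suc i)) \<longleftrightarrow> (\<exists>y. Q (case_nat y e))"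
    using assms unfolding sigma1_def by blast
  have P: "P x e \<longleftrightarrow> (\<exists>y. Q (case_nat y (case_nat x e)))" for x e
    using Q(2)[of "case_nat x e"] by simp
  define R where "R y x e = Q (case_nat y (case_nat x e))" for y x e
  have R: "delta0 (Suc (Suc (Suc n))) (\<lambda>e. R (e 0) (e (Suc 0)) (\<lambda>i. e (Suc (Suc (Suc i)))))"
    unfolding R_def by (rule delta0_insert2[OF Q(1)])
  have "delta0 (Suc n) (\<lambda>e. \<exists>x. x \<prec> e 0 \<and> (\<exists>y. y \<prec> e 0 \<and> R y x (\<lambda>i. e (Suc i))))"
    by (intro delta0_intros R; simp)
  moreover have "(\<exists>x. P x e) \<longleftrightarrow> (\<exists>w x. x \<prec> w \<and> (\<exists>y. y \<prec> w \<and> R y x e))" for e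
    unfolding P R_def[symmetric] using ls_pl1 ls_pl2 by blast
  ultimately show ?thesis
    unfolding sigma1_def
    by (intro exI[of _ "\<lambda>e. \<exists>x. x \<prec> e 0 \<and> (\<exists>y. y \<prec> e 0 \<and> R y x (\<lambda>i. e (Suc i)))"]) simp
qed

lemma sigma1_disj: assumes "sigma1 n P" "sigma1 n Q" shows "sigma1 n (\<lambda>e. P e \<or> Q e)"
proof -
  obtain A B where "delta0 (Suc n) A" "\<And>e. P e \<longleftrightarrow> (\<exists>x. A (case_nat x e))"
    "delta0 (Suc n) B" "\<And>e. Q e \<longleftrightarrow> (\<exists>x. B (case_nat x e))"
    using assms unfolding sigma1_def by blast
  then show ?thesis
    unfolding sigma1_def by (intro exI[of _ "\<lambda>e. A e \<or> B e"]) (auto intro: delta0_disj)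
qed

lemma sigma1_conj: assumes "sigma1 n P" "sigma1 n Q" shows "sigma1 n (\<lambda>e. P e \<and> Q e)"
proof -
  obtain A B where A: "delta0 (Suc n) A" "\<And>e. P e \<longleftrightarrow> (\<exists>x. A (case_nat x e))"
    and B: "delta0 (Suc n) B" "\<And>e. Q e \<longleftrightarrow> (\<exists>x. B (case_nat x e))"
    using assms unfolding sigma1_def by blast
  have tl: "(\<lambda>i. e (Suc i)) = case_nat (e (Suc 0)) (\<lambda>i. e (Suc (Suc i)))" for e :: "nat \<Rightarrow> 'm"
    by (auto simp: fun_eq_iff split: nat.split)
  have "delta0 (Suc (Suc n)) (\<lambda>e. A (\<lambda>i. e (Suc i)))"
    using A(1) by (rule delta0_rename) auto
  then have A': "delta0 (Suc (Suc n)) (\<lambda>e. A (case_nat (e (Suc 0)) (\<lambda>i. e (Suc (Suc i)))))"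
    by (rule delta0_cong) (rule arg_cong[of _ _ A, OF tl])
  have hd: "(\<lambda>i. e (if i = 0 then 0 else Suc i)) = case_nat (e 0) (\<lambda>i. e (Suc (Suc i)))" for e :: "nat \<Rightarrow> 'm"
    by (auto simp: fun_eq_iff split: nat.split)
  have "delta0 (Suc (Suc n)) (\<lambda>e. B (\<lambda>i. e (if i = 0 then 0 else Suc i)))"
    using B(1) by (rule delta0_rename) auto
  then have B': "delta0 (Suc (Suc n)) (\<lambda>e. B (case_nat (e 0) (\<lambda>i. e (Suc (Suc i)))))"
    by (rule delta0_cong) (rule arg_cong[of _ _ B, OF hd])
  have "sigma1 n (\<lambda>e. \<exists>x y. A (case_nat x e) \<and> B (case_nat y e))"
    by (intro sigma1_ex sigma1_D0 delta0_conj A' B')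
  then show ?thesis by (rule sigma1_cong) (auto simp: A B)
qed

text \<open>The premise is bounded because its negation becomes a disjunct, and
  \<open>\<Sigma>\<^sup>0\<^sub>1\<close> predicates are not closed under negation.\<close>

lemma sigma1_imp: assumes "delta0 n P" "sigma1 n Q" shows "sigma1 n (\<lambda>e. P e \<longrightarrow> Q e)"
proof -
  have "sigma1 n (\<lambda>e. \<not> P e)"
    by (intro sigma1_D0 delta0_not assms)
  from sigma1_disj[OF this assms(2)] show ?thesis by (rule sigma1_cong) auto
qed

text \<open>Collection gives the witnesses for all \<open>x\<close> below \<open>T e\<close> a
  common bound, and the quantifier over this bound moves in front of the bounded one.\<close>

lemma sigma1_ball:
  assumes T: "term_fun n T" and "sigma1 (Suc n) (\<lambda>e. P (e 0) (\<lambda>i. e (Suc i)))"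
  shows "sigma1 n (\<lambda>e. \<forall>x. x \<prec> T e \<longrightarrow> P x e)"
proof -
  obtain Q where Q: "delta0 (Suc (Suc n)) Q" "\<And>e. P (e 0) (\<lambda>i. e (Suc i)) \<longleftrightarrow> (\<exists>y. Q (case_nat y e))"
    using assms unfolding sigma1_def by blast
  have P: "P x e \<longleftrightarrow> (\<exists>y. Q (case_nat y (case_nat x e)))" for x e
    using Q(2)[of "case_nat x e"] by simp
  define R where "R y x e = Q (case_nat y (case_nat x e))" for y x e
  have R: "delta0 (Suc (Suc (Suc n))) (\<lambda>e. R (e 0) (e (Suc 0)) (\<lambda>i. e (Suc (Suc (Suc i)))))"
    unfolding R_def by (rule delta0_insert2[OF Q(1)])
  have "delta0 (Suc n) (\<lambda>e. \<forall>x. x \<prec> T (\<lambda>i. e (Suc i)) \<longrightarrow> (\<exists>y. y \<prec> e 0 \<and> R y x (\<lambda>i. e (Suc i))))"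
    by (rule delta0_ball[OF term_fun_lift[OF T]]) (intro delta0_intros R; simp)
  moreover have "(\<forall>x. x \<prec> T e \<longrightarrow> P x e) \<longleftrightarrow> (\<exists>b. \<forall>x. x \<prec> T e \<longrightarrow> (\<exists>y. y \<prec> b \<and> R y x e))" for e
  proof
    assume *: "\<forall>x. x \<prec> T e \<longrightarrow> P x e"
    \<comment> \<open>Collection is available for two variables. \<open>U\<close> therefore freezes
      the outer environment \<open>e\<close> into parameters and feeds \<open>Q\<close> with
      \<open>y\<close>, \<open>x\<close> and these constants.\<close>
    define U where "U i = (case i of 0 \<Rightarrow> (\<lambda>e'. e' (Suc 0)) | Suc i \<Rightarrow>
        (case i of 0 \<Rightarrow> (\<lambda>e'. e' 0) | Suc j \<Rightarrow> (\<lambda>e'. e j)))" for i and e' :: "nat \<Rightarrow> 'm"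
    have "term_fun (Suc (Suc 0)) (U i)" for i
      unfolding U_def by (auto intro: term_fun_var term_fun_const split: nat.split)
    then have QU: "delta0 (Suc (Suc 0)) (\<lambda>e'. Q (\<lambda>i. U i e'))"
      by (intro delta0_subst[OF Q(1)])
    have U: "(\<lambda>i. U i e') = case_nat (e' (Suc 0)) (case_nat (e' 0) e)" for e'
      by (auto simp: U_def fun_eq_iff split: nat.split)
    have "delta0 (Suc (Suc 0)) (\<lambda>e'. R (e' (Suc 0)) (e' 0) e)"
      using QU unfolding R_def U .
    moreover have "\<exists>y. R y x e" if "x \<prec> T e" for x
      using * that unfolding P R_def by blast
    ultimately obtain b where "\<And>x. x \<prec> T e \<Longrightarrow> \<exists>y. y \<prec> b \<and> R y x e"
      using delta0_collection[of "\<lambda>x y. R y x e" "T e"] by blast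
    then show "\<exists>b. \<forall>x. x \<prec> T e \<longrightarrow> (\<exists>y. y \<prec> b \<and> R y x e)" by blast
  next
    assume "\<exists>b. \<forall>x. x \<prec> T e \<longrightarrow> (\<exists>y. y \<prec> b \<and> R y x e)"
    then show "\<forall>x. x \<prec> T e \<longrightarrow> P x e" unfolding P R_def by blast
  qed
  ultimately show ?thesis
    unfolding sigma1_def
    by (intro exI[of _ "\<lambda>e. \<forall>x. x \<prec> T (\<lambda>i. e (Suc i)) \<longrightarrow> (\<exists>y. y \<prec> e 0 \<and> R y x (\<lambda>i. e (Suc i)))"]) simp
qed

lemmas sigma1_intros = sigma1_D0[OF delta0_const] sigma1_conj sigma1_disj sigma1_imp sigma1_ball sigma1_ex
  sigma1_D0[OF delta0_not] sigma1_D0[OF delta0_eq] sigma1_D0[OF delta0_ls] sigma1_D0[OF delta0_mem]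

lemma sigma1_app1: assumes "sigma1 (Suc 0) (\<lambda>e. P (e 0))" "term_fun m S" shows "sigma1 m (\<lambda>e. P (S e))"
  using sigma1_subst[OF assms(1), of m "\<lambda>_. S"] assms(2) by simp

lemma sigma1_app2:
  assumes "sigma1 (Suc (Suc 0)) (\<lambda>e. P (e 0) (e (Suc 0)))" "term_fun m S" "term_fun m T"
  shows "sigma1 m (\<lambda>e. P (S e) (T e))"
  using sigma1_subst[OF assms(1), of m "\<lambda>i. case_nat S (\<lambda>_. T) i"] assms(2,3) by (simp split: nat.split)

lemma delta0_app1: assumes "delta0 (Suc 0) (\<lambda>e. P (e 0))" "term_fun m S" shows "delta0 m (\<lambda>e. P (S e))"
  using delta0_subst[OF assms(1), of m "\<lambda>_. S"] assms(2) by simp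


section \<open>Pairs and codes of bounded sets\<close>

definition pr :: "'m \<Rightarrow> 'm \<Rightarrow> 'm" where
  "pr i j = (i \<oplus> j) \<otimes> (i \<oplus> j) \<oplus> i"

lemma term_fun_pr: "term_fun n S \<Longrightarrow> term_fun n T \<Longrightarrow> term_fun n (\<lambda>e. pr (S e) (T e))"
  unfolding pr_def by (intro term_fun_pl term_fun_ti)

text \<open>Write a for \<open>i \<oplus> j\<close>. Then \<open>pr i j\<close> is at most a^2 + a,
  which is less than (a + 1)^2, and \<open>pr k l\<close> is at least the square of
  \<open>k \<oplus> l\<close>, which is at least a + 1. The element \<open>r\<close> is the explicit
  difference needed for this, as there is no subtraction.\<close>

lemma pr_sum_ls:
  assumes "i \<oplus> j \<prec> k \<oplus> l"
  shows "pr i j \<prec> pr k l"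
proof -
  obtain d where d: "k \<oplus> l = i \<oplus> j \<oplus> d \<oplus> on" using assms unfolding ls_iff by (auto simp: pl_assoc)
  define a where "a = i \<oplus> j"
  define r where "r = a \<oplus> (a \<otimes> d \<oplus> (d \<otimes> (a \<oplus> d \<oplus> on) \<oplus> d))"
  have "(a \<oplus> d \<oplus> on) \<otimes> (a \<oplus> d \<oplus> on) = (a \<otimes> a \<oplus> a) \<oplus> (r \<oplus> on)"
    unfolding r_def by (simp add: semiring)
  moreover have "a \<otimes> a \<oplus> a = pr i j \<oplus> j"
    unfolding pr_def a_def by (simp add: pl_assoc)
  ultimately have "pr k l = pr i j \<oplus> j \<oplus> (r \<oplus> on) \<oplus> k"
    unfolding pr_def[of k l] d a_def[symmetric] by simp
  then have "pr k l = pr i j \<oplus> ((j \<oplus> r \<oplus> k) \<oplus> on)"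
    by (simp add: pl_ac)
  then show ?thesis unfolding ls_iff by blast
qed

lemma pr_inject [simp]: "pr i j = pr k l \<longleftrightarrow> i = k \<and> j = l"
proof
  assume eq: "pr i j = pr k l"
  then have "i \<oplus> j = k \<oplus> l" using pr_sum_ls ls_linear ls_irrefl by metis
  moreover from this have "i = k" using eq unfolding pr_def by simp
  ultimately show "i = k \<and> j = l" by simp
qed simp

lemma on_neq_ze [simp]: "on \<noteq> ze"
  using succ_neq_ze[of ze] by simp

lemma ti_self_ge: "\<exists>d. a \<otimes> a = a \<oplus> d"
  using ze_or_succ[of a] by (auto simp: distrib_left) (metis pl_commute)

text \<open>These bounds allow quantifiers over the components of a pair to be bounded by the pair,
  so that not being a pair of a given kind is still a bounded property.\<close>

lemma ls_pr1: "i \<prec> pr i j \<oplus> on" and ls_pr2: "j \<prec> pr i j \<oplus> on"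
proof -
  obtain d where "(i \<oplus> j) \<otimes> (i \<oplus> j) = i \<oplus> j \<oplus> d" using ti_self_ge by blast
  then have "pr i j = i \<oplus> (j \<oplus> d \<oplus> i)" "pr i j = j \<oplus> (i \<oplus> d \<oplus> i)"
    unfolding pr_def by (simp_all add: pl_ac)
  then show "i \<prec> pr i j \<oplus> on" "j \<prec> pr i j \<oplus> on" by (metis ls_pl1)+
qed

section \<open>Divisibility and the beta function\<close>

definition dv :: "'m \<Rightarrow> 'm \<Rightarrow> bool" where
  "dv u c \<longleftrightarrow> (\<exists>q. c = u \<otimes> q)"

lemma dv_ti [simp]: "dv u (u \<otimes> c)" "dv u (c \<otimes> u)"
  unfolding dv_def using ti_commute by blast+

lemma dv_ti_right: "dv u a \<Longrightarrow> dv u (a \<otimes> c)"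
  unfolding dv_def using ti_assoc by blast

lemma pl_eq_ze: "a \<oplus> b = ze \<longleftrightarrow> a = ze \<and> b = ze"
  using ze_or_succ[of b] by (auto simp: pl_assoc[symmetric] succ_neq_ze[symmetric])

text \<open>In place of subtraction the two quotients are compared. Unless
  \<open>p \<prec> r\<close>, the sum does not exceed \<open>a\<close>, which forces
  \<open>b\<close> to be zero.\<close>

lemma dv_pl_cancel: assumes "dv u a" "dv u (a \<oplus> b)" shows "dv u b"
proof -
  obtain p r where a: "a = u \<otimes> p" and ab: "a \<oplus> b = u \<otimes> r" using assms unfolding dv_def by blast
  consider "r \<prec> p" | "p = r" | "p \<prec> r" using ls_linear by blast
  then show ?thesis
  proof cases
    case 1
    then obtain d where "p = r \<oplus> (d \<oplus> on)" unfolding ls_iff by blast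
    then have "u \<otimes> r \<oplus> (u \<otimes> (d \<oplus> on) \<oplus> b) = u \<otimes> r \<oplus> ze" using a ab by (simp add: distrib_left pl_assoc)
    then have "b = ze" unfolding pl_cancel_left pl_eq_ze by blast
    then show ?thesis unfolding dv_def by (intro exI[of _ ze]) simp
  next
    case 2
    then have "a \<oplus> b = a \<oplus> ze" using a ab by simp
    then have "b = ze" unfolding pl_cancel_left .
    then show ?thesis unfolding dv_def by (intro exI[of _ ze]) simp
  next
    case 3
    then obtain d where "r = p \<oplus> (d \<oplus> on)" unfolding ls_iff by blast
    then have "u \<otimes> p \<oplus> b = u \<otimes> p \<oplus> u \<otimes> (d \<oplus> on)" using a ab by (simp add: distrib_left)
    then show ?thesis unfolding pl_cancel_left by simp
  qed
qed

text \<open>The modulus of index \<open>x\<close> of Goedel's beta function; \<open>x\<close> belongs to the set coded by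
  \<open>(c, m)\<close> if that modulus divides \<open>c\<close>.\<close>

definition modulus :: "'m \<Rightarrow> 'm \<Rightarrow> 'm" where
  "modulus m x = on \<oplus> (x \<oplus> on) \<otimes> m"

definition code :: "'m \<Rightarrow> 'm \<Rightarrow> 'm \<Rightarrow> bool" where
  "code c m x \<longleftrightarrow> (\<exists>q. q \<prec> c \<oplus> on \<and> c = modulus m x \<otimes> q)"

lemma code_iff: "code c m x \<longleftrightarrow> dv (modulus m x) c"
proof
  assume "dv (modulus m x) c"
  then obtain q where q: "c = modulus m x \<otimes> q" unfolding dv_def by blast
  then have "c = q \<oplus> (x \<oplus> on) \<otimes> m \<otimes> q" unfolding modulus_def by (simp add: distrib_right)
  then have "q \<prec> c \<oplus> on" using ls_pl1 by metis
  then show "code c m x" unfolding code_def using q by blast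
qed (auto simp: code_def dv_def)

lemma delta0_code: "term_fun n S \<Longrightarrow> term_fun n T \<Longrightarrow> term_fun n U \<Longrightarrow> delta0 n (\<lambda>e. code (S e) (T e) (U e))"
  unfolding code_def modulus_def
  by (rule delta0_bex, rule term_fun_pl, assumption, rule term_fun_const,
      intro delta0_eq term_fun_pl term_fun_ti term_fun_const term_fun_var term_fun_lift; simp)

text \<open>This is coprimality of the moduli in the form of Euclid's lemma. The modulus of
  \<open>x\<close> divides the multiples by \<open>c\<close> of both moduli, hence their difference,
  which is \<open>c \<otimes> m\<close> times the distance of \<open>x\<close> and \<open>y\<close>.
  That distance divides \<open>m\<close>, and \<open>m\<close> can be cancelled because the modulus
  of \<open>x\<close> is one more than a multiple of \<open>m\<close>.\<close>

lemma dv_modulus_cancel: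
  assumes m: "\<And>i. i \<prec> b \<Longrightarrow> dv (i \<oplus> on) m" and xy: "x \<prec> b" "y \<prec> b" "x \<noteq> y"
    and dv: "dv (modulus m x) (c \<otimes> modulus m y)"
  shows "dv (modulus m x) c"
proof -
  let ?u = "modulus m x" and ?v = "modulus m y"
  have step: "dv ?u c" if "dv ?u (c \<otimes> m)" for c
  proof -
    have "dv ?u ((x \<oplus> on) \<otimes> (c \<otimes> m))" using dv_ti_right[OF that, of "x \<oplus> on"] by (simp add: ti_commute)
    moreover have "(x \<oplus> on) \<otimes> (c \<otimes> m) \<oplus> c = c \<otimes> ?u" unfolding modulus_def by (simp add: semiring)
    ultimately show ?thesis using dv_pl_cancel[of ?u "(x \<oplus> on) \<otimes> (c \<otimes> m)" c] by simp
  qed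
  obtain d where d: "d \<prec> b" and dv2: "dv ?u (c \<otimes> ((d \<oplus> on) \<otimes> m))"
  proof -
    consider "x \<prec> y" | "y \<prec> x" using xy ls_linear by blast
    then show ?thesis
    proof cases
      case 1
      then obtain d where y: "y = x \<oplus> (d \<oplus> on)" unfolding ls_iff by blast
      have "d \<prec> y" unfolding y using ls_pl2[of d x] by (simp add: pl_assoc)
      moreover have "c \<otimes> ?v = c \<otimes> ?u \<oplus> c \<otimes> ((d \<oplus> on) \<otimes> m)"
        unfolding y modulus_def by (simp add: semiring)
      then have "dv ?u (c \<otimes> ((d \<oplus> on) \<otimes> m))"
        using dv dv_pl_cancel[of ?u "c \<otimes> ?u"] by simp
      ultimately show ?thesis using that ls_trans xy(2) by blast
    next
      case 2
      then obtain d where x: "x = y \<oplus> (d \<oplus> on)" unfolding ls_iff by blast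
      have "d \<prec> x" unfolding x using ls_pl2[of d y] by (simp add: pl_assoc)
      moreover have "c \<otimes> ?u = c \<otimes> ?v \<oplus> c \<otimes> ((d \<oplus> on) \<otimes> m)"
        unfolding x modulus_def by (simp add: semiring)
      then have "dv ?u (c \<otimes> ((d \<oplus> on) \<otimes> m))"
        using dv_pl_cancel[OF dv] dv_ti(2)[of ?u c] by simp
      ultimately show ?thesis using that ls_trans xy(1) by blast
    qed
  qed
  \<comment> \<open>Multiplying by the cofactor \<open>q\<close> turns the distance
    \<open>d \<oplus> on\<close> into a second factor \<open>m\<close>; then \<open>step\<close>
    removes both factors.\<close>
  obtain q where q: "m = (d \<oplus> on) \<otimes> q" using m[OF d] unfolding dv_def by blast
  have "c \<otimes> ((d \<oplus> on) \<otimes> m) \<otimes> q = c \<otimes> m \<otimes> ((d \<oplus> on) \<otimes> q)"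
    by (simp only: ti_assoc ti_commute ti_left_commute)
  then have "dv ?u (c \<otimes> m \<otimes> m)" using dv_ti_right[OF dv2, of q] q by simp
  then show ?thesis using step by blast
qed

text \<open>A substitute for the factorial, built up one factor at a time. The condition
  \<open>m \<noteq> ze\<close> excludes the degenerate case in which all moduli are one.\<close>

lemma common_multiple_exists: "\<exists>m. m \<noteq> ze \<and> (\<forall>i. i \<prec> b \<longrightarrow> dv (i \<oplus> on) m)"
proof (rule sigma1_induct[of "\<lambda>b. \<exists>m. m \<noteq> ze \<and> (\<forall>i. i \<prec> b \<longrightarrow> dv (i \<oplus> on) m)"])
  show "sigma1 (Suc 0) (\<lambda>e. \<exists>m. m \<noteq> ze \<and> (\<forall>i. i \<prec> e 0 \<longrightarrow> dv (i \<oplus> on) m))"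
    unfolding dv_def by (intro sigma1_intros delta0_intros; simp)
  show "\<exists>m. m \<noteq> ze \<and> (\<forall>i. i \<prec> ze \<longrightarrow> dv (i \<oplus> on) m)"
    by (auto intro: exI[of _ on])
  fix b assume "\<exists>m. m \<noteq> ze \<and> (\<forall>i. i \<prec> b \<longrightarrow> dv (i \<oplus> on) m)"
  then obtain m where m: "m \<noteq> ze" "\<forall>i. i \<prec> b \<longrightarrow> dv (i \<oplus> on) m" by blast
  then have "m \<otimes> (b \<oplus> on) \<noteq> ze" by (simp add: ti_succ pl_eq_ze)
  then show "\<exists>m. m \<noteq> ze \<and> (\<forall>i. i \<prec> b \<oplus> on \<longrightarrow> dv (i \<oplus> on) m)"
    using m(2) dv_ti_right unfolding ls_succ by (intro exI[of _ "m \<otimes> (b \<oplus> on)"]) auto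
qed

text \<open>The code is the product of the moduli of the elements of \<open>X\<close> below
  \<open>b\<close>, formed by induction on \<open>j\<close>. By coprimality, multiplying with the
  modulus of \<open>j\<close> changes divisibility at the index \<open>j\<close> only.\<close>

lemma set_code_exists: "\<exists>c m. \<forall>x. x \<prec> b \<longrightarrow> (code c m x \<longleftrightarrow> x \<epsilon> X)"
proof -
  obtain m where m: "m \<noteq> ze" "\<And>i. i \<prec> b \<Longrightarrow> dv (i \<oplus> on) m"
    using common_multiple_exists by blast
  have "\<exists>c. \<forall>x. x \<prec> b \<longrightarrow> (code c m x \<longleftrightarrow> x \<epsilon> X \<and> x \<prec> b)"
  proof (rule sigma1_induct[of "\<lambda>j. \<exists>c. \<forall>x. x \<prec> b \<longrightarrow> (code c m x \<longleftrightarrow> x \<epsilon> X \<and> x \<prec> j)"])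
    show "sigma1 (Suc 0) (\<lambda>e. \<exists>c. \<forall>x. x \<prec> b \<longrightarrow> (code c m x \<longleftrightarrow> x \<epsilon> X \<and> x \<prec> e 0))"
      by (intro sigma1_ex sigma1_D0 delta0_intros delta0_code; simp)
    \<comment> \<open>The empty product 1 codes the empty set: since \<open>m\<close> is not zero,
      every modulus exceeds 1 and cannot divide it.\<close>
    have "\<not> code on m x" for x
    proof
      assume "code on m x"
      then obtain q where q: "on = modulus m x \<otimes> q" unfolding code_iff dv_def by blast
      have "modulus m x \<otimes> q = (x \<oplus> on) \<otimes> m \<otimes> q \<oplus> q"
        unfolding modulus_def by (simp only: distrib_right[of on] on_ti pl_commute[of q])
      then have eq: "ze \<oplus> on = (x \<oplus> on) \<otimes> m \<otimes> q \<oplus> q" using q by (simp only: ze_pl)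
      have "q \<noteq> ze" using q on_neq_ze by (metis ti_ze)
      then obtain r where r: "q = r \<oplus> on" using ze_or_succ by blast
      have "ze \<oplus> on = ((x \<oplus> on) \<otimes> m \<otimes> q \<oplus> r) \<oplus> on" using eq r by (metis pl_assoc)
      then have "(x \<oplus> on) \<otimes> m \<otimes> q = ze" unfolding pl_cancel_right using pl_eq_ze by metis
      then have "x \<otimes> m \<otimes> q \<oplus> (m \<otimes> r \<oplus> m) = ze" unfolding r by (simp add: distrib_right distrib_left pl_ac)
      then show False using m(1) unfolding pl_eq_ze by blast
    qed
    then show "\<exists>c. \<forall>x. x \<prec> b \<longrightarrow> (code c m x \<longleftrightarrow> x \<epsilon> X \<and> x \<prec> ze)"
      by (intro exI[of _ on]) simp
    fix j assume "\<exists>c. \<forall>x. x \<prec> b \<longrightarrow> (code c m x \<longleftrightarrow> x \<epsilon> X \<and> x \<prec> j)"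
    then obtain c where c: "\<And>x. x \<prec> b \<Longrightarrow> code c m x \<longleftrightarrow> x \<epsilon> X \<and> x \<prec> j" by blast
    show "\<exists>c. \<forall>x. x \<prec> b \<longrightarrow> (code c m x \<longleftrightarrow> x \<epsilon> X \<and> x \<prec> j \<oplus> on)"
    proof (cases "j \<epsilon> X \<and> j \<prec> b")
      case False
      then show ?thesis using c unfolding ls_succ by blast
    next
      case True
      have "code (c \<otimes> modulus m j) m x \<longleftrightarrow> x \<epsilon> X \<and> (x \<prec> j \<or> x = j)" if x: "x \<prec> b" for x
      proof (cases "x = j")
        case True
        then show ?thesis using \<open>j \<epsilon> X \<and> j \<prec> b\<close> by (simp add: code_iff)
      next
        case False
        have "code (c \<otimes> modulus m j) m x \<longleftrightarrow> code c m x"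
          unfolding code_iff using dv_modulus_cancel[of b m x j c, OF m(2) x _ False] True dv_ti_right by blast
        then show ?thesis using c[OF x] False by simp
      qed
      then show ?thesis unfolding ls_succ by blast
    qed
  qed
  then show ?thesis by blast
qed


section \<open>Definable functions and their codes\<close>

text \<open>Ties a function of the metalogic to a set of the model, so that equations between values
  replace statements about pairs. Values outside \<open>D\<close> are left open.\<close>

definition graph_set :: "('m \<Rightarrow> bool) \<Rightarrow> ('m \<Rightarrow> 'm) \<Rightarrow> 's \<Rightarrow> bool" where
  "graph_set D g F \<longleftrightarrow> (\<forall>p. p \<epsilon> F \<longleftrightarrow> (\<exists>i. D i \<and> p = pr i (g i)))"

lemma graph_set_pr: "graph_set D g F \<Longrightarrow> pr i y \<epsilon> F \<longleftrightarrow> D i \<and> y = g i"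
  unfolding graph_set_def by auto

text \<open>A \<open>\<Sigma>\<^sup>0\<^sub>1\<close> graph on a bounded domain is
  \<open>\<Delta>\<^sup>0\<^sub>1\<close>: an element is outside it if it is not a pair, or its
  first component is outside \<open>D\<close>, or \<open>Q\<close> holds for a different second
  component. The last case replaces the negation of \<open>Q\<close>.\<close>

lemma graph_comprehension:
  assumes D: "delta0 (Suc 0) (\<lambda>e. D (e 0))" and Q: "sigma1 (Suc (Suc 0)) (\<lambda>e. Q (e 0) (e (Suc 0)))"
    and g: "\<And>i y. D i \<Longrightarrow> Q i y \<longleftrightarrow> y = g i"
  obtains F where "graph_set D g F"
proof -
  define P where "P p \<longleftrightarrow> (\<exists>i y. D i \<and> p = pr i y \<and> Q i y)" for p
  have 1: "sigma1 (Suc 0) (\<lambda>e. P (e 0))"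
    unfolding P_def
    by (intro sigma1_intros delta0_intros term_fun_pr sigma1_app2[OF Q] sigma1_D0[OF delta0_app1[OF D]]; simp)
  have "sigma1 (Suc 0) (\<lambda>e. (\<forall>i. i \<prec> e 0 \<oplus> on \<longrightarrow> (\<forall>y. y \<prec> e 0 \<oplus> on \<longrightarrow> e 0 \<noteq> pr i y)) \<or>
      (\<exists>i y. e 0 = pr i y \<and> (\<not> D i \<or> (\<exists>w. w \<noteq> y \<and> Q i w))))"
    by (intro sigma1_intros delta0_intros term_fun_pr sigma1_app2[OF Q] delta0_app1[OF D]; simp)
  then have 2: "sigma1 (Suc 0) (\<lambda>e. \<not> P (e 0))"
  proof (rule sigma1_cong)
    fix e :: "nat \<Rightarrow> 'm"
    have "(\<forall>i. i \<prec> p \<oplus> on \<longrightarrow> (\<forall>y. y \<prec> p \<oplus> on \<longrightarrow> p \<noteq> pr i y)) \<longleftrightarrow> (\<forall>i y. p \<noteq> pr i y)" for p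
      using ls_pr1 ls_pr2 by blast
    then show "((\<forall>i. i \<prec> e 0 \<oplus> on \<longrightarrow> (\<forall>y. y \<prec> e 0 \<oplus> on \<longrightarrow> e 0 \<noteq> pr i y)) \<or>
      (\<exists>i y. e 0 = pr i y \<and> (\<not> D i \<or> (\<exists>w. w \<noteq> y \<and> Q i w)))) = (\<not> P (e 0))"
      unfolding P_def using g by auto
  qed
  obtain F where F: "\<And>p. p \<epsilon> F \<longleftrightarrow> P p"
    using delta1_comprehension[OF 1 2] by blast
  have "(\<exists>y. D i \<and> p = pr i y \<and> Q i y) \<longleftrightarrow> D i \<and> p = pr i (g i)" for i p
    using g[of i] by auto
  then have "graph_set D g F"
    unfolding graph_set_def F P_def by simp
  then show thesis by (rule that)
qed

definition seq_fun :: "'m \<Rightarrow> ('m \<Rightarrow> 'm) \<Rightarrow> bool" where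
  "seq_fun n g \<longleftrightarrow> (\<exists>F. graph_set (\<lambda>i. i \<prec> n) g F)"

lemma seq_fun_I:
  assumes "sigma1 (Suc (Suc 0)) (\<lambda>e. Q (e 0) (e (Suc 0)))" "\<And>i y. i \<prec> n \<Longrightarrow> Q i y \<longleftrightarrow> y = g i"
  shows "seq_fun n g"
proof -
  have "delta0 (Suc 0) (\<lambda>e. e 0 \<prec> n)" by (intro delta0_intros; simp)
  then show ?thesis
    unfolding seq_fun_def using graph_comprehension[of "\<lambda>i. i \<prec> n" Q g] assms by blast
qed

lemma seq_fun_graph: "seq_fun n g \<Longrightarrow> \<exists>F. \<forall>i y. pr i y \<epsilon> F \<longleftrightarrow> i \<prec> n \<and> y = g i"
  using graph_set_pr unfolding seq_fun_def by blast

lemma seq_fun_ze: "seq_fun ze g"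
  by (rule seq_fun_I[of "\<lambda>_ _. False"]) (auto intro: sigma1_D0 delta0_const)

lemma seq_fun_append: assumes "seq_fun n g" shows "seq_fun (n \<oplus> on) (g(n := v))"
proof -
  obtain F where "\<forall>i y. pr i y \<epsilon> F \<longleftrightarrow> i \<prec> n \<and> y = g i" using seq_fun_graph[OF assms] ..
  then have F: "pr i y \<epsilon> F \<longleftrightarrow> i \<prec> n \<and> y = g i" for i y by simp
  show ?thesis
  proof (rule seq_fun_I[of "\<lambda>i y. pr i y \<epsilon> F \<or> i = n \<and> y = v"])
    show "sigma1 (Suc (Suc 0)) (\<lambda>e. pr (e 0) (e (Suc 0)) \<epsilon> F \<or> e 0 = n \<and> e (Suc 0) = v)"
      by (intro sigma1_intros delta0_intros term_fun_pr; simp)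
    fix i y assume "i \<prec> n \<oplus> on"
    then show "(pr i y \<epsilon> F \<or> i = n \<and> y = v) \<longleftrightarrow> y = (g(n := v)) i"
      unfolding ls_succ by (auto simp: F)
  qed
qed

text \<open>\<open>(B, c, m)\<close> codes the function whose value at \<open>i\<close> is the least \<open>x\<close> with \<open>pr i x\<close> below \<open>B\<close>
  and in the set coded by \<open>(c, m)\<close>; taking the least value makes every triple a code.\<close>

definition code_fun :: "'m \<Rightarrow> 'm \<Rightarrow> 'm \<Rightarrow> 'm \<Rightarrow> 'm \<Rightarrow> bool" where
  "code_fun B c m i x \<longleftrightarrow> pr i x \<prec> B \<and> code c m (pr i x) \<and> (\<forall>y. y \<prec> x \<longrightarrow> \<not> (pr i y \<prec> B \<and> code c m (pr i y)))"

lemma delta0_code_fun: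
  "term_fun n B \<Longrightarrow> term_fun n c \<Longrightarrow> term_fun n m \<Longrightarrow> term_fun n S \<Longrightarrow> term_fun n T \<Longrightarrow>
    delta0 n (\<lambda>e. code_fun (B e) (c e) (m e) (S e) (T e))"
  unfolding code_fun_def
  by (intro delta0_conj delta0_not delta0_ls delta0_code delta0_ball term_fun_pr term_fun_var term_fun_lift; simp)

lemma code_fun_unique: "code_fun B c m i x \<Longrightarrow> code_fun B c m i y \<Longrightarrow> x = y"
  unfolding code_fun_def using ls_linear by blast

text \<open>Collection bounds all pairs of the graph by one \<open>B\<close>, and below
  \<open>B\<close> the graph agrees with a set that has a numerical code.\<close>

lemma seq_fun_code:
  assumes "seq_fun n g"
  shows "\<exists>B c m. \<forall>i. i \<prec> n \<longrightarrow> code_fun B c m i (g i)"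
proof -
  obtain F where "\<forall>i y. pr i y \<epsilon> F \<longleftrightarrow> i \<prec> n \<and> y = g i" using seq_fun_graph[OF assms] ..
  then have F: "pr i y \<epsilon> F \<longleftrightarrow> i \<prec> n \<and> y = g i" for i y by simp
  \<comment> \<open>Collection is applied to the pair and not to the value, because \<open>B\<close>
    has to bound the pairs themselves.\<close>
  define Q where "Q i p \<longleftrightarrow> p \<epsilon> F \<and> (\<exists>y. y \<prec> p \<oplus> on \<and> p = pr i y)" for i p
  have "delta0 (Suc (Suc 0)) (\<lambda>e. Q (e 0) (e (Suc 0)))"
    unfolding Q_def by (intro delta0_intros term_fun_pr; simp)
  moreover have "\<exists>p. Q i p" if "i \<prec> n" for i
    unfolding Q_def using that F[of i "g i"] ls_pr2[of "g i" i] by (intro exI[of _ "pr i (g i)"]) auto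
  ultimately obtain B where B: "\<And>i. i \<prec> n \<Longrightarrow> \<exists>p. p \<prec> B \<and> Q i p"
    using delta0_collection[of Q n] by blast
  obtain c m where cm: "\<And>x. x \<prec> B \<Longrightarrow> code c m x \<longleftrightarrow> x \<epsilon> F" using set_code_exists by blast
  have "code_fun B c m i (g i)" if i: "i \<prec> n" for i
  proof -
    obtain y where "pr i y \<prec> B" "pr i y \<epsilon> F" using B[OF i] unfolding Q_def by blast
    then have "pr i (g i) \<prec> B" by (simp add: F)
    then show ?thesis unfolding code_fun_def using i by (auto simp: cm F)
  qed
  then show ?thesis by blast
qed

text \<open>The way back from numbers to sets: the relation \<open>code_fun\<close> is bounded and
  single-valued, so comprehension yields the graph.\<close>

lemma seq_fun_of_code:
  assumes "\<And>i. i \<prec> n \<Longrightarrow> code_fun B c m i (g i)"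
  shows "seq_fun n g"
proof (rule seq_fun_I[of "code_fun B c m"])
  show "sigma1 (Suc (Suc 0)) (\<lambda>e. code_fun B c m (e 0) (e (Suc 0)))"
    by (intro sigma1_D0 delta0_code_fun term_fun_const term_fun_var; simp)
qed (use assms code_fun_unique in blast)


section \<open>The meaning of the formulas\<close>

text \<open>The definitions with prefix \<open>s_\<close> follow the object formulas quantifier by
  quantifier. Thereby each translation below closes by rewriting both sides to the same
  statement.\<close>

definition s_fun :: "'s \<Rightarrow> ('m \<Rightarrow> bool) \<Rightarrow> ('m \<Rightarrow> bool) \<Rightarrow> bool" where
  "s_fun f D K \<longleftrightarrow>
    (\<forall>p. p \<epsilon> f \<longrightarrow> (\<exists>x. D x \<and> (\<exists>y. K y \<and> p = pr x y))) \<and>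
    (\<forall>x. D x \<longrightarrow> (\<exists>y. pr x y \<epsilon> f \<and> (\<forall>w. pr x w \<epsilon> f \<longrightarrow> w = y)))"

lemma s_fun_iff: "s_fun f D K \<longleftrightarrow> (\<exists>g. graph_set D g f \<and> (\<forall>x. D x \<longrightarrow> K (g x)))"
proof
  assume f: "s_fun f D K"
  then have "\<forall>x. \<exists>y. D x \<longrightarrow> pr x y \<epsilon> f \<and> (\<forall>w. pr x w \<epsilon> f \<longrightarrow> w = y)"
    unfolding s_fun_def by blast
  then obtain g where g: "\<And>x. D x \<Longrightarrow> pr x (g x) \<epsilon> f \<and> (\<forall>w. pr x w \<epsilon> f \<longrightarrow> w = g x)"
    by metis
  have pairs: "\<exists>x. D x \<and> (\<exists>y. K y \<and> p = pr x y)" if "p \<epsilon> f" for p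
    using f that unfolding s_fun_def by blast
  have "graph_set D g f"
    unfolding graph_set_def using g pairs by blast
  moreover have "K (g x)" if "D x" for x
    using pairs[of "pr x (g x)"] g[OF that] by auto
  ultimately show "\<exists>g. graph_set D g f \<and> (\<forall>x. D x \<longrightarrow> K (g x))" by blast
next
  assume "\<exists>g. graph_set D g f \<and> (\<forall>x. D x \<longrightarrow> K (g x))"
  then show "s_fun f D K" unfolding s_fun_def graph_set_def by auto
qed

definition s_ring :: "'s \<Rightarrow> 's \<Rightarrow> 's \<Rightarrow> 'm \<Rightarrow> 'm \<Rightarrow> bool" where
  "s_ring C A M z e \<longleftrightarrow>
    s_fun A (\<lambda>p. \<exists>x. x \<epsilon> C \<and> (\<exists>y. y \<epsilon> C \<and> p = pr x y)) (\<lambda>x. x \<epsilon> C) \<and>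
    s_fun M (\<lambda>p. \<exists>x. x \<epsilon> C \<and> (\<exists>y. y \<epsilon> C \<and> p = pr x y)) (\<lambda>x. x \<epsilon> C) \<and>
    z \<epsilon> C \<and> e \<epsilon> C \<and>
    (\<forall>x. x \<epsilon> C \<longrightarrow> (\<forall>y. y \<epsilon> C \<longrightarrow> (\<forall>t. t \<epsilon> C \<longrightarrow>
      (\<exists>u v w. pr (pr x y) u \<epsilon> A \<and> pr (pr u t) w \<epsilon> A \<and> pr (pr y t) v \<epsilon> A \<and> pr (pr x v) w \<epsilon> A)))) \<and>
    (\<forall>x. x \<epsilon> C \<longrightarrow> (\<forall>y. y \<epsilon> C \<longrightarrow> (\<exists>u. pr (pr x y) u \<epsilon> A \<and> pr (pr y x) u \<epsilon> A))) \<and>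
    (\<forall>x. x \<epsilon> C \<longrightarrow> pr (pr x z) x \<epsilon> A) \<and>
    (\<forall>x. x \<epsilon> C \<longrightarrow> (\<exists>y. y \<epsilon> C \<and> pr (pr x y) z \<epsilon> A)) \<and>
    (\<forall>x. x \<epsilon> C \<longrightarrow> (\<forall>y. y \<epsilon> C \<longrightarrow> (\<forall>t. t \<epsilon> C \<longrightarrow>
      (\<exists>u v w. pr (pr x y) u \<epsilon> M \<and> pr (pr u t) w \<epsilon> M \<and> pr (pr y t) v \<epsilon> M \<and> pr (pr x v) w \<epsilon> M)))) \<and>
    (\<forall>x. x \<epsilon> C \<longrightarrow> (\<forall>y. y \<epsilon> C \<longrightarrow> (\<exists>u. pr (pr x y) u \<epsilon> M \<and> pr (pr y x) u \<epsilon> M))) \<and>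
    (\<forall>x. x \<epsilon> C \<longrightarrow> pr (pr x e) x \<epsilon> M) \<and>
    (\<forall>x. x \<epsilon> C \<longrightarrow> (\<forall>y. y \<epsilon> C \<longrightarrow> (\<forall>t. t \<epsilon> C \<longrightarrow>
      (\<exists>s u v w. pr (pr y t) s \<epsilon> A \<and> pr (pr x s) w \<epsilon> M \<and> pr (pr x y) u \<epsilon> M \<and> pr (pr x t) v \<epsilon> M \<and> pr (pr u v) w \<epsilon> A))))"

definition s_lin :: "'s \<Rightarrow> 's \<Rightarrow> 'm \<Rightarrow> 'm \<Rightarrow> 'm \<Rightarrow> 'm \<Rightarrow> 'm \<Rightarrow> bool" where
  "s_lin A M a x b y d \<longleftrightarrow> (\<exists>u v. pr (pr a x) u \<epsilon> M \<and> pr (pr b y) v \<epsilon> M \<and> pr (pr u v) d \<epsilon> A)"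

definition s_divides :: "'s \<Rightarrow> 's \<Rightarrow> 'm \<Rightarrow> 'm \<Rightarrow> bool" where
  "s_divides C M a b \<longleftrightarrow> (\<exists>r. r \<epsilon> C \<and> pr (pr a r) b \<epsilon> M)"

definition s_gcd :: "'s \<Rightarrow> 's \<Rightarrow> ('m \<Rightarrow> bool) \<Rightarrow> 'm \<Rightarrow> bool" where
  "s_gcd C M P d \<longleftrightarrow> d \<epsilon> C \<and> (\<forall>a. P a \<longrightarrow> s_divides C M d a) \<and>
    (\<forall>c. c \<epsilon> C \<longrightarrow> (\<forall>a. P a \<longrightarrow> s_divides C M c a) \<longrightarrow> s_divides C M c d)"

definition s_ideal :: "'s \<Rightarrow> 's \<Rightarrow> 's \<Rightarrow> 'm \<Rightarrow> ('m \<Rightarrow> bool) \<Rightarrow> 'm \<Rightarrow> bool" where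
  "s_ideal C A M z P b \<longleftrightarrow> (\<exists>n a r s.
     s_fun a (\<lambda>i. i \<prec> n) P \<and> s_fun r (\<lambda>i. i \<prec> n) (\<lambda>x. x \<epsilon> C) \<and> s_fun s (\<lambda>i. i \<prec> n \<oplus> on) (\<lambda>x. x \<epsilon> C) \<and>
     pr ze z \<epsilon> s \<and>
     (\<forall>i. i \<prec> n \<longrightarrow> (\<exists>x y p u v. pr i x \<epsilon> a \<and> pr i y \<epsilon> r \<and> pr (pr x y) p \<epsilon> M \<and>
        pr i u \<epsilon> s \<and> pr (pr u p) v \<epsilon> A \<and> pr (i \<oplus> on) v \<epsilon> s)) \<and>
     pr n b \<epsilon> s)"

definition bezout_pairs :: "'s \<Rightarrow> 's \<Rightarrow> 's \<Rightarrow> bool" where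
  "bezout_pairs C A M \<longleftrightarrow> (\<forall>a. a \<epsilon> C \<longrightarrow> (\<forall>b. b \<epsilon> C \<longrightarrow> (\<exists>d. s_gcd C M (\<lambda>x. x = a \<or> x = b) d \<and>
     (\<exists>x. x \<epsilon> C \<and> (\<exists>y. y \<epsilon> C \<and> s_lin A M a x b y d)))))"

definition bezout_finite_sets :: "'s \<Rightarrow> 's \<Rightarrow> 's \<Rightarrow> 'm \<Rightarrow> bool" where
  "bezout_finite_sets C A M z \<longleftrightarrow> (\<forall>X. (\<exists>k. \<forall>i. i \<epsilon> X \<longrightarrow> i \<prec> k) \<and> (\<forall>a. a \<epsilon> X \<longrightarrow> a \<epsilon> C) \<longrightarrow>
     (\<exists>d. s_gcd C M (\<lambda>x. x \<epsilon> X) d \<and> s_ideal C A M z (\<lambda>x. x \<epsilon> X) d))"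

definition principal_sums :: "'s \<Rightarrow> 's \<Rightarrow> 's \<Rightarrow> bool" where
  "principal_sums C A M \<longleftrightarrow> (\<forall>a. a \<epsilon> C \<longrightarrow> (\<forall>b. b \<epsilon> C \<longrightarrow> (\<exists>d. d \<epsilon> C \<and>
     (\<forall>c. (\<exists>r. r \<epsilon> C \<and> (\<exists>s. s \<epsilon> C \<and> s_lin A M a r b s c)) \<longleftrightarrow> (\<exists>r. r \<epsilon> C \<and> pr (pr d r) c \<epsilon> M)))))"

definition s_sigma01_ideal :: "'s \<Rightarrow> 's \<Rightarrow> 's \<Rightarrow> 's \<Rightarrow> bool" where
  "s_sigma01_ideal C A M f \<longleftrightarrow> s_fun f (\<lambda>i. i = i) (\<lambda>x. x \<epsilon> C) \<and>
     (\<forall>i j r. r \<epsilon> C \<longrightarrow> (\<forall>s. s \<epsilon> C \<longrightarrow>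
        (\<exists>k x y w. pr i x \<epsilon> f \<and> pr j y \<epsilon> f \<and> pr k w \<epsilon> f \<and> s_lin A M x r y s w)))"

definition fg_ideals_principal :: "'s \<Rightarrow> 's \<Rightarrow> 's \<Rightarrow> 'm \<Rightarrow> bool" where
  "fg_ideals_principal C A M z \<longleftrightarrow> (\<forall>f. s_sigma01_ideal C A M f \<and>
     (\<exists>n c. s_fun c (\<lambda>i. i \<prec> n) (\<lambda>x. x \<epsilon> C) \<and>
        (\<forall>x. (\<exists>i. pr i x \<epsilon> f) \<longleftrightarrow> s_ideal C A M z (\<lambda>y. \<exists>i. pr i y \<epsilon> c) x)) \<longrightarrow>
     (\<exists>c. c \<epsilon> C \<and> (\<forall>x. (\<exists>i. pr i x \<epsilon> f) \<longleftrightarrow> (\<exists>r. r \<epsilon> C \<and> pr (pr c r) x \<epsilon> M))))"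

text \<open>The ring as it occurs below the five quantifiers of \<^const>\<open>all_rings\<close>.\<close>

definition R0 :: ring_code where
  "R0 = \<lparr>carrier = \<lambda>l. l - Suc 0, add_graph = \<lambda>l. l - Suc (Suc 0), mult_graph = \<lambda>l. l - Suc (Suc (Suc 0)),
    zero_elt = \<lambda>k. Var (k - Suc 0), one_elt = \<lambda>k. Var (k - Suc (Suc 0))\<rparr>"

lemma val_ntm:
  "val e (pair s t k) = pr (val e (s k)) (val e (t k))"
  "val e ((s \<^bold>+ t) k) = val e (s k) \<oplus> val e (t k)"
  "val e (\<^bold>0 k) = ze"
  "val e (\<^bold>1 k) = on"
  by (simp_all add: pair_def pr_def plus_t_def times_t_def zero_t_def one_t_def)

lemma sat_form:
  "sat e E ((\<^bold>\<forall>x. F x) k l) \<longleftrightarrow> (\<forall>x. sat (case_nat x e) E (F (\<lambda>k'. Var (k' - Suc k)) (Suc k) l))"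
  "sat e E ((\<^bold>\<exists>x. F x) k l) \<longleftrightarrow> (\<exists>x. sat (case_nat x e) E (F (\<lambda>k'. Var (k' - Suc k)) (Suc k) l))"
  "sat e E ((\<^bold>\<forall>\<^sub>S X. G X) k l) \<longleftrightarrow> (\<forall>X. sat e (case_nat X E) (G (\<lambda>l'. l' - Suc l) k (Suc l)))"
  "sat e E ((\<^bold>\<exists>\<^sub>S X. G X) k l) \<longleftrightarrow> (\<exists>X. sat e (case_nat X E) (G (\<lambda>l'. l' - Suc l) k (Suc l)))"
  "sat e E ((\<phi> \<^bold>\<and> \<psi>) k l) \<longleftrightarrow> sat e E (\<phi> k l) \<and> sat e E (\<psi> k l)"
  "sat e E ((\<phi> \<^bold>\<or> \<psi>) k l) \<longleftrightarrow> sat e E (\<phi> k l) \<or> sat e E (\<psi> k l)"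
  "sat e E ((\<phi> \<^bold>\<longrightarrow> \<psi>) k l) \<longleftrightarrow> (sat e E (\<phi> k l) \<longrightarrow> sat e E (\<psi> k l))"
  "sat e E ((\<phi> \<^bold>\<longleftrightarrow> \<psi>) k l) \<longleftrightarrow> (sat e E (\<phi> k l) \<longleftrightarrow> sat e E (\<psi> k l))"
  "sat e E ((s \<^bold>= t) k l) \<longleftrightarrow> val e (s k) = val e (t k)"
  "sat e E ((s \<^bold>< t) k l) \<longleftrightarrow> val e (s k) \<prec> val e (t k)"
  "sat e E ((t \<^bold>\<in> X) k l) \<longleftrightarrow> val e (t k) \<epsilon> E (X l)"
  by (auto simp: sat_defs)

lemmas R0_simps = sat_form val_ntm val.simps R0_def ring_code.simps el_def add_def mult_def in_set_def maps_def
  all_in_def ex_in_def is_fun_def is_seq_def is_finite_def entry_of_def times_p_def same_def numbers_def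
  lin_comb_def divides_def is_gcd_def doubleton_def ideal_gen_def principal_ideal_def principal_sum_def
  is_sigma01_ideal_def is_finitely_generated_def is_principal_def
  s_fun_def s_lin_def s_divides_def s_gcd_def s_ideal_def s_sigma01_ideal_def
  nat.case diff_Suc_Suc minus_nat.diff_0

context
  fixes e :: "nat \<Rightarrow> 'm" and E :: "nat \<Rightarrow> 's" and z on\<^sub>R :: 'm and C A M :: 's
begin

text \<open>The environment lists the values of the quantifiers in \<open>all_rings\<close>,
  innermost first, and the two levels count them in each sort.\<close>

abbreviation (input) satR :: "form \<Rightarrow> bool" where
  "satR \<phi> \<equiv> sat (case_nat on\<^sub>R (case_nat z e)) (case_nat M (case_nat A (case_nat C E)))
    (\<phi> (Suc (Suc 0)) (Suc (Suc (Suc 0))))"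

lemma sat_ring: "satR (comm_ring_with_unity R0) \<longleftrightarrow> s_ring C A M z on\<^sub>R"
  unfolding comm_ring_with_unity_def s_ring_def by (simp only: R0_simps)

lemma sat_bezout_pairs: "satR (pairs_have_bezout_gcd R0) \<longleftrightarrow> bezout_pairs C A M"
  unfolding pairs_have_bezout_gcd_def bezout_pairs_def by (simp only: R0_simps)

lemma sat_bezout_finite_sets: "satR (finite_sets_have_bezout_gcd R0) \<longleftrightarrow> bezout_finite_sets C A M z"
  unfolding finite_sets_have_bezout_gcd_def bezout_finite_sets_def by (simp only: R0_simps)

lemma sat_principal_sums: "satR (sums_of_principal_are_principal R0) \<longleftrightarrow> principal_sums C A M"
  unfolding sums_of_principal_are_principal_def principal_sums_def by (simp only: R0_simps)

lemma sat_fg_ideals_principal: "satR (fg_sigma01_ideals_are_principal R0) \<longleftrightarrow> fg_ideals_principal C A M z"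
  unfolding fg_sigma01_ideals_are_principal_def fg_ideals_principal_def by (simp only: R0_simps)

end

lemma sat_equivalences:
  "sat e E (sentence (\<^bold>\<forall>\<^sub>R R.
    (pairs_have_bezout_gcd R \<^bold>\<longleftrightarrow> finite_sets_have_bezout_gcd R) \<^bold>\<and>
    (finite_sets_have_bezout_gcd R \<^bold>\<longleftrightarrow> sums_of_principal_are_principal R) \<^bold>\<and>
    (sums_of_principal_are_principal R \<^bold>\<longleftrightarrow> fg_sigma01_ideals_are_principal R))) \<longleftrightarrow>
   (\<forall>C A M z e. s_ring C A M z e \<longrightarrow>
     (bezout_pairs C A M \<longleftrightarrow> bezout_finite_sets C A M z) \<and> (bezout_finite_sets C A M z \<longleftrightarrow> principal_sums C A M) \<and>
     (principal_sums C A M \<longleftrightarrow> fg_ideals_principal C A M z))"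
  unfolding all_rings_def
  by (simp only: sentence_def Let_def sat_form R0_def[symmetric] sat_ring sat_bezout_pairs sat_bezout_finite_sets sat_principal_sums sat_fg_ideals_principal)

end


section \<open>Countable rings in a model\<close>

locale ring_in_model = rca_model ze on pl ti ls mem
  for ze on :: "'m :: countable" and pl (infixl "\<oplus>" 65) and ti (infixl "\<otimes>" 70)
    and ls (infix "\<prec>" 50) and mem :: "'m \<Rightarrow> 's :: countable \<Rightarrow> bool" (infix "\<epsilon>" 50) +
  fixes C A M :: 's and z e :: 'm
  assumes ring: "s_ring C A M z e"
begin

section \<open>Ring operations as functions\<close>

text \<open>A description turns the graph into an operation of the metalogic, so that ring
  calculations can be done by rewriting. Outside the ring its values are unspecified, which is why
  the laws carry membership premises.\<close>

definition ad :: "'m \<Rightarrow> 'm \<Rightarrow> 'm" (infixl "\<^bold>+\<^sub>R" 65) where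
  "x \<^bold>+\<^sub>R y = (THE w. pr (pr x y) w \<epsilon> A)"

definition mu :: "'m \<Rightarrow> 'm \<Rightarrow> 'm" (infixl "\<^bold>\<cdot>\<^sub>R" 70) where
  "x \<^bold>\<cdot>\<^sub>R y = (THE w. pr (pr x y) w \<epsilon> M)"

lemma operation_graph:
  assumes "s_fun G (\<lambda>p. \<exists>x. x \<epsilon> C \<and> (\<exists>y. y \<epsilon> C \<and> p = pr x y)) (\<lambda>x. x \<epsilon> C)"
  shows "pr (pr x y) w \<epsilon> G \<longleftrightarrow> x \<epsilon> C \<and> y \<epsilon> C \<and> w = (THE w. pr (pr x y) w \<epsilon> G)"
    and "x \<epsilon> C \<Longrightarrow> y \<epsilon> C \<Longrightarrow> (THE w. pr (pr x y) w \<epsilon> G) \<epsilon> C"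
proof -
  obtain g where g: "graph_set (\<lambda>p. \<exists>x. x \<epsilon> C \<and> (\<exists>y. y \<epsilon> C \<and> p = pr x y)) g G"
    and cl: "\<forall>p. (\<exists>x. x \<epsilon> C \<and> (\<exists>y. y \<epsilon> C \<and> p = pr x y)) \<longrightarrow> g p \<epsilon> C"
    using assms unfolding s_fun_iff by blast
  have G: "pr (pr x y) w \<epsilon> G \<longleftrightarrow> x \<epsilon> C \<and> y \<epsilon> C \<and> w = g (pr x y)" for x y w
    using graph_set_pr[OF g] by auto
  have the: "(THE w. pr (pr x y) w \<epsilon> G) = g (pr x y)" if "x \<epsilon> C" "y \<epsilon> C" for x y
    using that by (simp add: G)
  show "pr (pr x y) w \<epsilon> G \<longleftrightarrow> x \<epsilon> C \<and> y \<epsilon> C \<and> w = (THE w. pr (pr x y) w \<epsilon> G)"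
    using the[of x y] G[of x y w] by metis
  show "(THE w. pr (pr x y) w \<epsilon> G) \<epsilon> C" if "x \<epsilon> C" "y \<epsilon> C"
    using the[OF that] cl that by auto
qed

lemma add_graph_iff: "pr (pr x y) w \<epsilon> A \<longleftrightarrow> x \<epsilon> C \<and> y \<epsilon> C \<and> w = x \<^bold>+\<^sub>R y"
  and mult_graph_iff: "pr (pr x y) w \<epsilon> M \<longleftrightarrow> x \<epsilon> C \<and> y \<epsilon> C \<and> w = x \<^bold>\<cdot>\<^sub>R y"
  and ad_closed [simp, intro]: "x \<epsilon> C \<Longrightarrow> y \<epsilon> C \<Longrightarrow> x \<^bold>+\<^sub>R y \<epsilon> C"
  and mu_closed [simp, intro]: "x \<epsilon> C \<Longrightarrow> y \<epsilon> C \<Longrightarrow> x \<^bold>\<cdot>\<^sub>R y \<epsilon> C"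
proof -
  have A: "s_fun A (\<lambda>p. \<exists>x. x \<epsilon> C \<and> (\<exists>y. y \<epsilon> C \<and> p = pr x y)) (\<lambda>x. x \<epsilon> C)"
    and M: "s_fun M (\<lambda>p. \<exists>x. x \<epsilon> C \<and> (\<exists>y. y \<epsilon> C \<and> p = pr x y)) (\<lambda>x. x \<epsilon> C)"
    using ring by (simp_all only: s_ring_def)
  show "pr (pr x y) w \<epsilon> A \<longleftrightarrow> x \<epsilon> C \<and> y \<epsilon> C \<and> w = x \<^bold>+\<^sub>R y"
    unfolding ad_def by (rule operation_graph(1)[OF A])
  show "pr (pr x y) w \<epsilon> M \<longleftrightarrow> x \<epsilon> C \<and> y \<epsilon> C \<and> w = x \<^bold>\<cdot>\<^sub>R y"
    unfolding mu_def by (rule operation_graph(1)[OF M])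
  show "x \<^bold>+\<^sub>R y \<epsilon> C" if "x \<epsilon> C" "y \<epsilon> C"
    unfolding ad_def using that by (rule operation_graph(2)[OF A])
  show "x \<^bold>\<cdot>\<^sub>R y \<epsilon> C" if "x \<epsilon> C" "y \<epsilon> C"
    unfolding mu_def using that by (rule operation_graph(2)[OF M])
qed

lemmas ring_laws = ring[simplified s_ring_def add_graph_iff mult_graph_iff, simplified]

lemma
  z_closed [simp]: "z \<epsilon> C" and e_closed [simp]: "e \<epsilon> C" and
  ad_assoc: "x \<epsilon> C \<Longrightarrow> y \<epsilon> C \<Longrightarrow> t \<epsilon> C \<Longrightarrow> (x \<^bold>+\<^sub>R y) \<^bold>+\<^sub>R t = x \<^bold>+\<^sub>R (y \<^bold>+\<^sub>R t)" and
  ad_commute: "x \<epsilon> C \<Longrightarrow> y \<epsilon> C \<Longrightarrow> x \<^bold>+\<^sub>R y = y \<^bold>+\<^sub>R x" and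
  ad_z [simp]: "x \<epsilon> C \<Longrightarrow> x \<^bold>+\<^sub>R z = x" and
  ad_inverse: "x \<epsilon> C \<Longrightarrow> \<exists>y. y \<epsilon> C \<and> x \<^bold>+\<^sub>R y = z" and
  mu_assoc: "x \<epsilon> C \<Longrightarrow> y \<epsilon> C \<Longrightarrow> t \<epsilon> C \<Longrightarrow> (x \<^bold>\<cdot>\<^sub>R y) \<^bold>\<cdot>\<^sub>R t = x \<^bold>\<cdot>\<^sub>R (y \<^bold>\<cdot>\<^sub>R t)" and
  mu_commute: "x \<epsilon> C \<Longrightarrow> y \<epsilon> C \<Longrightarrow> x \<^bold>\<cdot>\<^sub>R y = y \<^bold>\<cdot>\<^sub>R x" and
  mu_e [simp]: "x \<epsilon> C \<Longrightarrow> x \<^bold>\<cdot>\<^sub>R e = x" and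
  mu_ad: "x \<epsilon> C \<Longrightarrow> y \<epsilon> C \<Longrightarrow> t \<epsilon> C \<Longrightarrow> x \<^bold>\<cdot>\<^sub>R (y \<^bold>+\<^sub>R t) = x \<^bold>\<cdot>\<^sub>R y \<^bold>+\<^sub>R x \<^bold>\<cdot>\<^sub>R t"
  using ring_laws by metis+

lemma z_ad [simp]: "x \<epsilon> C \<Longrightarrow> z \<^bold>+\<^sub>R x = x"
  using ad_commute[of z x] by simp

lemma ad_left_commute: "x \<epsilon> C \<Longrightarrow> y \<epsilon> C \<Longrightarrow> t \<epsilon> C \<Longrightarrow> x \<^bold>+\<^sub>R (y \<^bold>+\<^sub>R t) = y \<^bold>+\<^sub>R (x \<^bold>+\<^sub>R t)"
  using ad_assoc[of x y t] ad_assoc[of y x t] ad_commute[of x y] by simp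

lemma mu_left_commute: "x \<epsilon> C \<Longrightarrow> y \<epsilon> C \<Longrightarrow> t \<epsilon> C \<Longrightarrow> x \<^bold>\<cdot>\<^sub>R (y \<^bold>\<cdot>\<^sub>R t) = y \<^bold>\<cdot>\<^sub>R (x \<^bold>\<cdot>\<^sub>R t)"
  using mu_assoc[of x y t] mu_assoc[of y x t] mu_commute[of x y] by simp

lemma ad_mu: "x \<epsilon> C \<Longrightarrow> y \<epsilon> C \<Longrightarrow> t \<epsilon> C \<Longrightarrow> (x \<^bold>+\<^sub>R y) \<^bold>\<cdot>\<^sub>R t = x \<^bold>\<cdot>\<^sub>R t \<^bold>+\<^sub>R y \<^bold>\<cdot>\<^sub>R t"
  using mu_ad[of t x y] mu_commute[of t] by simp

lemmas ring_simps = ad_assoc ad_commute ad_left_commute mu_assoc mu_commute mu_left_commute mu_ad ad_mu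

lemma mu_z [simp]: assumes x: "x \<epsilon> C" shows "x \<^bold>\<cdot>\<^sub>R z = z"
proof -
  let ?a = "x \<^bold>\<cdot>\<^sub>R z"
  have a: "?a \<epsilon> C" using x by simp
  obtain b where b: "b \<epsilon> C" "?a \<^bold>+\<^sub>R b = z" using ad_inverse[OF a] by blast
  have "?a = ?a \<^bold>+\<^sub>R ?a" using mu_ad[OF x, of z z] by simp
  then have "?a \<^bold>+\<^sub>R b = ?a \<^bold>+\<^sub>R (?a \<^bold>+\<^sub>R b)" using ad_assoc[OF a a b(1)] by simp
  then show ?thesis using a b(2) by simp
qed

lemma z_mu [simp]: "x \<epsilon> C \<Longrightarrow> z \<^bold>\<cdot>\<^sub>R x = z"
  using mu_commute[of z x] by simp

section \<open>Ideals generated by a predicate\<close>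

abbreviation "ideal \<equiv> s_ideal C A M z"

text \<open>With functions in place of graph sets, the partial sums obey a recursion equation. From
  right to left, the assumption on \<open>P\<close> puts the generators into the domain of
  multiplication.\<close>

lemma ideal_iff:
  assumes P: "\<forall>x. P x \<longrightarrow> x \<epsilon> C"
  shows "ideal P b \<longleftrightarrow> (\<exists>n a r s. seq_fun n a \<and> seq_fun n r \<and> seq_fun (n \<oplus> on) s \<and>
    (\<forall>i. i \<prec> n \<longrightarrow> P (a i) \<and> r i \<epsilon> C \<and> s (i \<oplus> on) = s i \<^bold>+\<^sub>R a i \<^bold>\<cdot>\<^sub>R r i) \<and>
    (\<forall>i. i \<prec> n \<oplus> on \<longrightarrow> s i \<epsilon> C) \<and> s ze = z \<and> s n = b)"
  (is "?l \<longleftrightarrow> ?r")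
proof
  have ze_ls: "ze \<prec> n \<oplus> on" for n using ls_pl1[of ze n] by simp
  have succ_ls: "i \<oplus> on \<prec> n \<oplus> on" "i \<prec> n \<oplus> on" if "i \<prec> n" for i n
    using that ls_pl_mono ls_succ by blast+
  have n_ls: "n \<prec> n \<oplus> on" for n by (simp add: ls_succ)
  {
    assume ?l
    then obtain n Fa Fr Fs where Fa: "s_fun Fa (\<lambda>i. i \<prec> n) P" and Fr: "s_fun Fr (\<lambda>i. i \<prec> n) (\<lambda>x. x \<epsilon> C)"
      and Fs: "s_fun Fs (\<lambda>i. i \<prec> n \<oplus> on) (\<lambda>x. x \<epsilon> C)" and Fz: "pr ze z \<epsilon> Fs" and Fb: "pr n b \<epsilon> Fs"
      and st: "\<forall>i. i \<prec> n \<longrightarrow> (\<exists>x y p u v. pr i x \<epsilon> Fa \<and> pr i y \<epsilon> Fr \<and> pr (pr x y) p \<epsilon> M \<and>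
        pr i u \<epsilon> Fs \<and> pr (pr u p) v \<epsilon> A \<and> pr (i \<oplus> on) v \<epsilon> Fs)"
      unfolding s_ideal_def by (elim exE conjE) (rule that)
    obtain a where a: "graph_set (\<lambda>i. i \<prec> n) a Fa" "\<forall>i. i \<prec> n \<longrightarrow> P (a i)" using Fa unfolding s_fun_iff by blast
    obtain r where r: "graph_set (\<lambda>i. i \<prec> n) r Fr" "\<forall>i. i \<prec> n \<longrightarrow> r i \<epsilon> C" using Fr unfolding s_fun_iff by blast
    obtain s where s: "graph_set (\<lambda>i. i \<prec> n \<oplus> on) s Fs" "\<forall>i. i \<prec> n \<oplus> on \<longrightarrow> s i \<epsilon> C" using Fs unfolding s_fun_iff by blast
    note g = graph_set_pr[OF a(1)] graph_set_pr[OF r(1)] graph_set_pr[OF s(1)]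
    have "s (i \<oplus> on) = s i \<^bold>+\<^sub>R a i \<^bold>\<cdot>\<^sub>R r i" if "i \<prec> n" for i
      using st that unfolding g add_graph_iff mult_graph_iff by metis
    moreover have "s ze = z" "s n = b" using Fz Fb unfolding g by auto
    moreover have "seq_fun n a" "seq_fun n r" "seq_fun (n \<oplus> on) s" using a r s unfolding seq_fun_def by blast+
    ultimately show ?r using a(2) r(2) s(2) by (intro exI[of _ n] exI[of _ a] exI[of _ r] exI[of _ s]) simp
  next
    assume ?r
    then obtain n a r s where seq_fun: "seq_fun n a" "seq_fun n r" "seq_fun (n \<oplus> on) s" and
      st: "\<forall>i. i \<prec> n \<longrightarrow> P (a i) \<and> r i \<epsilon> C \<and> s (i \<oplus> on) = s i \<^bold>+\<^sub>R a i \<^bold>\<cdot>\<^sub>R r i" and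
      sC: "\<forall>i. i \<prec> n \<oplus> on \<longrightarrow> s i \<epsilon> C" and s0: "s ze = z" and sn: "s n = b"
      by (elim exE conjE) (rule that)
    obtain Fa Fr Fs where F: "graph_set (\<lambda>i. i \<prec> n) a Fa" "graph_set (\<lambda>i. i \<prec> n) r Fr" "graph_set (\<lambda>i. i \<prec> n \<oplus> on) s Fs"
      using seq_fun unfolding seq_fun_def by blast
    note g = graph_set_pr[OF F(1)] graph_set_pr[OF F(2)] graph_set_pr[OF F(3)]
    have "s_fun Fa (\<lambda>i. i \<prec> n) P" "s_fun Fr (\<lambda>i. i \<prec> n) (\<lambda>x. x \<epsilon> C)" "s_fun Fs (\<lambda>i. i \<prec> n \<oplus> on) (\<lambda>x. x \<epsilon> C)"
      using F st sC unfolding s_fun_iff by blast+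
    moreover have "\<exists>x y p u v. pr i x \<epsilon> Fa \<and> pr i y \<epsilon> Fr \<and> pr (pr x y) p \<epsilon> M \<and>
        pr i u \<epsilon> Fs \<and> pr (pr u p) v \<epsilon> A \<and> pr (i \<oplus> on) v \<epsilon> Fs" if "i \<prec> n" for i
      using st sC P that succ_ls[OF that] unfolding g add_graph_iff mult_graph_iff by auto
    moreover have "pr ze z \<epsilon> Fs" "pr n b \<epsilon> Fs"
      unfolding g using s0 sn ze_ls n_ls by auto
    ultimately show ?l unfolding s_ideal_def
      by (intro exI[of _ n] exI[of _ Fa] exI[of _ Fr] exI[of _ Fs]) simp
  }
qed

lemma ideal_closed: "ideal P b \<Longrightarrow> b \<epsilon> C"
  unfolding s_ideal_def s_fun_def by auto

lemma ideal_z: assumes P: "\<forall>x. P x \<longrightarrow> x \<epsilon> C" shows "ideal P z"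
  unfolding ideal_iff[OF P]
proof (intro exI conjI)
  show "seq_fun ze (\<lambda>_. z)" "seq_fun ze (\<lambda>_. z)" by (rule seq_fun_ze)+
  \<comment> \<open>The partial sums of the empty sum consist of a single entry; the constant
    function is written as an update so that appending to the empty sequence applies.\<close>
  show "seq_fun (ze \<oplus> on) ((\<lambda>_. z)(ze := z))" by (intro seq_fun_append seq_fun_ze)
qed auto

text \<open>One more multiple of a generator is enough for what follows, so the sum of two arbitrary
  elements, which would ask for concatenation of sequences, is never formed.\<close>

lemma ideal_append:
  assumes P: "\<forall>x. P x \<longrightarrow> x \<epsilon> C" and d: "ideal P d" and x: "P x" and y: "y \<epsilon> C"
  shows "ideal P (d \<^bold>+\<^sub>R x \<^bold>\<cdot>\<^sub>R y)"
proof -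
  obtain n a r s where seq_fun: "seq_fun n a" "seq_fun n r" "seq_fun (n \<oplus> on) s" and
    st: "\<forall>i. i \<prec> n \<longrightarrow> P (a i) \<and> r i \<epsilon> C \<and> s (i \<oplus> on) = s i \<^bold>+\<^sub>R a i \<^bold>\<cdot>\<^sub>R r i" and
    sC: "\<forall>i. i \<prec> n \<oplus> on \<longrightarrow> s i \<epsilon> C" and s0: "s ze = z" and sn: "s n = d"
    using d unfolding ideal_iff[OF P] by (elim exE conjE) (rule that)
  let ?v = "d \<^bold>+\<^sub>R x \<^bold>\<cdot>\<^sub>R y"
  have irr: "n \<noteq> n \<oplus> on" "\<And>i. i \<prec> n \<Longrightarrow> i \<noteq> n" "\<And>i. i \<prec> n \<Longrightarrow> i \<noteq> n \<oplus> on" "ze \<noteq> n \<oplus> on"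
    using ls_irrefl ls_succ succ_neq_ze by metis+
  have succ: "i \<oplus> on \<noteq> n \<oplus> on" if "i \<prec> n" for i
    using that irr(2) succ_inj by blast
  show ?thesis
    unfolding ideal_iff[OF P]
  proof (intro exI conjI)
    \<comment> \<open>There is one partial sum more than there are summands, so the new partial sum
      sits at \<open>n \<oplus> on\<close>.\<close>
    show "seq_fun (n \<oplus> on) (a(n := x))" "seq_fun (n \<oplus> on) (r(n := y))" "seq_fun (n \<oplus> on \<oplus> on) (s(n \<oplus> on := ?v))"
      using seq_fun by (auto intro: seq_fun_append)
    show "\<forall>i. i \<prec> n \<oplus> on \<longrightarrow> P ((a(n := x)) i) \<and> (r(n := y)) i \<epsilon> C \<and>
        (s(n \<oplus> on := ?v)) (i \<oplus> on) = (s(n \<oplus> on := ?v)) i \<^bold>+\<^sub>R (a(n := x)) i \<^bold>\<cdot>\<^sub>R (r(n := y)) i"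
      unfolding ls_succ using st x y sn irr succ by auto
    show "\<forall>i. i \<prec> n \<oplus> on \<oplus> on \<longrightarrow> (s(n \<oplus> on := ?v)) i \<epsilon> C"
    proof (intro allI impI)
      fix i assume "i \<prec> n \<oplus> on \<oplus> on"
      then have "i \<prec> n \<oplus> on \<or> i = n \<oplus> on" using ls_succ by blast
      then show "(s(n \<oplus> on := ?v)) i \<epsilon> C"
        using sC ideal_closed[OF d] P x y by auto
    qed
  qed (use s0 irr in auto)
qed

lemma seq_fun_scale:
  assumes g: "seq_fun n g" and gC: "\<And>i. i \<prec> n \<Longrightarrow> g i \<epsilon> C" and t: "t \<epsilon> C"
  shows "seq_fun n (\<lambda>i. g i \<^bold>\<cdot>\<^sub>R t)"
proof -
  obtain F where "\<forall>i y. pr i y \<epsilon> F \<longleftrightarrow> i \<prec> n \<and> y = g i" using seq_fun_graph[OF g] ..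
  then have F: "pr i y \<epsilon> F \<longleftrightarrow> i \<prec> n \<and> y = g i" for i y by simp
  show ?thesis
  proof (rule seq_fun_I[of "\<lambda>i y. \<exists>w. pr i w \<epsilon> F \<and> pr (pr w t) y \<epsilon> M"])
    show "sigma1 (Suc (Suc 0)) (\<lambda>e. \<exists>w. pr (e 0) w \<epsilon> F \<and> pr (pr w t) (e (Suc 0)) \<epsilon> M)"
      by (intro sigma1_intros delta0_intros term_fun_pr; simp)
  qed (use gC t in \<open>simp add: F mult_graph_iff\<close>)
qed

text \<open>Multiplying the coefficients and the partial sums by \<open>t\<close> preserves the
  recursion, with the generators left as they are.\<close>

lemma ideal_scale:
  assumes P: "\<forall>x. P x \<longrightarrow> x \<epsilon> C" and d: "ideal P d" and t: "t \<epsilon> C"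
  shows "ideal P (d \<^bold>\<cdot>\<^sub>R t)"
proof -
  obtain n a r s where seq_fun: "seq_fun n a" "seq_fun n r" "seq_fun (n \<oplus> on) s" and
    st: "\<forall>i. i \<prec> n \<longrightarrow> P (a i) \<and> r i \<epsilon> C \<and> s (i \<oplus> on) = s i \<^bold>+\<^sub>R a i \<^bold>\<cdot>\<^sub>R r i" and
    sC: "\<forall>i. i \<prec> n \<oplus> on \<longrightarrow> s i \<epsilon> C" and s0: "s ze = z" and sn: "s n = d"
    using d unfolding ideal_iff[OF P] by (elim exE conjE) (rule that)
  show ?thesis
    unfolding ideal_iff[OF P]
  proof (intro exI conjI)
    show "seq_fun n a" by fact
    show "seq_fun n (\<lambda>i. r i \<^bold>\<cdot>\<^sub>R t)" "seq_fun (n \<oplus> on) (\<lambda>i. s i \<^bold>\<cdot>\<^sub>R t)"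
      using seq_fun st sC t by (auto intro: seq_fun_scale)
    show "\<forall>i. i \<prec> n \<longrightarrow> P (a i) \<and> r i \<^bold>\<cdot>\<^sub>R t \<epsilon> C \<and>
        s (i \<oplus> on) \<^bold>\<cdot>\<^sub>R t = s i \<^bold>\<cdot>\<^sub>R t \<^bold>+\<^sub>R a i \<^bold>\<cdot>\<^sub>R (r i \<^bold>\<cdot>\<^sub>R t)"
      using st sC P t by (simp add: ls_succ ad_mu mu_assoc)
  qed (use sC s0 sn t in auto)
qed

text \<open>The length of the sum may be nonstandard, so this is
  \<open>\<Sigma>\<^sup>0\<^sub>1\<close> induction on the index of a partial sum, and
  \<open>R\<close> is restricted accordingly.\<close>

lemma ideal_induct:
  assumes P: "\<forall>x. P x \<longrightarrow> x \<epsilon> C" and R: "sigma1 (Suc 0) (\<lambda>e. R (e 0))"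
    and zero: "R z" and step: "\<And>u x y. R u \<Longrightarrow> u \<epsilon> C \<Longrightarrow> P x \<Longrightarrow> y \<epsilon> C \<Longrightarrow> R (u \<^bold>+\<^sub>R x \<^bold>\<cdot>\<^sub>R y)"
    and d: "ideal P d"
  shows "R d"
proof -
  obtain n a r s where seq_fun: "seq_fun n a" "seq_fun n r" "seq_fun (n \<oplus> on) s" and
    st: "\<forall>i. i \<prec> n \<longrightarrow> P (a i) \<and> r i \<epsilon> C \<and> s (i \<oplus> on) = s i \<^bold>+\<^sub>R a i \<^bold>\<cdot>\<^sub>R r i" and
    sC: "\<forall>i. i \<prec> n \<oplus> on \<longrightarrow> s i \<epsilon> C" and s0: "s ze = z" and sn: "s n = d"
    using d unfolding ideal_iff[OF P] by (elim exE conjE) (rule that)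
  obtain F where "\<forall>i y. pr i y \<epsilon> F \<longleftrightarrow> i \<prec> n \<oplus> on \<and> y = s i" using seq_fun_graph[OF seq_fun(3)] ..
  then have F: "pr i y \<epsilon> F \<longleftrightarrow> i \<prec> n \<oplus> on \<and> y = s i" for i y by simp
  \<comment> \<open>The partial sum is reached through its graph \<open>F\<close> and a quantifier
    over its value, since \<open>s\<close> is a function of the metalogic and no term of the
    language.\<close>
  have "n \<prec> n \<oplus> on \<longrightarrow> (\<exists>u. pr n u \<epsilon> F \<and> R u)"
  proof (rule sigma1_induct[of "\<lambda>i. i \<prec> n \<oplus> on \<longrightarrow> (\<exists>u. pr i u \<epsilon> F \<and> R u)"])
    show "sigma1 (Suc 0) (\<lambda>e. e 0 \<prec> n \<oplus> on \<longrightarrow> (\<exists>u. pr (e 0) u \<epsilon> F \<and> R u))"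
      by (intro sigma1_intros delta0_intros term_fun_pr sigma1_app1[OF R]; simp)
    show "ze \<prec> n \<oplus> on \<longrightarrow> (\<exists>u. pr ze u \<epsilon> F \<and> R u)"
      using zero by (simp add: F s0)
    fix i assume IH: "i \<prec> n \<oplus> on \<longrightarrow> (\<exists>u. pr i u \<epsilon> F \<and> R u)"
    show "i \<oplus> on \<prec> n \<oplus> on \<longrightarrow> (\<exists>u. pr (i \<oplus> on) u \<epsilon> F \<and> R u)"
    proof
      assume i: "i \<oplus> on \<prec> n \<oplus> on"
      have "i \<prec> i \<oplus> on" by (simp add: ls_succ)
      then have i': "i \<prec> n \<oplus> on" using i ls_trans by blast
      have "i \<noteq> n" using i ls_irrefl by metis
      then have "i \<prec> n" using i' ls_succ by blast
      then have "R (s (i \<oplus> on))" using st step[of "s i" "a i" "r i"] IH i' sC by (simp add: F)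
      then show "\<exists>u. pr (i \<oplus> on) u \<epsilon> F \<and> R u" using i by (simp add: F)
    qed
  qed
  then show ?thesis by (simp add: F ls_succ sn)
qed

text \<open>\<open>K\<close> is the definition of the ideal with each of the three sequences
  replaced by a triple of numbers. Sequences are turned into codes by \<open>seq_fun_code\<close>,
  and codes into sequences by \<open>seq_fun_of_code\<close>.\<close>

lemma sigma1_ideal:
  assumes P: "\<forall>x. x \<epsilon> X \<longrightarrow> x \<epsilon> C"
  shows "sigma1 (Suc 0) (\<lambda>e. ideal (\<lambda>x. x \<epsilon> X) (e 0))"
proof -
  define K where "K b \<longleftrightarrow> (\<exists>n Ba ca ma Br cr mr Bs cs ms. code_fun Bs cs ms ze z \<and> code_fun Bs cs ms n b \<and>
    (\<forall>i. i \<prec> n \<longrightarrow> (\<exists>x y p u v. code_fun Ba ca ma i x \<and> code_fun Br cr mr i y \<and> code_fun Bs cs ms i u \<and>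
      code_fun Bs cs ms (i \<oplus> on) v \<and> x \<epsilon> X \<and> y \<epsilon> C \<and> pr (pr x y) p \<epsilon> M \<and> pr (pr u p) v \<epsilon> A)))" for b
  have "sigma1 (Suc 0) (\<lambda>e. K (e 0))"
    unfolding K_def by (intro sigma1_intros delta0_intros term_fun_pr sigma1_D0[OF delta0_code_fun]; simp)
  then show ?thesis
  proof (rule sigma1_cong)
    fix e' :: "nat \<Rightarrow> 'm"
    define b where "b = e' 0"
    have "K b \<longleftrightarrow> ideal (\<lambda>x. x \<epsilon> X) b"
    proof
      assume "K b"
      then obtain n Ba ca ma Br cr mr Bs cs ms where c0: "code_fun Bs cs ms ze z" and cn: "code_fun Bs cs ms n b" and
        st: "\<forall>i. i \<prec> n \<longrightarrow> (\<exists>x y p u v. code_fun Ba ca ma i x \<and> code_fun Br cr mr i y \<and> code_fun Bs cs ms i u \<and>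
          code_fun Bs cs ms (i \<oplus> on) v \<and> x \<epsilon> X \<and> y \<epsilon> C \<and> pr (pr x y) p \<epsilon> M \<and> pr (pr u p) v \<epsilon> A)"
        unfolding K_def by (elim exE conjE) (rule that)
      define val where "val B c m i = (THE x. code_fun B c m i x)" for B c m i
      have val: "val B c m i = x" if "code_fun B c m i x" for B c m i x
        unfolding val_def using that code_fun_unique by blast
      define a where "a = val Ba ca ma"
      define r where "r = val Br cr mr"
      define s where "s = val Bs cs ms"
      have st': "code_fun Ba ca ma i (a i) \<and> code_fun Br cr mr i (r i) \<and> code_fun Bs cs ms i (s i) \<and>
          code_fun Bs cs ms (i \<oplus> on) (s (i \<oplus> on)) \<and> a i \<epsilon> X \<and> r i \<epsilon> C \<and> s i \<epsilon> C \<and> s (i \<oplus> on) = s i \<^bold>+\<^sub>R a i \<^bold>\<cdot>\<^sub>R r i"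
        if "i \<prec> n" for i
        using st[rule_format, OF that] val unfolding a_def r_def s_def add_graph_iff mult_graph_iff by metis
      have sn: "code_fun Bs cs ms n (s n)" "s n = b" "s ze = z"
        using val[OF cn] val[OF c0] cn unfolding s_def by simp_all
      have "seq_fun n a" "seq_fun n r" using st' by (auto intro: seq_fun_of_code)
      moreover have "seq_fun (n \<oplus> on) s"
        by (rule seq_fun_of_code[of _ Bs cs ms]) (use st' sn(1) ls_succ in blast)
      moreover have "s i \<epsilon> C" if "i \<prec> n \<oplus> on" for i
      proof (cases "i = n")
        \<comment> \<open>The recursion in \<open>K\<close> speaks about the sums at indices below
          \<open>n\<close>. The last sum is in the ring as a value of addition, or as
          \<open>z\<close> if there are no summands.\<close>
        case True
        consider "n = ze" | k where "n = k \<oplus> on" using ze_or_succ by blast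
        then show ?thesis
        proof cases
          case 1
          then show ?thesis using True sn(3) by simp
        next
          case 2
          then have "k \<prec> n" by (simp add: ls_succ)
          then have "s (k \<oplus> on) \<epsilon> C" using st'[of k] P by simp
          then show ?thesis using True 2 by simp
        qed
      next
        case False
        then show ?thesis using that st' ls_succ by blast
      qed
      ultimately show "ideal (\<lambda>x. x \<epsilon> X) b"
        unfolding ideal_iff[OF P] using st' sn
        by (intro exI[of _ n] exI[of _ a] exI[of _ r] exI[of _ s]) simp
    next
      assume "ideal (\<lambda>x. x \<epsilon> X) b"
      then obtain n a r s where seq_fun: "seq_fun n a" "seq_fun n r" "seq_fun (n \<oplus> on) s" and
        st: "\<forall>i. i \<prec> n \<longrightarrow> a i \<epsilon> X \<and> r i \<epsilon> C \<and> s (i \<oplus> on) = s i \<^bold>+\<^sub>R a i \<^bold>\<cdot>\<^sub>R r i" and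
        sC: "\<forall>i. i \<prec> n \<oplus> on \<longrightarrow> s i \<epsilon> C" and s0: "s ze = z" and sn: "s n = b"
        unfolding ideal_iff[OF P] by (elim exE conjE) (rule that)
      obtain Ba ca ma where a: "\<forall>i. i \<prec> n \<longrightarrow> code_fun Ba ca ma i (a i)"
        using seq_fun_code[OF seq_fun(1)] by (elim exE) (rule that)
      obtain Br cr mr where r: "\<forall>i. i \<prec> n \<longrightarrow> code_fun Br cr mr i (r i)"
        using seq_fun_code[OF seq_fun(2)] by (elim exE) (rule that)
      obtain Bs cs ms where s: "\<forall>i. i \<prec> n \<oplus> on \<longrightarrow> code_fun Bs cs ms i (s i)"
        using seq_fun_code[OF seq_fun(3)] by (elim exE) (rule that)
      have "ze \<prec> n \<oplus> on" using ls_pl1[of ze n] by simp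
      then have "code_fun Bs cs ms ze z" using s s0 by metis
      moreover have "code_fun Bs cs ms n b" using s sn by (auto simp: ls_succ)
      moreover have "\<exists>x y p u v. code_fun Ba ca ma i x \<and> code_fun Br cr mr i y \<and> code_fun Bs cs ms i u \<and>
          code_fun Bs cs ms (i \<oplus> on) v \<and> x \<epsilon> X \<and> y \<epsilon> C \<and> pr (pr x y) p \<epsilon> M \<and> pr (pr u p) v \<epsilon> A" if i: "i \<prec> n" for i
      proof -
        have "i \<oplus> on \<prec> n \<oplus> on" "i \<prec> n \<oplus> on" using i ls_pl_mono ls_succ by blast+
        then have f: "code_fun Ba ca ma i (a i)" "code_fun Br cr mr i (r i)" "code_fun Bs cs ms i (s i)"
          "code_fun Bs cs ms (i \<oplus> on) (s (i \<oplus> on))" "a i \<epsilon> X" "r i \<epsilon> C" "s i \<epsilon> C"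
          "s (i \<oplus> on) = s i \<^bold>+\<^sub>R a i \<^bold>\<cdot>\<^sub>R r i"
          using a r s st sC i by blast+
        have "a i \<epsilon> C" using f(5) P by blast
        with f show ?thesis
          unfolding add_graph_iff mult_graph_iff
          by (intro exI[of _ "a i"] exI[of _ "r i"] exI[of _ "a i \<^bold>\<cdot>\<^sub>R r i"] exI[of _ "s i"] exI[of _ "s (i \<oplus> on)"] conjI)
            simp_all
      qed
      ultimately show "K b" unfolding K_def by blast
    qed
    then show "K (e' 0) \<longleftrightarrow> ideal (\<lambda>x. x \<epsilon> X) (e' 0)" by (simp add: b_def)
  qed
qed

section \<open>Divisibility and linear combinations in the ring\<close>

abbreviation divs :: "'m \<Rightarrow> 'm \<Rightarrow> bool" where
  "divs \<equiv> s_divides C M"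

lemma divs_iff: "divs a b \<longleftrightarrow> a \<epsilon> C \<and> (\<exists>r. r \<epsilon> C \<and> b = a \<^bold>\<cdot>\<^sub>R r)"
  unfolding s_divides_def mult_graph_iff by blast

lemma lin_iff: "s_lin A M a x b y d \<longleftrightarrow> a \<epsilon> C \<and> x \<epsilon> C \<and> b \<epsilon> C \<and> y \<epsilon> C \<and> d = a \<^bold>\<cdot>\<^sub>R x \<^bold>+\<^sub>R b \<^bold>\<cdot>\<^sub>R y"
  unfolding s_lin_def mult_graph_iff add_graph_iff by auto

lemma divs_refl: "a \<epsilon> C \<Longrightarrow> divs a a"
  unfolding divs_iff using mu_e[of a] by (metis e_closed)

lemma divs_z: "a \<epsilon> C \<Longrightarrow> divs a z"
  unfolding divs_iff using mu_z[of a] by (metis z_closed)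

lemma divs_mu: assumes "divs a b" "t \<epsilon> C" shows "divs a (b \<^bold>\<cdot>\<^sub>R t)"
proof -
  obtain r where "a \<epsilon> C" "r \<epsilon> C" "b = a \<^bold>\<cdot>\<^sub>R r" using assms(1) unfolding divs_iff by blast
  then show ?thesis unfolding divs_iff using assms(2) by (auto simp: mu_assoc intro!: exI[of _ "r \<^bold>\<cdot>\<^sub>R t"])
qed

lemma divs_trans: "divs a b \<Longrightarrow> divs b c \<Longrightarrow> divs a c"
  using divs_mu unfolding divs_iff[of b c] by blast

lemma divs_ad: assumes "divs a b" "divs a c" shows "divs a (b \<^bold>+\<^sub>R c)"
proof -
  obtain r s where "a \<epsilon> C" "r \<epsilon> C" "b = a \<^bold>\<cdot>\<^sub>R r" "s \<epsilon> C" "c = a \<^bold>\<cdot>\<^sub>R s"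
    using assms unfolding divs_iff by blast
  then show ?thesis unfolding divs_iff by (auto simp: mu_ad intro!: exI[of _ "r \<^bold>+\<^sub>R s"])
qed

lemma sigma1_divs: "term_fun n S \<Longrightarrow> term_fun n T \<Longrightarrow> sigma1 n (\<lambda>e. divs (S e) (T e))"
  unfolding s_divides_def
  by (intro sigma1_ex sigma1_conj sigma1_D0[OF delta0_mem] term_fun_pr term_fun_var term_fun_lift; simp)

lemma ideal_divs:
  assumes P: "\<forall>x. P x \<longrightarrow> x \<epsilon> C" and c: "c \<epsilon> C" and dv: "\<And>a. P a \<Longrightarrow> divs c a" and d: "ideal P d"
  shows "divs c d"
proof (rule ideal_induct[OF P _ _ _ d, of "divs c"])
  show "sigma1 (Suc 0) (\<lambda>e. divs c (e 0))" by (intro sigma1_divs term_fun_const term_fun_var; simp)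
qed (use c dv in \<open>auto intro: divs_z divs_ad divs_mu\<close>)

text \<open>A sum of any length over \<open>a\<close> and \<open>b\<close> is contracted summand by
  summand, each new coefficient being added to that of \<open>a\<close> or to that of
  \<open>b\<close>.\<close>

lemma ideal_doubleton:
  assumes a: "a \<epsilon> C" and b: "b \<epsilon> C"
  shows "ideal (\<lambda>x. x = a \<or> x = b) d \<longleftrightarrow> (\<exists>x y. x \<epsilon> C \<and> y \<epsilon> C \<and> d = a \<^bold>\<cdot>\<^sub>R x \<^bold>+\<^sub>R b \<^bold>\<cdot>\<^sub>R y)"
proof
  have P: "\<forall>x. x = a \<or> x = b \<longrightarrow> x \<epsilon> C" using a b by blast
  {
    assume d: "ideal (\<lambda>x. x = a \<or> x = b) d"
    \<comment> \<open>Phrased with \<open>s_lin\<close> because the certificate for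
      \<open>sigma1\<close> is obtained from the graphs of the operations; \<open>R_iff\<close> is
      the form used for calculation.\<close>
    define R where "R d \<longleftrightarrow> (\<exists>x y. x \<epsilon> C \<and> y \<epsilon> C \<and> s_lin A M a x b y d)" for d
    have R_iff: "R d \<longleftrightarrow> (\<exists>x y. x \<epsilon> C \<and> y \<epsilon> C \<and> d = a \<^bold>\<cdot>\<^sub>R x \<^bold>+\<^sub>R b \<^bold>\<cdot>\<^sub>R y)" for d
      unfolding R_def lin_iff using a b by blast
    have "R d"
    proof (rule ideal_induct[OF P _ _ _ d, of R])
      show "sigma1 (Suc 0) (\<lambda>e. R (e 0))"
        unfolding R_def s_lin_def by (intro sigma1_intros delta0_intros term_fun_pr; simp)
      show "R z" unfolding R_iff using a b by (intro exI[of _ z]) simp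
      fix u x y assume "R u" "x = a \<or> x = b" and y: "y \<epsilon> C"
      then obtain v w where v: "v \<epsilon> C" "w \<epsilon> C" "u = a \<^bold>\<cdot>\<^sub>R v \<^bold>+\<^sub>R b \<^bold>\<cdot>\<^sub>R w" unfolding R_iff by blast
      from \<open>x = a \<or> x = b\<close> show "R (u \<^bold>+\<^sub>R x \<^bold>\<cdot>\<^sub>R y)"
      proof
        assume "x = a"
        then have "u \<^bold>+\<^sub>R x \<^bold>\<cdot>\<^sub>R y = a \<^bold>\<cdot>\<^sub>R (v \<^bold>+\<^sub>R y) \<^bold>+\<^sub>R b \<^bold>\<cdot>\<^sub>R w"
          using a b v y by (simp add: ring_simps)
        then show ?thesis unfolding R_iff using v y by blast
      next
        assume "x = b"
        then have "u \<^bold>+\<^sub>R x \<^bold>\<cdot>\<^sub>R y = a \<^bold>\<cdot>\<^sub>R v \<^bold>+\<^sub>R b \<^bold>\<cdot>\<^sub>R (w \<^bold>+\<^sub>R y)"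
          using a b v y by (simp add: ring_simps)
        then show ?thesis unfolding R_iff using v y by blast
      qed
    qed
    then show "\<exists>x y. x \<epsilon> C \<and> y \<epsilon> C \<and> d = a \<^bold>\<cdot>\<^sub>R x \<^bold>+\<^sub>R b \<^bold>\<cdot>\<^sub>R y" unfolding R_iff .
  next
    assume "\<exists>x y. x \<epsilon> C \<and> y \<epsilon> C \<and> d = a \<^bold>\<cdot>\<^sub>R x \<^bold>+\<^sub>R b \<^bold>\<cdot>\<^sub>R y"
    then obtain x y where xy: "x \<epsilon> C" "y \<epsilon> C" "d = a \<^bold>\<cdot>\<^sub>R x \<^bold>+\<^sub>R b \<^bold>\<cdot>\<^sub>R y" by blast
    have "ideal (\<lambda>x. x = a \<or> x = b) (z \<^bold>+\<^sub>R a \<^bold>\<cdot>\<^sub>R x)"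
      by (rule ideal_append[OF P ideal_z[OF P]]) (use xy in simp_all)
    then have "ideal (\<lambda>x. x = a \<or> x = b) (z \<^bold>+\<^sub>R a \<^bold>\<cdot>\<^sub>R x \<^bold>+\<^sub>R b \<^bold>\<cdot>\<^sub>R y)"
      by (rule ideal_append[OF P]) (use xy in simp_all)
    then show "ideal (\<lambda>x. x = a \<or> x = b) d" using xy a by simp
  }
qed

lemma bezout_pairs_E:
  assumes "bezout_pairs C A M" "a \<epsilon> C" "b \<epsilon> C"
  obtains d x y where "d \<epsilon> C" "divs d a" "divs d b" "x \<epsilon> C" "y \<epsilon> C" "d = a \<^bold>\<cdot>\<^sub>R x \<^bold>+\<^sub>R b \<^bold>\<cdot>\<^sub>R y"
proof -
  obtain d where gcd: "s_gcd C M (\<lambda>x. x = a \<or> x = b) d"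
    and lin: "\<exists>x. x \<epsilon> C \<and> (\<exists>y. y \<epsilon> C \<and> s_lin A M a x b y d)"
    using assms(1)[unfolded bezout_pairs_def, rule_format, OF assms(2,3)] by (elim exE conjE) (rule that; blast)
  obtain x y where xy: "x \<epsilon> C" "y \<epsilon> C" "d = a \<^bold>\<cdot>\<^sub>R x \<^bold>+\<^sub>R b \<^bold>\<cdot>\<^sub>R y"
    using lin unfolding lin_iff by blast
  have "d \<epsilon> C" "divs d a" "divs d b" using gcd unfolding s_gcd_def by simp_all
  then show thesis using xy by (rule that)
qed

section \<open>The implications between the four properties\<close>

lemma bezout_pairs_imp_principal_sums: assumes "bezout_pairs C A M" shows "principal_sums C A M"
  unfolding principal_sums_def
proof (intro allI impI)
  fix a b assume ab: "a \<epsilon> C" "b \<epsilon> C"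
  obtain d x y where d: "d \<epsilon> C" "divs d a" "divs d b" and xy: "x \<epsilon> C" "y \<epsilon> C"
    and d_eq: "d = a \<^bold>\<cdot>\<^sub>R x \<^bold>+\<^sub>R b \<^bold>\<cdot>\<^sub>R y"
    using bezout_pairs_E[OF assms ab] by metis
  have "(\<exists>r. r \<epsilon> C \<and> (\<exists>s. s \<epsilon> C \<and> s_lin A M a r b s c)) \<longleftrightarrow> divs d c" for c
  proof
    assume "\<exists>r. r \<epsilon> C \<and> (\<exists>s. s \<epsilon> C \<and> s_lin A M a r b s c)"
    then show "divs d c" unfolding lin_iff using d by (auto intro: divs_ad divs_mu)
  next
    assume "divs d c"
    then obtain t where t: "t \<epsilon> C" "c = d \<^bold>\<cdot>\<^sub>R t" unfolding divs_iff by blast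
    then have "c = a \<^bold>\<cdot>\<^sub>R (x \<^bold>\<cdot>\<^sub>R t) \<^bold>+\<^sub>R b \<^bold>\<cdot>\<^sub>R (y \<^bold>\<cdot>\<^sub>R t)"
      using d_eq xy ab by (simp add: ad_mu mu_assoc)
    then show "\<exists>r. r \<epsilon> C \<and> (\<exists>s. s \<epsilon> C \<and> s_lin A M a r b s c)"
      unfolding lin_iff using xy t ab mu_closed by blast
  qed
  then show "\<exists>d. d \<epsilon> C \<and> (\<forall>c. (\<exists>r. r \<epsilon> C \<and> (\<exists>s. s \<epsilon> C \<and> s_lin A M a r b s c)) \<longleftrightarrow>
      (\<exists>r. r \<epsilon> C \<and> pr (pr d r) c \<epsilon> M))"
    unfolding s_divides_def using d(1) by blast
qed

text \<open>As \<open>a\<close> and \<open>b\<close> lie in the sum, \<open>d\<close> divides them;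
  as \<open>d\<close> lies in its own ideal, it is a linear combination, which every common divisor
  divides.\<close>

lemma principal_sums_imp_bezout_pairs: assumes "principal_sums C A M" shows "bezout_pairs C A M"
  unfolding bezout_pairs_def
proof (intro allI impI)
  fix a b assume ab: "a \<epsilon> C" "b \<epsilon> C"
  obtain d where d: "d \<epsilon> C" and
    "\<forall>c. (\<exists>r. r \<epsilon> C \<and> (\<exists>s. s \<epsilon> C \<and> s_lin A M a r b s c)) \<longleftrightarrow> divs d c"
    using assms[unfolded principal_sums_def s_divides_def[symmetric], rule_format, OF ab] by (elim exE conjE) (rule that)
  then have iff: "divs d c \<longleftrightarrow> (\<exists>r. r \<epsilon> C \<and> (\<exists>s. s \<epsilon> C \<and> s_lin A M a r b s c))" for c
    by simp
  have "s_lin A M a e b z a" "s_lin A M a z b e b" unfolding lin_iff using ab by auto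
  then have da: "divs d a" "divs d b" unfolding iff using e_closed z_closed by blast+
  obtain x y where xy: "x \<epsilon> C" "y \<epsilon> C" "s_lin A M a x b y d"
    using divs_refl[OF d] unfolding iff by blast
  have "divs c d" if "divs c a" "divs c b" for c
    using xy that unfolding lin_iff by (auto intro: divs_ad divs_mu)
  then have "s_gcd C M (\<lambda>x. x = a \<or> x = b) d" unfolding s_gcd_def using d da by auto
  then show "\<exists>d. s_gcd C M (\<lambda>x. x = a \<or> x = b) d \<and> (\<exists>x. x \<epsilon> C \<and> (\<exists>y. y \<epsilon> C \<and> s_lin A M a x b y d))"
    using xy by blast
qed

text \<open>Carrying membership in the ideal through the induction settles maximality at the end,
  since by \<open>ideal_divs\<close> every common divisor of \<open>X\<close> divides each element
  of the ideal. The universal clause of a gcd would spoil the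
  \<open>\<Sigma>\<^sup>0\<^sub>1\<close> form.\<close>

lemma bezout_pairs_imp_bezout_finite_sets: assumes p1: "bezout_pairs C A M" shows "bezout_finite_sets C A M z"
  unfolding bezout_finite_sets_def
proof (intro allI impI, elim conjE exE)
  fix X k assume k: "\<forall>i. i \<epsilon> X \<longrightarrow> i \<prec> k" and X: "\<forall>a. a \<epsilon> X \<longrightarrow> a \<epsilon> C"
  have "\<exists>d. ideal (\<lambda>x. x \<epsilon> X) d \<and> (\<forall>x. x \<prec> k \<longrightarrow> x \<epsilon> X \<longrightarrow> divs d x)"
  proof (rule sigma1_induct[of "\<lambda>j. \<exists>d. ideal (\<lambda>x. x \<epsilon> X) d \<and> (\<forall>x. x \<prec> j \<longrightarrow> x \<epsilon> X \<longrightarrow> divs d x)"])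
    show "sigma1 (Suc 0) (\<lambda>e. \<exists>d. ideal (\<lambda>x. x \<epsilon> X) d \<and> (\<forall>x. x \<prec> e 0 \<longrightarrow> x \<epsilon> X \<longrightarrow> divs d x))"
      by (intro sigma1_ex sigma1_conj sigma1_app1[OF sigma1_ideal[OF X]] sigma1_ball sigma1_imp sigma1_divs delta0_mem term_fun_var; simp)
    show "\<exists>d. ideal (\<lambda>x. x \<epsilon> X) d \<and> (\<forall>x. x \<prec> ze \<longrightarrow> x \<epsilon> X \<longrightarrow> divs d x)"
      using ideal_z[OF X] by auto
    fix j assume "\<exists>d. ideal (\<lambda>x. x \<epsilon> X) d \<and> (\<forall>x. x \<prec> j \<longrightarrow> x \<epsilon> X \<longrightarrow> divs d x)"
    then obtain d where d: "ideal (\<lambda>x. x \<epsilon> X) d" "\<forall>x. x \<prec> j \<longrightarrow> x \<epsilon> X \<longrightarrow> divs d x" by blast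
    show "\<exists>d. ideal (\<lambda>x. x \<epsilon> X) d \<and> (\<forall>x. x \<prec> j \<oplus> on \<longrightarrow> x \<epsilon> X \<longrightarrow> divs d x)"
    proof (cases "j \<epsilon> X")
      case False
      then show ?thesis using d unfolding ls_succ by blast
    next
      case True
      then have jC: "j \<epsilon> C" using X by blast
      \<comment> \<open>The new \<open>g\<close> divides whatever \<open>d\<close> divides and also
        \<open>j\<close>; its linear form in \<open>d\<close> and \<open>j\<close> keeps it in the
        ideal by scaling \<open>d\<close> and appending one summand.\<close>
      obtain g x y where g: "divs g d" "divs g j" and xy: "x \<epsilon> C" "y \<epsilon> C"
        and g_eq: "g = d \<^bold>\<cdot>\<^sub>R x \<^bold>+\<^sub>R j \<^bold>\<cdot>\<^sub>R y"
        using bezout_pairs_E[OF p1 ideal_closed[OF d(1)] jC] by metis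
      have "ideal (\<lambda>x. x \<epsilon> X) (d \<^bold>\<cdot>\<^sub>R x \<^bold>+\<^sub>R j \<^bold>\<cdot>\<^sub>R y)"
        by (rule ideal_append[OF X ideal_scale[OF X d(1) xy(1)]]) (use True xy in simp_all)
      then have "ideal (\<lambda>x. x \<epsilon> X) g" unfolding g_eq .
      moreover have "\<forall>x. x \<prec> j \<oplus> on \<longrightarrow> x \<epsilon> X \<longrightarrow> divs g x"
        using d(2) g unfolding ls_succ by (auto intro: divs_trans)
      ultimately show ?thesis by blast
    qed
  qed
  then obtain d where d: "ideal (\<lambda>x. x \<epsilon> X) d" "\<forall>x. x \<prec> k \<longrightarrow> x \<epsilon> X \<longrightarrow> divs d x" by blast
  have "divs d a" if "a \<epsilon> X" for a using d(2) k that by blast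
  moreover have "divs c d" if "c \<epsilon> C" "\<forall>a. a \<epsilon> X \<longrightarrow> divs c a" for c
    using ideal_divs[OF X that(1) _ d(1)] that(2) by blast
  ultimately have "s_gcd C M (\<lambda>x. x \<epsilon> X) d"
    unfolding s_gcd_def using ideal_closed[OF d(1)] by blast
  then show "\<exists>d. s_gcd C M (\<lambda>x. x \<epsilon> X) d \<and> ideal (\<lambda>x. x \<epsilon> X) d" using d(1) by blast
qed

lemma bezout_finite_sets_E:
  assumes "bezout_finite_sets C A M z" "\<forall>i. i \<epsilon> X \<longrightarrow> i \<prec> k" "\<forall>a. a \<epsilon> X \<longrightarrow> a \<epsilon> C"
  obtains d where "s_gcd C M (\<lambda>x. x \<epsilon> X) d" "ideal (\<lambda>x. x \<epsilon> X) d"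
proof -
  have "(\<exists>k. \<forall>i. i \<epsilon> X \<longrightarrow> i \<prec> k) \<and> (\<forall>a. a \<epsilon> X \<longrightarrow> a \<epsilon> C)"
    using assms(2,3) by (intro conjI exI)
  from assms(1)[unfolded bezout_finite_sets_def, THEN spec, THEN mp, OF this] show thesis
    by (elim exE conjE) (rule that)
qed

lemma bezout_finite_sets_imp_bezout_pairs: assumes p2: "bezout_finite_sets C A M z" shows "bezout_pairs C A M"
  unfolding bezout_pairs_def
proof (intro allI impI)
  fix a b assume ab: "a \<epsilon> C" "b \<epsilon> C"
  have "sigma1 (Suc 0) (\<lambda>e. e 0 = a \<or> e 0 = b)" "sigma1 (Suc 0) (\<lambda>e. \<not> (e 0 = a \<or> e 0 = b))"
    by (intro sigma1_D0 delta0_intros; simp)+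
  then have "\<exists>X. \<forall>x. x \<epsilon> X \<longleftrightarrow> x = a \<or> x = b"
    using delta1_comprehension[of "\<lambda>x. x = a \<or> x = b"] by metis
  then obtain X where X: "\<forall>x. x \<epsilon> X \<longleftrightarrow> x = a \<or> x = b" by blast
  then have eq: "(\<lambda>x. x \<epsilon> X) = (\<lambda>x. x = a \<or> x = b)" by blast
  \<comment> \<open>Finiteness means boundedness, and \<open>a \<oplus> b \<oplus> on\<close>
    exceeds both elements.\<close>
  have "\<forall>i. i \<epsilon> X \<longrightarrow> i \<prec> a \<oplus> b \<oplus> on" "\<forall>i. i \<epsilon> X \<longrightarrow> i \<epsilon> C"
    using X ab ls_pl1 ls_pl2 by auto
  then obtain d where "s_gcd C M (\<lambda>x. x \<epsilon> X) d" "ideal (\<lambda>x. x \<epsilon> X) d"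
    by (rule bezout_finite_sets_E[OF p2])
  then show "\<exists>d. s_gcd C M (\<lambda>x. x = a \<or> x = b) d \<and> (\<exists>x. x \<epsilon> C \<and> (\<exists>y. y \<epsilon> C \<and> s_lin A M a x b y d))"
    unfolding eq ideal_doubleton[OF ab] lin_iff using ab by blast
qed

text \<open>The generators form a sequence, while the assumption speaks of bounded sets. The range
  of the sequence is a set because the quantifier over its indices can be bounded by
  \<open>n\<close>.\<close>

lemma bezout_finite_sets_imp_fg_ideals_principal: assumes p2: "bezout_finite_sets C A M z" shows "fg_ideals_principal C A M z"
  unfolding fg_ideals_principal_def
proof (intro allI impI, elim conjE exE)
  fix f n c assume c: "s_fun c (\<lambda>i. i \<prec> n) (\<lambda>x. x \<epsilon> C)"
    and f: "\<forall>x. (\<exists>i. pr i x \<epsilon> f) \<longleftrightarrow> ideal (\<lambda>y. \<exists>i. pr i y \<epsilon> c) x"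
  obtain g where g: "graph_set (\<lambda>i. i \<prec> n) g c" "\<forall>i. i \<prec> n \<longrightarrow> g i \<epsilon> C"
    using c unfolding s_fun_iff by blast
  note g_iff = graph_set_pr[OF g(1)]
  have "sigma1 (Suc 0) (\<lambda>e. \<exists>i. i \<prec> n \<and> pr i (e 0) \<epsilon> c)" "sigma1 (Suc 0) (\<lambda>e. \<not> (\<exists>i. i \<prec> n \<and> pr i (e 0) \<epsilon> c))"
    by (intro sigma1_D0 delta0_intros term_fun_pr; simp)+
  then have "\<exists>X. \<forall>x. x \<epsilon> X \<longleftrightarrow> (\<exists>i. i \<prec> n \<and> pr i x \<epsilon> c)"
    using delta1_comprehension[of "\<lambda>x. \<exists>i. i \<prec> n \<and> pr i x \<epsilon> c"] by metis
  then obtain X where X: "\<forall>x. x \<epsilon> X \<longleftrightarrow> (\<exists>i. i \<prec> n \<and> pr i x \<epsilon> c)" by blast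
  then have eq: "(\<lambda>y. \<exists>i. pr i y \<epsilon> c) = (\<lambda>x. x \<epsilon> X)" by (simp add: g_iff)
  have XC: "\<forall>x. x \<epsilon> X \<longrightarrow> x \<epsilon> C" using X g(2) by (auto simp: g_iff)
  \<comment> \<open>Collection bounds the values of the sequence, so that the range \<open>X\<close>
    is finite in the sense of the model.\<close>
  have "delta0 (Suc (Suc 0)) (\<lambda>e. pr (e 0) (e (Suc 0)) \<epsilon> c)" by (intro delta0_intros term_fun_pr; simp)
  then have "\<exists>b. \<forall>i. i \<prec> n \<longrightarrow> (\<exists>y. y \<prec> b \<and> pr i y \<epsilon> c)"
    using delta0_collection[of "\<lambda>i y. pr i y \<epsilon> c" n] by (simp add: g_iff) metis
  then obtain b where b: "\<forall>i. i \<prec> n \<longrightarrow> (\<exists>y. y \<prec> b \<and> pr i y \<epsilon> c)" ..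
  have "\<forall>x. x \<epsilon> X \<longrightarrow> x \<prec> b" using X b by (auto simp: g_iff)
  then obtain d where gcd: "s_gcd C M (\<lambda>x. x \<epsilon> X) d" and id: "ideal (\<lambda>x. x \<epsilon> X) d"
    using XC by (rule bezout_finite_sets_E[OF p2])
  have d: "d \<epsilon> C" "\<And>a. a \<epsilon> X \<Longrightarrow> divs d a" using gcd unfolding s_gcd_def by blast+
  have "ideal (\<lambda>x. x \<epsilon> X) x \<longleftrightarrow> divs d x" for x
  proof
    assume "ideal (\<lambda>x. x \<epsilon> X) x"
    then show "divs d x" using ideal_divs[OF XC d(1), of x] d(2) by blast
  next
    assume "divs d x"
    then show "ideal (\<lambda>x. x \<epsilon> X) x" using ideal_scale[OF XC id] unfolding divs_iff by blast
  qed
  then show "\<exists>c. c \<epsilon> C \<and> (\<forall>x. (\<exists>i. pr i x \<epsilon> f) \<longleftrightarrow> (\<exists>r. r \<epsilon> C \<and> pr (pr c r) x \<epsilon> M))"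
    unfolding f[rule_format] eq s_divides_def using d(1) by blast
qed

text \<open>The sum is enumerated by sending \<open>pr r s\<close> to the combination with
  coefficients \<open>r\<close> and \<open>s\<close>. Numbers that are not pairs of ring elements
  are sent to \<open>z\<close>, which lies in the sum and makes the enumeration total.\<close>

lemma fg_ideals_principal_imp_principal_sums: assumes p4: "fg_ideals_principal C A M z" shows "principal_sums C A M"
  unfolding principal_sums_def
proof (intro allI impI)
  fix a b assume ab: "a \<epsilon> C" "b \<epsilon> C"
  define carrier_pair where "carrier_pair t \<longleftrightarrow> (\<exists>r s. r \<epsilon> C \<and> s \<epsilon> C \<and> t = pr r s)" for t
  define g where "g t = (if carrier_pair t then (THE y. \<exists>r s. r \<epsilon> C \<and> s \<epsilon> C \<and> t = pr r s \<and> y = a \<^bold>\<cdot>\<^sub>R r \<^bold>+\<^sub>R b \<^bold>\<cdot>\<^sub>R s) else z)" for t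
  have g_pr: "g (pr r s) = a \<^bold>\<cdot>\<^sub>R r \<^bold>+\<^sub>R b \<^bold>\<cdot>\<^sub>R s" if "r \<epsilon> C" "s \<epsilon> C" for r s
    using that by (simp add: g_def carrier_pair_def)
  have g_z: "g t = z" if "\<not> carrier_pair t" for t
    using that by (simp add: g_def)
  \<comment> \<open>The default case is a negated existence statement; bounding the components by
    the pair keeps it, and so all of \<open>Q\<close>, within
    \<open>\<Sigma>\<^sup>0\<^sub>1\<close>.\<close>
  define Q where "Q t y \<longleftrightarrow> (\<exists>r s. r \<epsilon> C \<and> s \<epsilon> C \<and> t = pr r s \<and> s_lin A M a r b s y) \<or>
    (\<forall>r. r \<prec> t \<oplus> on \<longrightarrow> (\<forall>s. s \<prec> t \<oplus> on \<longrightarrow> \<not> (r \<epsilon> C \<and> s \<epsilon> C \<and> t = pr r s))) \<and> y = z" for t y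
  have "sigma1 (Suc (Suc 0)) (\<lambda>e. Q (e 0) (e (Suc 0)))"
    unfolding Q_def s_lin_def by (intro sigma1_intros delta0_intros term_fun_pr; simp)
  moreover have "Q t y \<longleftrightarrow> y = g t" for t y
  proof (cases "carrier_pair t")
    case True
    then obtain r s where t: "r \<epsilon> C" "s \<epsilon> C" "t = pr r s" unfolding carrier_pair_def by blast
    then have "\<not> (\<forall>r. r \<prec> t \<oplus> on \<longrightarrow> (\<forall>s. s \<prec> t \<oplus> on \<longrightarrow> \<not> (r \<epsilon> C \<and> s \<epsilon> C \<and> t = pr r s)))"
      using ls_pr1 ls_pr2 by blast
    then have "Q t y \<longleftrightarrow> s_lin A M a r b s y"
      unfolding Q_def t(3) using t(1,2) by auto
    then show ?thesis unfolding lin_iff using ab t by (simp add: g_pr)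
  next
    case False
    then show ?thesis unfolding Q_def g_z[OF False] unfolding carrier_pair_def by blast
  qed
  moreover have "delta0 (Suc 0) (\<lambda>e. e 0 = e 0)" by (intro delta0_intros; simp)
  ultimately obtain f where f: "graph_set (\<lambda>i. i = i) g f"
    using graph_comprehension[of "\<lambda>i. i = i" Q g] by blast
  have f_iff: "pr i y \<epsilon> f \<longleftrightarrow> y = g i" for i y
    using graph_set_pr[OF f] by simp
  define L where "L y \<longleftrightarrow> (\<exists>r s. r \<epsilon> C \<and> s \<epsilon> C \<and> y = a \<^bold>\<cdot>\<^sub>R r \<^bold>+\<^sub>R b \<^bold>\<cdot>\<^sub>R s)" for y
  have L_z: "L z" unfolding L_def using ab by (intro exI[of _ z]) simp
  have L_g: "L (g i)" for i
  proof (cases "carrier_pair i")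
    case True
    then obtain r s where i: "r \<epsilon> C" "s \<epsilon> C" "i = pr r s" unfolding carrier_pair_def by blast
    show ?thesis unfolding L_def i(3) g_pr[OF i(1,2)] using i(1,2) by blast
  next
    case False
    then show ?thesis using L_z g_z by simp
  qed
  have range: "(\<exists>i. pr i y \<epsilon> f) \<longleftrightarrow> L y" for y
  proof
    assume "L y"
    then obtain r s where "r \<epsilon> C" "s \<epsilon> C" "y = a \<^bold>\<cdot>\<^sub>R r \<^bold>+\<^sub>R b \<^bold>\<cdot>\<^sub>R s" unfolding L_def by blast
    then have "y = g (pr r s)" using g_pr by simp
    then show "\<exists>i. pr i y \<epsilon> f" unfolding f_iff by blast
  qed (use L_g in \<open>auto simp: f_iff\<close>)
  have LC: "y \<epsilon> C" if "L y" for y using that ab unfolding L_def by auto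
  have lin: "L (x \<^bold>\<cdot>\<^sub>R r \<^bold>+\<^sub>R y \<^bold>\<cdot>\<^sub>R s)" if L: "L x" "L y" and rs: "r \<epsilon> C" "s \<epsilon> C" for x y r s
  proof -
    obtain x1 x2 y1 y2 where xy: "x1 \<epsilon> C" "x2 \<epsilon> C" "x = a \<^bold>\<cdot>\<^sub>R x1 \<^bold>+\<^sub>R b \<^bold>\<cdot>\<^sub>R x2"
      "y1 \<epsilon> C" "y2 \<epsilon> C" "y = a \<^bold>\<cdot>\<^sub>R y1 \<^bold>+\<^sub>R b \<^bold>\<cdot>\<^sub>R y2"
      using L unfolding L_def by blast
    then have "x \<^bold>\<cdot>\<^sub>R r \<^bold>+\<^sub>R y \<^bold>\<cdot>\<^sub>R s = a \<^bold>\<cdot>\<^sub>R (x1 \<^bold>\<cdot>\<^sub>R r \<^bold>+\<^sub>R y1 \<^bold>\<cdot>\<^sub>R s) \<^bold>+\<^sub>R b \<^bold>\<cdot>\<^sub>R (x2 \<^bold>\<cdot>\<^sub>R r \<^bold>+\<^sub>R y2 \<^bold>\<cdot>\<^sub>R s)"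
      using ab rs by (simp add: ring_simps)
    then show ?thesis
      unfolding L_def using xy rs
      by (intro exI[of _ "x1 \<^bold>\<cdot>\<^sub>R r \<^bold>+\<^sub>R y1 \<^bold>\<cdot>\<^sub>R s"] exI[of _ "x2 \<^bold>\<cdot>\<^sub>R r \<^bold>+\<^sub>R y2 \<^bold>\<cdot>\<^sub>R s"]) simp
  qed
  have "s_sigma01_ideal C A M f"
    unfolding s_sigma01_ideal_def
  proof (intro conjI allI impI)
    show "s_fun f (\<lambda>i. i = i) (\<lambda>x. x \<epsilon> C)"
      unfolding s_fun_iff using f LC[OF L_g] by blast
    fix i j r s assume rs: "r \<epsilon> C" "s \<epsilon> C"
    obtain k where "pr k (g i \<^bold>\<cdot>\<^sub>R r \<^bold>+\<^sub>R g j \<^bold>\<cdot>\<^sub>R s) \<epsilon> f"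
      using lin[OF L_g L_g rs] range by blast
    then show "\<exists>k x y w. pr i x \<epsilon> f \<and> pr j y \<epsilon> f \<and> pr k w \<epsilon> f \<and> s_lin A M x r y s w"
      unfolding lin_iff f_iff using LC[OF L_g] rs
      by (intro exI[of _ k] exI[of _ "g i"] exI[of _ "g j"] exI[of _ "g i \<^bold>\<cdot>\<^sub>R r \<^bold>+\<^sub>R g j \<^bold>\<cdot>\<^sub>R s"]) simp
  qed
  moreover have "\<exists>n c. s_fun c (\<lambda>i. i \<prec> n) (\<lambda>x. x \<epsilon> C) \<and>
      (\<forall>x. (\<exists>i. pr i x \<epsilon> f) \<longleftrightarrow> ideal (\<lambda>y. \<exists>i. pr i y \<epsilon> c) x)"
  proof -
    \<comment> \<open>The sequence of the two generators, written as two successive updates to match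
      \<open>seq_fun_append\<close>.\<close>
    define h where "h = (\<lambda>_. a)(ze := a, ze \<oplus> on := b)"
    have h: "h ze = a" "h (ze \<oplus> on) = b"
      unfolding h_def using on_neq_ze[symmetric] by simp_all
    have "seq_fun (ze \<oplus> on \<oplus> on) h" unfolding h_def by (intro seq_fun_append seq_fun_ze)
    then obtain c where c: "graph_set (\<lambda>i. i \<prec> ze \<oplus> on \<oplus> on) h c" unfolding seq_fun_def by blast
    have two: "i \<prec> ze \<oplus> on \<oplus> on \<longleftrightarrow> i = ze \<or> i = ze \<oplus> on" for i by (auto simp only: ls_succ not_ls_ze)
    have "s_fun c (\<lambda>i. i \<prec> ze \<oplus> on \<oplus> on) (\<lambda>x. x \<epsilon> C)"
      unfolding s_fun_iff using c ab h two by metis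
    moreover have eq: "(\<lambda>y. \<exists>i. pr i y \<epsilon> c) = (\<lambda>y. y = a \<or> y = b)"
      unfolding graph_set_pr[OF c] two using h by metis
    have "\<forall>x. (\<exists>i. pr i x \<epsilon> f) \<longleftrightarrow> ideal (\<lambda>y. \<exists>i. pr i y \<epsilon> c) x"
      unfolding eq range L_def ideal_doubleton[OF ab] by simp
    ultimately show ?thesis by (intro exI conjI)
  qed
  ultimately have "\<exists>d. d \<epsilon> C \<and> (\<forall>x. (\<exists>i. pr i x \<epsilon> f) \<longleftrightarrow> (\<exists>r. r \<epsilon> C \<and> pr (pr d r) x \<epsilon> M))"
    by (intro p4[unfolded fg_ideals_principal_def, THEN spec, THEN mp] conjI)
  then obtain d where d: "d \<epsilon> C" "\<forall>x. (\<exists>i. pr i x \<epsilon> f) \<longleftrightarrow> (\<exists>r. r \<epsilon> C \<and> pr (pr d r) x \<epsilon> M)"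
    by (elim exE conjE) (rule that)
  have "(\<exists>r. r \<epsilon> C \<and> (\<exists>s. s \<epsilon> C \<and> s_lin A M a r b s c)) \<longleftrightarrow> (\<exists>i. pr i c \<epsilon> f)" for c
    unfolding range L_def lin_iff using ab by (simp cong: conj_cong)
  then show "\<exists>d. d \<epsilon> C \<and> (\<forall>c. (\<exists>r. r \<epsilon> C \<and> (\<exists>s. s \<epsilon> C \<and> s_lin A M a r b s c)) \<longleftrightarrow>
      (\<exists>r. r \<epsilon> C \<and> pr (pr d r) c \<epsilon> M))"
    using d by (intro exI[of _ d]) simp
qed

end

theorem theorem6p15:
  shows "RCA0 \<turnstile> sentence (\<^bold>\<forall>\<^sub>R R.
    (pairs_have_bezout_gcd R \<^bold>\<longleftrightarrow> finite_sets_have_bezout_gcd R) \<^bold>\<and>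
    (finite_sets_have_bezout_gcd R \<^bold>\<longleftrightarrow> sums_of_principal_are_principal R) \<^bold>\<and>
    (sums_of_principal_are_principal R \<^bold>\<longleftrightarrow> fg_sigma01_ideals_are_principal R))"
  (is "RCA0 \<turnstile> ?\<phi>")
proof (rule ccontr)
  have succ0: "sentence (\<^bold>\<forall>n. \<^bold>\<not> n \<^bold>+ \<^bold>1 \<^bold>= \<^bold>0) \<in> RCA0"
    and succ_inj: "sentence (\<^bold>\<forall>m n. m \<^bold>+ \<^bold>1 \<^bold>= n \<^bold>+ \<^bold>1 \<^bold>\<longrightarrow> m \<^bold>= n) \<in> RCA0"
    unfolding RCA0_def basic_axioms_def by blast+
  assume "\<not> RCA0 \<turnstile> ?\<phi>"
  then show False
  proof (rule countable_model_exists[OF succ0 succ_inj])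
    fix ze on :: nat and pl ti ls and mem :: "nat \<Rightarrow> nat \<Rightarrow> bool" and e E
    assume model: "\<And>\<phi> e E. \<phi> \<in> RCA0 \<Longrightarrow> arith_structure.sat ze on pl ti ls mem e E \<phi>"
      and false: "\<not> arith_structure.sat ze on pl ti ls mem e E ?\<phi>"
    interpret rca_model ze on pl ti ls mem
      by unfold_locales (rule model)
    have "(bezout_pairs C A M \<longleftrightarrow> bezout_finite_sets C A M z) \<and> (bezout_finite_sets C A M z \<longleftrightarrow> principal_sums C A M) \<and>
        (principal_sums C A M \<longleftrightarrow> fg_ideals_principal C A M z)" if "s_ring C A M z e" for C A M z e
    proof -
      interpret ring_in_model ze on pl ti ls mem C A M z e
        by unfold_locales (rule that)
      show ?thesis
        using bezout_pairs_imp_bezout_finite_sets bezout_finite_sets_imp_bezout_pairs bezout_pairs_imp_principal_sums principal_sums_imp_bezout_pairs bezout_finite_sets_imp_fg_ideals_principal fg_ideals_principal_imp_principal_sums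
        by blast
    qed
    then show False using false unfolding sat_equivalences by blast
  qed
qed

end
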